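(* Let $n\ge2$ and let $SC_n$ be the equational theory of symmetric $n$-Catalan algebras. Then $\mathrm{Struct}_G(SC_n)\cong G_{n,1}$.
   Context: All compositions are written in diagrammatic order. $x_i^j$ denotes the list $x_i,x_{i+1},\dots,x_j$ (empty if $i>j$). **The theory $SC_n$.** For $n\ge2$, $SC_n$ consists of one $n$-ary function symbol $\otimes$ and, for each $0<i<n$, the equations $$\otimes(x_1^i,\otimes(x_{i+1}^{i+n}),x_{i+n+1}^{2n-1})=\otimes(x_1^{i-1},\otimes(x_i^{i+n-1}),x_{i+n}^{2n-1}),$$ $$\otimes(x_1^{i-1},x_i,x_{i+1},x_{i+2}^n)=\otimes(x_1^{i-1},x_{i+1},x_i,x_{i+2}^n).$$ **Structure groups.** Let $\mathcal{E}=\langle\mathcal{F}\mid\mathcal{E}_{\mathcal{F}}\rangle_{\mathcal{V}}$ be an equational theory with a countably infinite variable set $\mathcal{V}$, balanced in that both sides of each equation have the same variables, and composable: any two terms $u,v$ occurring as sides of equations in $\mathcal{E}_{\mathcal{F}}$ are unifiable, i.e. $u^\varphi=v^\psi$ for some substitutions $\varphi,\psi:\mathcal{V}\to\mathbb{F}_{\mathcal{F}}(\mathcal{V})$, where $\mathbb{F}_{\mathcal{F}}(\mathcal{V})$ is the absolutely free term algebra and $u^\varphi$ the result of substituting. ($SC_n$ is balanced and composable.) For a balanced pair $(s,t)$, $\rho_{s,t}$ is the partial function on $\mathbb{F}_{\mathcal{F}}(\mathcal{V})$ with graph $\{(s^\varphi,t^\varphi)\}$, $\varphi$ ranging over substitutions.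 An address is a word in the letters $(F,i)$, $F\in\mathcal{F}$ of arity $m$, $1\le i\le m$; $\mathrm{sub}(t,\alpha)$ is the subterm of $t$ at the end of the path $\alpha$ from the root of the term tree. $\rho_{s,t}^\alpha$ is the partial function defined on those $u$ for which $\mathrm{sub}(u,\alpha)$ exists and lies in $\mathrm{dom}(\rho_{s,t})$, which replaces the subterm of $u$ at $\alpha$ by its image under $\rho_{s,t}$ and leaves the rest unchanged. $\mathrm{Struct}(\mathcal{E})$ is the (inverse) monoid of partial maps generated under composition by all $\rho_{s,t}^\alpha$ with $(s,t)$ or $(t,s)$ in $\mathcal{E}_{\mathcal{F}}$ and $\alpha$ an address. $\mathrm{Struct}_G(\mathcal{E})$ is the universal group of $\mathrm{Struct}(\mathcal{E})$, obtained by collapsing all idempotents to $1$. **The group $G_{n,1}$.** $n$-ary trees are defined inductively: a single vertex is an $n$-ary tree, and a root vertex with an ordered list of $n$ $n$-ary subtrees $T_1,\dots,T_n$ is an $n$-ary tree. $\ell(T)$ is the set of leaves of $T$. A simple expansion of $T$ replaces a leaf $v$ by a vertex $v$ with $n$ leaf children $\alpha_1(v),\dots,\alpha_n(v)$; an expansion is the result of finitely many successive simple expansions. An $n$-ary tree diagram is a triple $(T_1,T_2,\sigma)$ with $T_1,T_2$ $n$-ary trees with equally many leaves and $\sigma:\ell(T_1)\to\ell(T_2)$ a bijection. A simple expansion of it expands $T_1$ at a leaf $l$, $T_2$ at $\sigma(l)$, and replaces $\sigma$ by $\sigma'$ with $\sigma'(k)=\sigma(k)$ for $k\in\ell(T_1)\setminus\{l\}$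 and $\sigma'(\alpha_i(l))=\alpha_i(\sigma(l))$; expansions are finite iterates. Two tree diagrams are equivalent if they have a common expansion; equivalence classes $[(T_1,T_2,\sigma)]$ are $n$-ary tree symbols. $G_{n,1}$ is the set of $n$-ary tree symbols with product $[(T_1,T,\sigma)][(T,T_2,\sigma')]=[(T_1,T_2,\sigma\cdot\sigma')]$ (any two symbols have representatives of this form, since any two trees have a common expansion), inverse $[(T_1,T_2,\sigma)]^{-1}=[(T_2,T_1,\sigma^{-1})]$, unit $[(T,T,\mathrm{id})]$. *)

theory Defs
  imports "HOL-Algebra.Algebra"
begin

section \<open>Terms and equational theories\<close>

text \<open>The function symbols are the elements of the type \<open>'f\<close>, with arities given by
  \<open>ar :: 'f \<Rightarrow> nat\<close>, and the variables are the elements of \<open>'v\<close>.  The absolutely free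
  term algebra is the set \<open>terms ar\<close> of those raw terms that respect the arities.\<close>

datatype ('f, 'v) trm = Var 'v | App 'f "('f, 'v) trm list"

inductive_set terms :: "('f \<Rightarrow> nat) \<Rightarrow> ('f, 'v) trm set" for ar :: "'f \<Rightarrow> nat" where
  Var: "Var x \<in> terms ar"
| App: "length ts = ar f \<Longrightarrow> (\<forall>t\<in>set ts. t \<in> terms ar) \<Longrightarrow> App f ts \<in> terms ar"

primrec vars :: "('f, 'v) trm \<Rightarrow> 'v set" where
  "vars (Var x) = {x}"
| "vars (App f ts) = \<Union> (set (map vars ts))"

primrec subst :: "('v \<Rightarrow> ('f, 'v) trm) \<Rightarrow> ('f, 'v) trm \<Rightarrow> ('f, 'v) trm" where
  "subst \<phi> (Var x) = \<phi> x"
| "subst \<phi> (App f ts) = App f (map (subst \<phi>) ts)"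

definition substs :: "('f \<Rightarrow> nat) \<Rightarrow> ('v \<Rightarrow> ('f, 'v) trm) set" where
  "substs ar = {\<phi>. range \<phi> \<subseteq> terms ar}"

text \<open>A set of equations is a set of pairs of terms.\<close>

definition balanced :: "(('f, 'v) trm \<times> ('f, 'v) trm) set \<Rightarrow> bool" where
  "balanced E \<longleftrightarrow> (\<forall>(s, t)\<in>E. vars s = vars t)"

definition composable :: "('f \<Rightarrow> nat) \<Rightarrow> (('f, 'v) trm \<times> ('f, 'v) trm) set \<Rightarrow> bool" where
  "composable ar E \<longleftrightarrow>
     (\<forall>u \<in> Domain E \<union> Range E. \<forall>v \<in> Domain E \<union> Range E.
        \<exists>\<phi>\<in>substs ar. \<exists>\<psi>\<in>substs ar. subst \<phi> u = subst \<psi> v)"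


section \<open>The structure monoid and the structure group\<close>

text \<open>Partial maps are represented by their graphs.  Relational composition \<open>O\<close> is then
  composition of partial maps in diagrammatic order.\<close>

definition rho :: "('f \<Rightarrow> nat) \<Rightarrow> ('f, 'v) trm \<Rightarrow> ('f, 'v) trm \<Rightarrow> ('f, 'v) trm rel" where
  "rho ar s t = {(subst \<phi> s, subst \<phi> t) | \<phi>. \<phi> \<in> substs ar}"

definition addresses :: "('f \<Rightarrow> nat) \<Rightarrow> ('f \<times> nat) list set" where
  "addresses ar = {\<alpha>. \<forall>(f, i)\<in>set \<alpha>. 1 \<le> i \<and> i \<le> ar f}"

fun sub :: "('f, 'v) trm \<Rightarrow> ('f \<times> nat) list \<Rightarrow> ('f, 'v) trm option" where
  "sub t [] = Some t"
| "sub (Var x) (_ # \<alpha>) = None"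
| "sub (App f ts) ((g, i) # \<alpha>) =
     (if g = f \<and> 1 \<le> i \<and> i \<le> length ts then sub (ts ! (i - 1)) \<alpha> else None)"

text \<open>\<open>replace u \<alpha> w\<close> is only meaningful if \<open>sub u \<alpha>\<close> exists.\<close>

fun replace :: "('f, 'v) trm \<Rightarrow> ('f \<times> nat) list \<Rightarrow> ('f, 'v) trm \<Rightarrow> ('f, 'v) trm" where
  "replace t [] w = w"
| "replace (Var x) (_ # \<alpha>) w = Var x"
| "replace (App f ts) ((g, i) # \<alpha>) w = App f (ts[i - 1 := replace (ts ! (i - 1)) \<alpha> w])"

definition rho_at ::
  "('f \<Rightarrow> nat) \<Rightarrow> ('f, 'v) trm \<Rightarrow> ('f, 'v) trm \<Rightarrow> ('f \<times> nat) list \<Rightarrow> ('f, 'v) trm rel" where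
  "rho_at ar s t \<alpha> =
     {(u, replace u \<alpha> w) | u v w. u \<in> terms ar \<and> sub u \<alpha> = Some v \<and> (v, w) \<in> rho ar s t}"

inductive_set Struct_maps ::
  "('f \<Rightarrow> nat) \<Rightarrow> (('f, 'v) trm \<times> ('f, 'v) trm) set \<Rightarrow> ('f, 'v) trm rel set"
  for ar :: "'f \<Rightarrow> nat" and E :: "(('f, 'v) trm \<times> ('f, 'v) trm) set" where
  identity: "Id_on (terms ar) \<in> Struct_maps ar E"
| generator: "(s, t) \<in> E \<or> (t, s) \<in> E \<Longrightarrow> \<alpha> \<in> addresses ar \<Longrightarrow> rho_at ar s t \<alpha> \<in> Struct_maps ar E"
| composite: "f \<in> Struct_maps ar E \<Longrightarrow> g \<in> Struct_maps ar E \<Longrightarrow> f O g \<in> Struct_maps ar E"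

definition Struct ::
  "('f \<Rightarrow> nat) \<Rightarrow> (('f, 'v) trm \<times> ('f, 'v) trm) set \<Rightarrow> ('f, 'v) trm rel monoid" where
  "Struct ar E =
     \<lparr>carrier = Struct_maps ar E, monoid.mult = (\<lambda>f g. f O g), one = Id_on (terms ar)\<rparr>"

text \<open>The least monoid congruence identifying every idempotent with the unit.\<close>

inductive_set idem_cong :: "('a, 'b) monoid_scheme \<Rightarrow> ('a \<times> 'a) set" for M (structure) where
  idem: "e \<in> carrier M \<Longrightarrow> e \<otimes> e = e \<Longrightarrow> (e, \<one>) \<in> idem_cong M"
| refl: "a \<in> carrier M \<Longrightarrow> (a, a) \<in> idem_cong M"
| sym: "(a, b) \<in> idem_cong M \<Longrightarrow> (b, a) \<in> idem_cong M"
| trans: "(a, b) \<in> idem_cong M \<Longrightarrow> (b, c) \<in> idem_cong M \<Longrightarrow> (a, c) \<in> idem_cong M"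
| mult: "(a, b) \<in> idem_cong M \<Longrightarrow> (c, d) \<in> idem_cong M \<Longrightarrow> (a \<otimes> c, b \<otimes> d) \<in> idem_cong M"

definition universal_group :: "('a, 'b) monoid_scheme \<Rightarrow> 'a set monoid" where
  "universal_group M =
     \<lparr>carrier = carrier M // idem_cong M,
      monoid.mult = (\<lambda>A B. \<Union>a\<in>A. \<Union>b\<in>B. idem_cong M `` {a \<otimes>\<^bsub>M\<^esub> b}),
      one = idem_cong M `` {\<one>\<^bsub>M\<^esub>}\<rparr>"

definition Struct_G ::
  "('f \<Rightarrow> nat) \<Rightarrow> (('f, 'v) trm \<times> ('f, 'v) trm) set \<Rightarrow> ('f, 'v) trm rel set monoid" where
  "Struct_G ar E = universal_group (Struct ar E)"

lemma subst_cong_vars: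
  "subst \<phi> s = subst \<psi> s \<longleftrightarrow> (\<forall>x\<in>vars s. \<phi> x = \<psi> x)"
  by (induction s) auto

lemma single_valued_rho:
  assumes "vars t = vars s"
  shows "single_valued (rho ar s t)"
  using assms by (auto simp: single_valued_def rho_def subst_cong_vars)


section \<open>Symmetric n-Catalan algebras\<close>

datatype SC_symbol = Otimes

definition SC_arity :: "nat \<Rightarrow> SC_symbol \<Rightarrow> nat" where
  "SC_arity n = (\<lambda>_. n)"

abbreviation otimes :: "(SC_symbol, nat) trm list \<Rightarrow> (SC_symbol, nat) trm" where
  "otimes \<equiv> App Otimes"

text \<open>\<open>var_list i j\<close> is the list \<open>x\<^sub>i, \<dots>, x\<^sub>j\<close> of variables, empty if \<open>i > j\<close>.\<close>

definition var_list :: "nat \<Rightarrow> nat \<Rightarrow> (SC_symbol, nat) trm list" where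
  "var_list i j = map Var [i..<Suc j]"

definition SC :: "nat \<Rightarrow> ((SC_symbol, nat) trm \<times> (SC_symbol, nat) trm) set" where
  "SC n =
     {(otimes (var_list 1 i @ [otimes (var_list (i + 1) (i + n))] @ var_list (i + n + 1) (2 * n - 1)),
       otimes (var_list 1 (i - 1) @ [otimes (var_list i (i + n - 1))] @ var_list (i + n) (2 * n - 1)))
      | i. 0 < i \<and> i < n} \<union>
     {(otimes (var_list 1 (i - 1) @ [Var i, Var (i + 1)] @ var_list (i + 2) n),
       otimes (var_list 1 (i - 1) @ [Var (i + 1), Var i] @ var_list (i + 2) n))
      | i. 0 < i \<and> i < n}"

lemma vars_var_list:
  "\<Union> (set (map vars (var_list i j))) = {i..j}"
  by (auto simp: var_list_def)

lemma balanced_SC: "balanced (SC n)"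
proof -
  have vars: "vars (otimes (as @ bs)) = vars (otimes as) \<union> vars (otimes bs)"
    "vars (otimes (var_list i j)) = {i..j}" "vars (otimes [t]) = vars t"
    "vars (otimes [t, t']) = vars t \<union> vars t'" for as bs i j t t'
    using vars_var_list[of i j] by simp_all
  have "{1..i} \<union> ({i + 1..i + n} \<union> {i + n + 1..2 * n - 1}) =
      {1..i - 1} \<union> ({i..i + n - 1} \<union> {i + n..2 * n - 1})"
    if "0 < i" "i < n" for i
    using that by auto
  then show ?thesis
    unfolding balanced_def SC_def by (auto simp only: vars vars.simps(1) Un_commute)
qed

lemma composable_SC: "composable (SC_arity n) (SC n)"
proof -
  define B where "B = otimes (replicate n (Var 0))"
  define W where "W = otimes (replicate n B)"
  have B: "B \<in> terms (SC_arity n)"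
    by (auto simp: B_def SC_arity_def intro!: terms.intros)
  have map_const: "map (subst \<phi>) (var_list i j) = replicate (Suc j - i) c"
    if "\<And>k. i \<le> k \<Longrightarrow> k \<le> j \<Longrightarrow> \<phi> k = c" for \<phi> i j c
    using that by (auto simp: var_list_def simp del: upt_Suc intro!: nth_equalityI)
  have nested: "\<exists>\<phi>\<in>substs (SC_arity n).
      subst \<phi> (otimes (var_list 1 i @ [otimes (var_list (i + 1) (i + n))]
                @ var_list (i + n + 1) (2 * n - 1))) = W"
    if "i < n" for i
  proof
    let ?\<phi> = "\<lambda>k. if i + 1 \<le> k \<and> k \<le> i + n then Var 0 else B"
    show "?\<phi> \<in> substs (SC_arity n)"
      using B by (auto simp: substs_def intro: terms.Var)
    have 1: "map (subst ?\<phi>) (var_list 1 i) = replicate i B"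
      by (subst map_const[where c = B]) auto
    have 2: "map (subst ?\<phi>) (var_list (i + 1) (i + n)) = replicate n (Var 0)"
      by (subst map_const[where c = "Var 0"]) auto
    have 3: "map (subst ?\<phi>) (var_list (i + n + 1) (2 * n - 1)) = replicate (n - 1 - i) B"
      by (subst map_const[where c = B]) auto
    have "replicate i B @ [B] @ replicate (n - 1 - i) B = replicate n B"
      using that replicate_add[of i "Suc (n - 1 - i)" B] by simp
    then show "subst ?\<phi> (otimes (var_list 1 i @ [otimes (var_list (i + 1) (i + n))]
                @ var_list (i + n + 1) (2 * n - 1))) = W"
      unfolding W_def using 1 2 3 by (simp add: B_def del: replicate.simps)
  qed
  have flat: "\<exists>\<phi>\<in>substs (SC_arity n). subst \<phi> (otimes ts) = W"
    if "length ts = n" "set ts \<subseteq> range Var" for ts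
  proof
    show "(\<lambda>_. B) \<in> substs (SC_arity n)"
      using B by (auto simp: substs_def)
    show "subst (\<lambda>_. B) (otimes ts) = W"
    proof -
      have "subst (\<lambda>_. B) t = B" if "t \<in> set ts" for t
        using that \<open>set ts \<subseteq> range Var\<close> by auto
      then have "map (subst (\<lambda>_. B)) ts = map (\<lambda>_. B) ts" by simp
      then show ?thesis
        by (simp add: W_def map_replicate_const \<open>length ts = n\<close>)
    qed
  qed
  have ts: "length (var_list 1 (i - 1) @ [Var j, Var k] @ var_list (i + 2) n) = n"
    "set (var_list 1 (i - 1) @ [Var j, Var k] @ var_list (i + 2) n) \<subseteq> range Var"
    if "0 < i" "i < n" for i j k
    using that by (auto simp: var_list_def simp del: upt_Suc)
  have nested': "\<exists>\<phi>\<in>substs (SC_arity n).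
      subst \<phi> (otimes (var_list 1 (i - 1) @ [otimes (var_list i (i + n - 1))]
                @ var_list (i + n) (2 * n - 1))) = W"
    if "0 < i" "i < n" for i
    using nested[of "i - 1"] that by simp
  have W: "\<exists>\<phi>\<in>substs (SC_arity n). subst \<phi> u = W" if "u \<in> Domain (SC n) \<union> Range (SC n)" for u
    using that unfolding SC_def
    by (elim UnE DomainE RangeE CollectE exE conjE Pair_inject; hypsubst)
      (rule nested nested' flat[OF ts]; assumption)+
  show ?thesis
    unfolding composable_def
  proof (intro ballI)
    fix u v
    assume "u \<in> Domain (SC n) \<union> Range (SC n)" "v \<in> Domain (SC n) \<union> Range (SC n)"
    with W[of u] W[of v]
    show "\<exists>\<phi>\<in>substs (SC_arity n). \<exists>\<psi>\<in>substs (SC_arity n). subst \<phi> u = subst \<psi> v"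
      by metis
  qed
qed


section \<open>The group of n-ary tree symbols\<close>

datatype tree = Leaf | Node "tree list"

inductive_set trees :: "nat \<Rightarrow> tree set" for n :: nat where
  Leaf: "Leaf \<in> trees n"
| Node: "length Ts = n \<Longrightarrow> (\<forall>T\<in>set Ts. T \<in> trees n) \<Longrightarrow> Node Ts \<in> trees n"

text \<open>A vertex is encoded by the word of child indices on the path leading to it from the
  root.  The \<open>i\<close>-th child of \<open>v\<close> is \<open>v @ [i]\<close>, where \<open>1 \<le> i \<le> n\<close>.\<close>

function leaves :: "tree \<Rightarrow> nat list set" where
  "leaves Leaf = {[]}"
| "leaves (Node Ts) = (\<Union>i\<in>{1..length Ts}. (#) i ` leaves (Ts ! (i - 1)))"
  by pat_completeness auto
termination
proof (relation "measure size")
  fix Ts :: "tree list" and i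
  assume "i \<in> {1..length Ts}"
  then have "Ts ! (i - 1) \<in> set Ts" by auto
  then have "size (Ts ! (i - 1)) < Suc (size_list size Ts)"
    by (simp add: size_list_estimation' less_Suc_eq_le)
  then show "(Ts ! (i - 1), Node Ts) \<in> measure size" by simp
qed simp

text \<open>\<open>expand_tree n T v\<close> is the simple expansion of \<open>T\<close> at \<open>v\<close>, provided that \<open>v\<close> is a leaf
  of \<open>T\<close>.\<close>

fun expand_tree :: "nat \<Rightarrow> tree \<Rightarrow> nat list \<Rightarrow> tree" where
  "expand_tree n Leaf [] = Node (replicate n Leaf)"
| "expand_tree n (Node Ts) (i # v) = Node (Ts[i - 1 := expand_tree n (Ts ! (i - 1)) v])"
| "expand_tree n T v = T"

text \<open>A bijection between sets of leaves is a HOL function which is made unique by requiring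
  it to be \<open>undefined\<close> off its domain.\<close>

type_synonym tree_diagram = "tree \<times> tree \<times> (nat list \<Rightarrow> nat list)"

definition tree_diagrams :: "nat \<Rightarrow> tree_diagram set" where
  "tree_diagrams n =
     {(T1, T2, \<sigma>). T1 \<in> trees n \<and> T2 \<in> trees n \<and>
        \<sigma> \<in> extensional (leaves T1) \<and> bij_betw \<sigma> (leaves T1) (leaves T2)}"

text \<open>The leaves of the expanded tree that are not leaves of \<open>T1\<close> are the words
  \<open>k = l @ [i]\<close>, so that \<open>last k = i\<close>.\<close>

definition expand_bij ::
  "nat \<Rightarrow> tree \<Rightarrow> nat list \<Rightarrow> (nat list \<Rightarrow> nat list) \<Rightarrow> nat list \<Rightarrow> nat list" where
  "expand_bij n T1 l \<sigma> =
     (\<lambda>k\<in>leaves (expand_tree n T1 l). if k \<in> leaves T1 - {l} then \<sigma> k else \<sigma> l @ [last k])"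

inductive simple_expansion :: "nat \<Rightarrow> tree_diagram \<Rightarrow> tree_diagram \<Rightarrow> bool" for n :: nat where
  "l \<in> leaves T1 \<Longrightarrow>
     simple_expansion n (T1, T2, \<sigma>)
       (expand_tree n T1 l, expand_tree n T2 (\<sigma> l), expand_bij n T1 l \<sigma>)"

definition diagram_equiv :: "nat \<Rightarrow> tree_diagram rel" where
  "diagram_equiv n =
     {(d, d'). d \<in> tree_diagrams n \<and> d' \<in> tree_diagrams n \<and>
        (\<exists>e. (simple_expansion n)\<^sup>*\<^sup>* d e \<and> (simple_expansion n)\<^sup>*\<^sup>* d' e)}"

text \<open>The unit is the class of \<open>(T, T, id)\<close> for any tree \<open>T\<close>.  The choice of \<open>T\<close> does not
  matter, since all these diagrams are expansions of the one with \<open>T = Leaf\<close>.\<close>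

definition G_n1 :: "nat \<Rightarrow> tree_diagram set monoid" where
  "G_n1 n =
     \<lparr>carrier = tree_diagrams n // diagram_equiv n,
      monoid.mult = (\<lambda>A B. \<Union> {diagram_equiv n `` {(T1, T2, compose (leaves T1) \<sigma>' \<sigma>)}
                       | T1 T T2 \<sigma> \<sigma>'. (T1, T, \<sigma>) \<in> A \<and> (T, T2, \<sigma>') \<in> B}),
      one = diagram_equiv n `` {(Leaf, Leaf, \<lambda>v\<in>leaves Leaf. v)}\<rparr>"

end

theory Submission
  imports Defs "HOL-Library.Stream"
begin

text \<open>Both groups are realised as one group \<open>\<Gamma>\<close> of bijections of the set \<open>\<Omega>\<close> of infinite words
  over \<open>{1..n}\<close>, namely those which on words with a sufficiently long prefix only exchange that
  prefix.  A tree diagram \<open>(T1, T2, \<sigma>)\<close> acts by exchanging a leaf \<open>l\<close> of \<open>T1\<close> for \<open>\<sigma> l\<close>; two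
  diagrams are equivalent iff they act in the same way, because both can be expanded until the
  source is one and the same full tree.  An infinite word leads out of a term through a variable
  (\<open>lab\<close>), and for each map \<open>f\<close> in the structure monoid there is exactly one bijection in \<open>\<Gamma>\<close>
  that carries the labelling of \<open>u\<close> to that of \<open>f u\<close> for all \<open>u\<close> in the domain.  It is unique as
  \<open>f\<close> is defined on some term without repeated variables.  Since a term is determined by its
  labelling, maps with the trivial bijection are partial identities, so \<open>f\<close> and \<open>g\<close> with equal
  bijections are identified through the idempotents \<open>f O g\<inverse>\<close> and \<open>g\<inverse> O g\<close>.  Surjectivity is a
  coherence statement: terms with the same multiset of variables are connected by the equations,
  since each can be brought to the same right-nested normal form.\<close>

section \<open>Lists\<close>

text \<open>Two obstacles shape the proof. Structure maps are partial, and a map with empty domain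
  would be represented by every bijection. This is what \<open>deep\<close> is for: a term without
  variables near its root matches every linear left-hand side, and each map consumes only a bounded
  amount of depth, so a deep enough linear term lies in its domain. Secondly, closure of \<Gamma>
  under inverses is not visible from its definition, which bounds the prefix that is read but not
  the one that is written; it is obtained from tree diagrams, where inverting means swapping the
  trees. Coherence is applied to a single pair of terms per bijection: naming the leaves of the two
  trees of a diagram by variables, partners alike, gives linear terms \<open>u\<close> and
  \<open>v\<close>, and any structure map from \<open>u\<close> to \<open>v\<close> has the
  bijection of the diagram, whatever route it takes. The bound \<open>n \<ge> 2\<close> enters where
  a finite word is recovered from its action on infinite words, since over a single letter all words
  act alike, and where the number of symbols of a normal form is computed from the number of its
  variables.\<close>

lemma distinct_concat_nth:
  "distinct (concat xss) \<longleftrightarrow>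
     (\<forall>i<length xss. distinct (xss ! i)) \<and>
     (\<forall>i j. i < j \<longrightarrow> j < length xss \<longrightarrow> set (xss ! i) \<inter> set (xss ! j) = {})"
proof (induction xss)
  case (Cons xs xss)
  have 1: "(\<forall>i<length (xs # xss). distinct ((xs # xss) ! i)) \<longleftrightarrow>
      distinct xs \<and> (\<forall>i<length xss. distinct (xss ! i))"
    by (auto simp: less_Suc_eq_0_disj)
  have 2: "(\<forall>i j. i < j \<longrightarrow> j < length (xs # xss) \<longrightarrow> set ((xs # xss) ! i) \<inter> set ((xs # xss) ! j) = {}) \<longleftrightarrow>
      (\<forall>j<length xss. set xs \<inter> set (xss ! j) = {}) \<and>
      (\<forall>i j. i < j \<longrightarrow> j < length xss \<longrightarrow> set (xss ! i) \<inter> set (xss ! j) = {})"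
    (is "?L \<longleftrightarrow> ?A \<and> ?B")
  proof
    assume L: ?L
    have ?A using L by (metis One_nat_def Suc_less_eq length_Cons nth_Cons_0 nth_Cons_Suc zero_less_Suc)
    moreover have ?B using L by (metis Suc_less_eq length_Cons nth_Cons_Suc)
    ultimately show "?A \<and> ?B" by simp
  next
    assume R: "?A \<and> ?B"
    show ?L
    proof (intro allI impI)
      fix i j assume "i < j" "j < length (xs # xss)"
      then obtain j' where "j = Suc j'" "j' < length xss" "i \<le> j'" by (cases j) auto
      with R show "set ((xs # xss) ! i) \<inter> set ((xs # xss) ! j) = {}" by (cases i) auto
    qed
  qed
  have 3: "set xs \<inter> set (concat xss) = {} \<longleftrightarrow> (\<forall>j<length xss. set xs \<inter> set (xss ! j) = {})"
  proof -
    have "set xss = (!) xss ` {..<length xss}" by (auto simp: set_conv_nth)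
    then show ?thesis by auto
  qed
  show ?case unfolding 1 2 using Cons.IH 3 by auto
qed simp

text \<open>Adjacent transpositions generate all permutations. \<open>P\<close> is an arbitrary
  preorder on lists, so side conditions on length or on membership in the terms can be packed into
  it as implications. It serves for the arguments of \<open>otimes\<close> and for the variable
  lists of normal forms.\<close>

lemma mset_eq_adjacent_swaps:
  assumes refl: "\<And>xs. P xs xs"
    and trans: "\<And>xs ys zs. P xs ys \<Longrightarrow> P ys zs \<Longrightarrow> P xs zs"
    and swap: "\<And>as a b bs. P (as @ a # b # bs) (as @ b # a # bs)"
    and eq: "mset xs = mset ys"
  shows "P xs ys"
proof -
  have move: "P (pre @ x # us @ vs) (pre @ us @ x # vs)" for pre x us vs
  proof (induction us arbitrary: pre)
    case (Cons u us)
    have "P (pre @ x # u # us @ vs) (pre @ u # x # us @ vs)" by (rule swap)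
    then show ?case using Cons.IH[of "pre @ [u]"] trans by simp
  qed (simp add: refl)
  \<comment> \<open>The prefix \<open>pre\<close> absorbs the entries already in place, since
    \<open>P\<close> is not assumed to be compatible with prepending.\<close>
  have "P (pre @ xs) (pre @ ys)" for pre
    using eq
  proof (induction xs arbitrary: pre ys)
    case (Cons x xs)
    then obtain us vs where ys: "ys = us @ x # vs"
      by (metis list.set_intros(1) mset_eq_setD split_list)
    with Cons.prems have "mset xs = mset (us @ vs)" by simp
    then have "P (pre @ x # xs) (pre @ x # us @ vs)" using Cons.IH[of "us @ vs" "pre @ [x]"] by simp
    then show ?case using move trans ys by blast
  qed (simp add: refl)
  from this[of "[]"] show ?thesis by simp
qed

section \<open>Infinite words\<close>

locale catalan =
  fixes n :: nat
  assumes n2: "n \<ge> 2"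
begin

declare One_nat_def [simp del]

abbreviation \<Omega> :: "nat stream set" where
  "\<Omega> \<equiv> streams {1..n}"

abbreviation words :: "nat list set" where
  "words \<equiv> lists {1..n}"

lemma shift_in_iff [simp]: "w @- \<omega> \<in> \<Omega> \<longleftrightarrow> w \<in> words \<and> \<omega> \<in> \<Omega>"
  by (induction w) (simp_all add: streams_Stream)

lemma SCons_in_iff [simp]: "i ## \<omega> \<in> \<Omega> \<longleftrightarrow> i \<in> {1..n} \<and> \<omega> \<in> \<Omega>"
  by (rule streams_Stream)

lemma \<Omega>_nonempty: "\<exists>\<omega>. \<omega> \<in> \<Omega>"
proof -
  have "sconst 1 \<in> \<Omega>" using n2 by (auto intro: sconst_streams)
  then show ?thesis by blast
qed

lemma \<Omega>_cases:
  assumes "\<omega> \<in> \<Omega>"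
  obtains i \<omega>' where "\<omega> = i ## \<omega>'" "1 \<le> i" "i \<le> n" "\<omega>' \<in> \<Omega>"
proof (rule that)
  show "\<omega> = shd \<omega> ## stl \<omega>" by (rule stream.collapse[symmetric])
  show "1 \<le> shd \<omega>" "shd \<omega> \<le> n" "stl \<omega> \<in> \<Omega>"
    using assms streams_shd[OF assms] streams_stl[OF assms] by auto
qed

lemma \<Omega>_split:
  assumes "\<omega> \<in> \<Omega>"
  obtains w \<omega>' where "\<omega> = w @- \<omega>'" "length w = N" "w \<in> words" "\<omega>' \<in> \<Omega>"
proof (rule that)
  show "\<omega> = stake N \<omega> @- sdrop N \<omega>" by (rule stake_sdrop[symmetric])
  show "stake N \<omega> \<in> words" "sdrop N \<omega> \<in> \<Omega>"
    using assms shift_in_iff[of "stake N \<omega>" "sdrop N \<omega>"] unfolding stake_sdrop by blast+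
qed simp

lemma shift_eq_shift_length:
  "length w = length w' \<Longrightarrow> w @- \<omega> = w' @- \<omega>' \<longleftrightarrow> w = w' \<and> \<omega> = \<omega>'"
  by (induction w w' rule: list_induct2) auto

lemma shift_eq_shift_cases:
  assumes "w @- \<omega> = w' @- \<omega>'"
  obtains v where "w = w' @ v" "\<omega>' = v @- \<omega>" | v where "w' = w @ v" "\<omega> = v @- \<omega>'"
proof -
  have "(\<exists>v. w = w' @ v \<and> \<omega>' = v @- \<omega>) \<or> (\<exists>v. w' = w @ v \<and> \<omega> = v @- \<omega>')"
    using assms
  proof (induction w arbitrary: w')
    case (Cons a w)
    then show ?case by (cases w') auto
  qed auto
  with that show ?thesis by blast
qed

lemma shift_longer:
  assumes "w @- \<omega> = l @- \<omega>'" "length l \<le> length w"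
  obtains v where "w = l @ v" "\<omega>' = v @- \<omega>"
  using assms by (elim shift_eq_shift_cases) auto

section \<open>Prefix-local bijections of infinite words\<close>

text \<open>A graph instead of a function: nothing has to be fixed outside \<Omega>, and composition
  and inverse are \<open>O\<close> and converse, as for the maps in
  \<open>Struct_maps\<close>.\<close>

definition word_bij :: "nat stream rel \<Rightarrow> bool" where
  "word_bij q \<longleftrightarrow> Domain q = \<Omega> \<and> Range q = \<Omega> \<and> single_valued q \<and> single_valued (q\<inverse>)"

lemma word_bij_subset: "word_bij q \<Longrightarrow> (\<omega>, \<omega>') \<in> q \<Longrightarrow> \<omega> \<in> \<Omega> \<and> \<omega>' \<in> \<Omega>"
  by (auto simp: word_bij_def)

lemma word_bij_total: "word_bij q \<Longrightarrow> \<omega> \<in> \<Omega> \<Longrightarrow> \<exists>\<omega>'. (\<omega>, \<omega>') \<in> q"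
  unfolding word_bij_def by blast

lemma word_bij_onto: "word_bij q \<Longrightarrow> \<omega>' \<in> \<Omega> \<Longrightarrow> \<exists>\<omega>. (\<omega>, \<omega>') \<in> q"
  unfolding word_bij_def by blast

lemma word_bij_fun: "word_bij q \<Longrightarrow> (\<omega>, \<omega>') \<in> q \<Longrightarrow> (\<omega>, \<omega>'') \<in> q \<Longrightarrow> \<omega>' = \<omega>''"
  unfolding word_bij_def single_valued_def by blast

lemma word_bij_inj: "word_bij q \<Longrightarrow> (\<omega>, \<omega>'') \<in> q \<Longrightarrow> (\<omega>', \<omega>'') \<in> q \<Longrightarrow> \<omega> = \<omega>'"
  unfolding word_bij_def single_valued_def by blast

lemma word_bijI:
  assumes "q \<subseteq> \<Omega> \<times> \<Omega>"
    and "\<And>\<omega>. \<omega> \<in> \<Omega> \<Longrightarrow> \<exists>\<omega>'. (\<omega>, \<omega>') \<in> q"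
    and "\<And>\<omega>'. \<omega>' \<in> \<Omega> \<Longrightarrow> \<exists>\<omega>. (\<omega>, \<omega>') \<in> q"
    and "\<And>\<omega> \<omega>' \<omega>''. (\<omega>, \<omega>') \<in> q \<Longrightarrow> (\<omega>, \<omega>'') \<in> q \<Longrightarrow> \<omega>' = \<omega>''"
    and "\<And>\<omega> \<omega>' \<omega>''. (\<omega>, \<omega>'') \<in> q \<Longrightarrow> (\<omega>', \<omega>'') \<in> q \<Longrightarrow> \<omega> = \<omega>'"
  shows "word_bij q"
proof -
  have "Domain q = \<Omega>" "Range q = \<Omega>" using assms(1-3) by blast+
  moreover have "single_valued q" using assms(4) unfolding single_valued_def by blast
  moreover have "single_valued (q\<inverse>)" using assms(5) unfolding single_valued_def by blast
  ultimately show ?thesis unfolding word_bij_def by blast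
qed

text \<open>\<open>N\<close> bounds the prefixes that are read; the prefixes \<open>w'\<close> that
  are written may have any length, including 0.\<close>

definition prefix_local :: "nat \<Rightarrow> nat stream rel \<Rightarrow> bool" where
  "prefix_local N q \<longleftrightarrow>
     (\<forall>w\<in>words. length w = N \<longrightarrow> (\<exists>w'\<in>words. \<forall>\<omega>\<in>\<Omega>. (w @- \<omega>, w' @- \<omega>) \<in> q))"

text \<open>The Higman-Thompson group in its action on the Cantor space of infinite words.\<close>

definition \<Gamma> :: "nat stream rel set" where
  "\<Gamma> = {q. word_bij q \<and> (\<exists>N. prefix_local N q)}"

lemma prefix_local_mono:
  assumes "prefix_local N q" "N \<le> M"
  shows "prefix_local M q"
  unfolding prefix_local_def
proof (intro ballI impI)
  fix w assume w: "w \<in> words" "length w = M"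
  have "take N w \<in> words" "drop N w \<in> words" "length (take N w) = N"
    using w assms(2) by (auto simp: lists_eq_set dest: in_set_takeD in_set_dropD)
  then obtain w' where w': "w' \<in> words" "\<forall>\<omega>\<in>\<Omega>. (take N w @- \<omega>, w' @- \<omega>) \<in> q"
    using assms(1) unfolding prefix_local_def by blast
  have "(w @- \<omega>, (w' @ drop N w) @- \<omega>) \<in> q" if "\<omega> \<in> \<Omega>" for \<omega>
  proof -
    have "(take N w @- drop N w @- \<omega>, w' @- drop N w @- \<omega>) \<in> q"
      using w'(2) that \<open>drop N w \<in> words\<close> by simp
    then show ?thesis by (simp flip: shift_append)
  qed
  then show "\<exists>w'\<in>words. \<forall>\<omega>\<in>\<Omega>. (w @- \<omega>, w' @- \<omega>) \<in> q"
    using w'(1) \<open>drop N w \<in> words\<close> by (intro bexI[of _ "w' @ drop N w"]) auto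
qed

lemma prefix_localE:
  assumes "prefix_local N q" "w \<in> words" "N \<le> length w"
  obtains w' where "w' \<in> words" "\<And>\<omega>. \<omega> \<in> \<Omega> \<Longrightarrow> (w @- \<omega>, w' @- \<omega>) \<in> q"
  using prefix_local_mono[OF assms(1,3)] assms(2) unfolding prefix_local_def by blast

lemma word_bij_comp:
  assumes q: "word_bij q" "word_bij q'"
  shows "word_bij (q O q')"
proof -
  have "Range q = Domain q'" using q by (simp add: word_bij_def)
  then have "Domain (q O q') = Domain q" "Range (q O q') = Range q'" by blast+
  then show ?thesis
    using q unfolding word_bij_def by (simp add: single_valued_relcomp converse_relcomp)
qed

lemma word_bij_converse: "word_bij q \<Longrightarrow> word_bij (q\<inverse>)"
  unfolding word_bij_def by simp

lemma word_bij_comp_converse: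
  assumes "word_bij q"
  shows "q O q\<inverse> = Id_on \<Omega>"
  using word_bij_subset[OF assms] word_bij_total[OF assms] word_bij_inj[OF assms] by blast

text \<open>Cancellation of \<open>q\<close> in the group of bijections of \<Omega>.\<close>

lemma word_bij_idem:
  assumes "word_bij q" "q O q = q"
  shows "q = Id_on \<Omega>"
proof -
  have "q = q O (q O q\<inverse>)"
    using word_bij_subset[OF assms(1)] by (auto simp: word_bij_comp_converse[OF assms(1)])
  also have "\<dots> = q O q\<inverse>" using assms(2) by (simp flip: O_assoc)
  finally show ?thesis using word_bij_comp_converse[OF assms(1)] by simp
qed

text \<open>No function properly extends another one with the same domain. Several later identities
  between bijections are reduced in this way to one inclusion.\<close>

lemma word_bij_mono_eq:
  assumes "word_bij q" "word_bij q'" "q \<subseteq> q'"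
  shows "q = q'"
proof -
  have "(\<omega>, \<omega>') \<in> q" if q': "(\<omega>, \<omega>') \<in> q'" for \<omega> \<omega>'
  proof -
    obtain \<omega>'' where "(\<omega>, \<omega>'') \<in> q"
      using word_bij_total[OF assms(1)] word_bij_subset[OF assms(2) q'] by blast
    moreover from this have "\<omega>' = \<omega>''" using word_bij_fun[OF assms(2) q'] assms(3) by blast
    ultimately show ?thesis by simp
  qed
  then show ?thesis using assms(3) by auto
qed

lemma \<Gamma>_word_bij: "q \<in> \<Gamma> \<Longrightarrow> word_bij q"
  by (simp add: \<Gamma>_def)

lemma prefix_local_Id: "prefix_local N (Id_on \<Omega>)"
  unfolding prefix_local_def
proof (intro ballI impI)
  fix w assume "w \<in> words"
  then show "\<exists>w'\<in>words. \<forall>\<omega>\<in>\<Omega>. (w @- \<omega>, w' @- \<omega>) \<in> Id_on \<Omega>"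
    by (intro bexI[of _ w] ballI Id_onI) simp_all
qed

lemma \<Gamma>_Id: "Id_on \<Omega> \<in> \<Gamma>"
proof -
  have "word_bij (Id_on \<Omega>)" by (rule word_bijI) auto
  then show ?thesis using prefix_local_Id by (auto simp: \<Gamma>_def)
qed

lemma \<Gamma>_comp:
  assumes "q \<in> \<Gamma>" "q' \<in> \<Gamma>"
  shows "q O q' \<in> \<Gamma>"
proof -
  obtain N N' where N: "prefix_local N q" "prefix_local N' q'"
    using assms by (auto simp: \<Gamma>_def)
  \<comment> \<open>\<open>q\<close> reads the first \<open>N\<close> letters and may replace them
    by a shorter word; the next \<open>N'\<close> letters pass through unchanged and leave enough
    for \<open>q'\<close> to read.\<close>
  have "prefix_local (N + N') (q O q')"
    unfolding prefix_local_def
  proof (intro ballI impI)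
    fix w assume w: "w \<in> words" "length w = N + N'"
    define a b where "a = take N w" and "b = drop N w"
    have ab: "w = a @ b" "length a = N" "length b = N'" "a \<in> words" "b \<in> words"
      using w by (auto simp: a_def b_def lists_eq_set dest: in_set_takeD in_set_dropD)
    obtain a' where a': "a' \<in> words" "\<And>\<omega>. \<omega> \<in> \<Omega> \<Longrightarrow> (a @- \<omega>, a' @- \<omega>) \<in> q"
      using prefix_localE[OF N(1) ab(4)] ab(2) by auto
    have "a' @ b \<in> words" "N' \<le> length (a' @ b)" using a'(1) ab by auto
    then obtain c where c: "c \<in> words" "\<And>\<omega>. \<omega> \<in> \<Omega> \<Longrightarrow> ((a' @ b) @- \<omega>, c @- \<omega>) \<in> q'"
      using prefix_localE[OF N(2)] by metis
    have "(w @- \<omega>, c @- \<omega>) \<in> q O q'" if "\<omega> \<in> \<Omega>" for \<omega>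
    proof
      show "(w @- \<omega>, (a' @ b) @- \<omega>) \<in> q"
        using a'(2)[of "b @- \<omega>"] that ab by simp
      show "((a' @ b) @- \<omega>, c @- \<omega>) \<in> q'" using c that by blast
    qed
    then show "\<exists>w'\<in>words. \<forall>\<omega>\<in>\<Omega>. (w @- \<omega>, w' @- \<omega>) \<in> q O q'" using c(1) by blast
  qed
  then show ?thesis
    using assms word_bij_comp by (auto simp: \<Gamma>_def)
qed

text \<open>The action of a rewriting step below the \<open>i\<close>-th argument: it corresponds to
  putting \<open>(f, i)\<close> in front of an address.\<close>

definition embed_at :: "nat \<Rightarrow> nat stream rel \<Rightarrow> nat stream rel" where
  "embed_at i q = {(j ## \<omega>, j ## \<omega>') | j \<omega> \<omega>'. j \<in> {1..n} \<and> (\<omega>, \<omega>') \<in> (if j = i then q else Id_on \<Omega>)}"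

lemma \<Gamma>_embed_at:
  assumes "q \<in> \<Gamma>"
  shows "embed_at i q \<in> \<Gamma>"
proof -
  obtain N where N: "prefix_local N q" using assms by (auto simp: \<Gamma>_def)
  have wb: "word_bij q" using assms by (rule \<Gamma>_word_bij)
  let ?q = "\<lambda>j. if j = i then q else Id_on \<Omega>"
  have wj: "word_bij (?q j)" for j
    using wb \<Gamma>_word_bij[OF \<Gamma>_Id] by simp
  have mem: "(j ## \<omega>, k ## \<omega>') \<in> embed_at i q \<longleftrightarrow> j = k \<and> j \<in> {1..n} \<and> (\<omega>, \<omega>') \<in> ?q j" for j k \<omega> \<omega>'
    by (auto simp: embed_at_def)
  have wb': "word_bij (embed_at i q)"
  proof (rule word_bijI)
    show sub: "embed_at i q \<subseteq> \<Omega> \<times> \<Omega>"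
      using word_bij_subset[OF wb] unfolding embed_at_def by (auto split: if_splits)
    show "\<exists>\<omega>'. (\<omega>, \<omega>') \<in> embed_at i q" if "\<omega> \<in> \<Omega>" for \<omega>
      using that
    proof (cases rule: \<Omega>_cases)
      case (1 j \<omega>0)
      then obtain \<omega>' where "(\<omega>0, \<omega>') \<in> ?q j" using word_bij_total[OF wj] by blast
      then show ?thesis using 1 mem by (metis atLeastAtMost_iff)
    qed
    show "\<exists>\<omega>. (\<omega>, \<omega>') \<in> embed_at i q" if "\<omega>' \<in> \<Omega>" for \<omega>'
      using that
    proof (cases rule: \<Omega>_cases)
      case (1 j \<omega>0)
      then obtain \<omega> where "(\<omega>, \<omega>0) \<in> ?q j" using word_bij_onto[OF wj] by blast
      then show ?thesis using 1 mem by (metis atLeastAtMost_iff)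
    qed
    fix \<omega> \<omega>' \<omega>''
    show "\<omega>' = \<omega>''" if "(\<omega>, \<omega>') \<in> embed_at i q" "(\<omega>, \<omega>'') \<in> embed_at i q"
      using that word_bij_fun[OF wj]
      by (cases \<omega>; cases \<omega>'; cases \<omega>'') (simp only: mem, blast)
    show "\<omega> = \<omega>'" if "(\<omega>, \<omega>'') \<in> embed_at i q" "(\<omega>', \<omega>'') \<in> embed_at i q"
      using that word_bij_inj[OF wj]
      by (cases \<omega>; cases \<omega>'; cases \<omega>'') (simp only: mem, blast)
  qed
  have "prefix_local (Suc N) (embed_at i q)"
    unfolding prefix_local_def
  proof (intro ballI impI)
    fix w assume w: "w \<in> words" "length w = Suc N"
    then obtain j w0 where w0: "w = j # w0" "length w0 = N" "w0 \<in> words" "j \<in> {1..n}"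
      by (cases w) auto
    have "prefix_local N (if j = i then q else Id_on \<Omega>)"
      using N prefix_local_Id by simp
    then obtain w' where "w' \<in> words"
      "\<forall>\<omega>\<in>\<Omega>. (w0 @- \<omega>, w' @- \<omega>) \<in> (if j = i then q else Id_on \<Omega>)"
      using w0 unfolding prefix_local_def by blast
    then show "\<exists>w'\<in>words. \<forall>\<omega>\<in>\<Omega>. (w @- \<omega>, w' @- \<omega>) \<in> embed_at i q"
      using w0 by (intro bexI[of _ "j # w'"]) (auto simp: mem)
  qed
  with wb' show ?thesis by (auto simp: \<Gamma>_def)
qed

section \<open>Trees as complete prefix codes\<close>

lemma Cons_in_leaves_Node:
  "i # w \<in> leaves (Node Ts) \<longleftrightarrow> i \<in> {1..length Ts} \<and> w \<in> leaves (Ts ! (i - 1))"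
  by (auto simp: image_iff)

lemma Nil_notin_leaves_Node: "[] \<notin> leaves (Node Ts)"
  by auto

declare leaves.simps(2) [simp del]

text \<open>The \<open>\<exists>!\<close> combines the two halves of a complete prefix code:
  existence is completeness, uniqueness forbids one code word to be a proper prefix of
  another.\<close>

definition complete_code :: "nat list set \<Rightarrow> bool" where
  "complete_code L \<longleftrightarrow> L \<subseteq> words \<and> finite L \<and> (\<forall>\<omega>\<in>\<Omega>. \<exists>!l. l \<in> L \<and> (\<exists>\<omega>'. \<omega> = l @- \<omega>'))"

lemma complete_code_split:
  assumes "complete_code L" "\<omega> \<in> \<Omega>"
  obtains l \<omega>' where "l \<in> L" "\<omega> = l @- \<omega>'" "l \<in> words" "\<omega>' \<in> \<Omega>"
  using assms unfolding complete_code_def by (metis shift_in_iff)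

lemma complete_code_unique:
  assumes "complete_code L" "l \<in> L" "l' \<in> L" "l @- \<omega> = l' @- \<omega>'" "\<omega> \<in> \<Omega>"
  shows "l = l'" "\<omega> = \<omega>'"
proof -
  have "l \<in> words" using assms(1,2) unfolding complete_code_def by blast
  then have "l @- \<omega> \<in> \<Omega>" using assms(5) by simp
  then show "l = l'" using assms unfolding complete_code_def by metis
  then show "\<omega> = \<omega>'" using assms(4) shift_eq_shift_length by blast
qed

lemma complete_code_Cons:
  assumes L: "complete_code L" "[] \<notin> L" and i: "i \<in> {1..n}"
  shows "complete_code {w. i # w \<in> L}"
proof -
  have "finite {w. i # w \<in> L}"
    using L(1) finite_vimageI[of L "(#) i"] by (simp add: complete_code_def vimage_def)
  moreover have "{w. i # w \<in> L} \<subseteq> words"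
    using L(1) by (auto simp: complete_code_def)
  moreover have "\<exists>!l. l \<in> {w. i # w \<in> L} \<and> (\<exists>\<omega>'. \<omega> = l @- \<omega>')" if "\<omega> \<in> \<Omega>" for \<omega>
  proof -
    have "i ## \<omega> \<in> \<Omega>" using that i by simp
    then obtain l \<omega>' where l: "l \<in> L" "i ## \<omega> = l @- \<omega>'" "\<omega>' \<in> \<Omega>"
      using complete_code_split[OF L(1)] by metis
    with L(2) obtain l0 where l0: "l = i # l0" by (cases l) auto
    show ?thesis
    proof (rule ex1I[of _ l0])
      show "l0 \<in> {w. i # w \<in> L} \<and> (\<exists>\<omega>'. \<omega> = l0 @- \<omega>')" using l l0 by auto
    next
      fix l1 assume l1: "l1 \<in> {w. i # w \<in> L} \<and> (\<exists>\<omega>'. \<omega> = l1 @- \<omega>')"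
      then obtain \<omega>1 where "\<omega> = l1 @- \<omega>1" by blast
      then have "l @- \<omega>' = (i # l1) @- \<omega>1" using l by simp
      with complete_code_unique(1)[OF L(1) l(1) _ this l(3)] l1 l0 show "l1 = l0" by simp
    qed
  qed
  ultimately show ?thesis unfolding complete_code_def by blast
qed

text \<open>Induction on a bound for the length of the code words. A code containing the empty word
  contains nothing else and is a single leaf; otherwise the words starting with \<open>i\<close>,
  with that letter removed, form the code of the \<open>i\<close>-th subtree.\<close>

lemma complete_code_tree:
  "complete_code L \<Longrightarrow> \<forall>l\<in>L. length l \<le> m \<Longrightarrow> \<exists>T\<in>trees n. leaves T = L"
proof (induction m arbitrary: L)
  case (0 L)
  obtain l where "l \<in> L" using complete_code_split[OF 0(1)] \<Omega>_nonempty by metis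
  then have "L = {[]}" using 0 by auto
  then show ?case by (intro bexI[of _ Leaf]) (auto intro: trees.Leaf)
next
  case (Suc m)
  show ?case
  proof (cases "[] \<in> L")
    case True
    obtain \<omega> where \<omega>: "\<omega> \<in> \<Omega>" using \<Omega>_nonempty by blast
    have "l = []" if "l \<in> L" for l
      using complete_code_unique(1)[OF Suc.prems(1) that True, of \<omega> "l @- \<omega>"] \<omega> by simp
    then have "L = {[]}" using True by auto
    then show ?thesis by (intro bexI[of _ Leaf]) (auto intro: trees.Leaf)
  next
    case False
    have "\<forall>i\<in>{1..n}. \<exists>T\<in>trees n. leaves T = {w. i # w \<in> L}"
      using Suc.IH complete_code_Cons[OF Suc.prems(1) False] Suc.prems(2) by fastforce
    then obtain f where f: "\<And>i. i \<in> {1..n} \<Longrightarrow> f i \<in> trees n \<and> leaves (f i) = {w. i # w \<in> L}"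
      by metis
    define T where "T = Node (map f [1..<Suc n])"
    have "T \<in> trees n" unfolding T_def
      by (rule trees.Node) (use f in \<open>auto simp del: upt_Suc\<close>)
    moreover have "leaves T = L"
    proof -
      have "w \<in> leaves T \<longleftrightarrow> w \<in> L" for w
      proof (cases w)
        case Nil
        then show ?thesis using False by (simp add: T_def Nil_notin_leaves_Node del: upt_Suc)
      next
        case (Cons i w')
        have "w \<in> L \<Longrightarrow> i \<in> {1..n}"
          using Suc.prems(1) Cons unfolding complete_code_def by auto
        moreover have "w \<in> leaves T \<longleftrightarrow> i \<in> {1..n} \<and> w' \<in> leaves (f i)"
          unfolding Cons T_def by (auto simp: Cons_in_leaves_Node nth_append simp del: upt_Suc)
        ultimately show ?thesis using f Cons by auto
      qed
      then show ?thesis by blast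
    qed
    ultimately show ?thesis by blast
  qed
qed

lemma leaves_complete_code: "T \<in> trees n \<Longrightarrow> complete_code (leaves T)"
proof (induction rule: trees.induct)
  case Leaf
  then show ?case by (auto simp: complete_code_def)
next
  case (Node Ts)
  then have IH: "complete_code (leaves (Ts ! (i - 1)))" if "i \<in> {1..n}" for i
    using that by auto
  have mem: "i # w \<in> leaves (Node Ts) \<longleftrightarrow> i \<in> {1..n} \<and> w \<in> leaves (Ts ! (i - 1))" for i w
    using Node by (simp add: Cons_in_leaves_Node)
  note nil = Nil_notin_leaves_Node[of Ts]
  have "leaves (Ts ! (i - 1)) \<subseteq> words" "finite (leaves (Ts ! (i - 1)))" if "i \<in> {1..n}" for i
    using IH[OF that] unfolding complete_code_def by blast+
  then have "leaves (Node Ts) \<subseteq> words" "finite (leaves (Node Ts))"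
    using Node(1) by (auto simp: subset_eq leaves.simps(2))
  moreover have "\<exists>!l. l \<in> leaves (Node Ts) \<and> (\<exists>\<omega>'. \<omega> = l @- \<omega>')" if \<omega>: "\<omega> \<in> \<Omega>" for \<omega>
    using \<omega>
  proof (cases rule: \<Omega>_cases)
    case (1 i \<omega>0)
    then have i: "i \<in> {1..n}" by simp
    obtain l \<omega>' where l: "l \<in> leaves (Ts ! (i - 1))" "\<omega>0 = l @- \<omega>'" "\<omega>' \<in> \<Omega>"
      using complete_code_split[OF IH[OF i] 1(4)] .
    show ?thesis
    proof (rule ex1I[of _ "i # l"])
      show "i # l \<in> leaves (Node Ts) \<and> (\<exists>\<omega>'. \<omega> = (i # l) @- \<omega>')"
        using l 1 i by (auto simp only: mem) auto
    next
      fix l1 assume l1: "l1 \<in> leaves (Node Ts) \<and> (\<exists>\<omega>'. \<omega> = l1 @- \<omega>')"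
      then obtain j l2 where l2: "l1 = j # l2" using nil by (cases l1) auto
      from l1 obtain \<omega>1 where \<omega>1: "\<omega> = l1 @- \<omega>1" by blast
      then have "j = i" "\<omega>0 = l2 @- \<omega>1" using l2 1 by auto
      moreover have "l2 \<in> leaves (Ts ! (i - 1))" using l1 l2 \<open>j = i\<close> by (simp only: mem)
      ultimately have "l = l2"
        using complete_code_unique(1)[OF IH[OF i] l(1)] l by metis
      then show "l1 = i # l" using l2 \<open>j = i\<close> by simp
    qed
  qed
  ultimately show ?case unfolding complete_code_def by blast
qed

lemma leaves_in_words: "T \<in> trees n \<Longrightarrow> l \<in> leaves T \<Longrightarrow> l \<in> words"
  using leaves_complete_code unfolding complete_code_def by blast

lemma leaves_inj:
  "T \<in> trees n \<Longrightarrow> T' \<in> trees n \<Longrightarrow> leaves T = leaves T' \<Longrightarrow> T = T'"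
proof (induction arbitrary: T' rule: trees.induct)
  case Leaf
  then show ?case by (cases T') (auto simp: leaves.simps(2))
next
  case (Node Ts)
  then obtain Ts' where T': "T' = Node Ts'" by (cases T') (auto simp: leaves.simps(2))
  with Node have Ts': "length Ts' = n" "\<forall>T\<in>set Ts'. T \<in> trees n"
    by (auto elim: trees.cases)
  have "Ts = Ts'"
  proof (rule nth_equalityI)
    show "length Ts = length Ts'" using Node Ts' by simp
  next
    fix i assume i: "i < length Ts"
    have "leaves (Ts ! i) = {w. Suc i # w \<in> leaves (Node Ts)}" using i by (auto simp: Cons_in_leaves_Node)
    also have "\<dots> = {w. Suc i # w \<in> leaves (Node Ts')}" using Node T' by simp
    also have "\<dots> = leaves (Ts' ! i)" using i Node Ts' by (auto simp: Cons_in_leaves_Node)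
    finally show "Ts ! i = Ts' ! i" using i Node Ts' by auto
  qed
  then show ?case using T' by simp
qed

text \<open>Its leaves are all words of length \<open>m\<close>, so \<open>prefix_local m q\<close>
  amounts to a prefix exchange at each of them.\<close>

primrec full_tree :: "nat \<Rightarrow> tree" where
  "full_tree 0 = Leaf"
| "full_tree (Suc m) = Node (replicate n (full_tree m))"

lemma full_tree_in_trees: "full_tree m \<in> trees n"
  by (induction m) (auto intro!: trees.intros)

lemma leaves_full_tree: "leaves (full_tree m) = {w \<in> words. length w = m}"
proof (induction m)
  case (Suc m)
  have "w \<in> leaves (full_tree (Suc m)) \<longleftrightarrow> w \<in> words \<and> length w = Suc m" for w
    using Suc by (cases w) (auto simp: Cons_in_leaves_Node Nil_notin_leaves_Node)
  then show ?case by blast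
qed auto

section \<open>Tree diagrams as bijections of infinite words\<close>

definition symbol_map :: "tree_diagram \<Rightarrow> nat stream rel" where
  "symbol_map d = (case d of (T1, T2, \<sigma>) \<Rightarrow> {(l @- \<omega>, \<sigma> l @- \<omega>) | l \<omega>. l \<in> leaves T1 \<and> \<omega> \<in> \<Omega>})"

lemma tree_diagrams_iff:
  "(T1, T2, \<sigma>) \<in> tree_diagrams n \<longleftrightarrow> T1 \<in> trees n \<and> T2 \<in> trees n \<and>
     \<sigma> \<in> extensional (leaves T1) \<and> bij_betw \<sigma> (leaves T1) (leaves T2)"
  by (simp add: tree_diagrams_def)

lemma symbol_map_mem:
  "(\<omega>, \<omega>') \<in> symbol_map (T1, T2, \<sigma>) \<longleftrightarrow>
     (\<exists>l\<in>leaves T1. \<exists>\<omega>0\<in>\<Omega>. \<omega> = l @- \<omega>0 \<and> \<omega>' = \<sigma> l @- \<omega>0)"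
  by (auto simp: symbol_map_def)

lemma symbol_map_leaf:
  assumes "T1 \<in> trees n" "l \<in> leaves T1" "\<omega> \<in> \<Omega>"
  shows "(l @- \<omega>, \<omega>') \<in> symbol_map (T1, T2, \<sigma>) \<longleftrightarrow> \<omega>' = \<sigma> l @- \<omega>"
proof
  assume "(l @- \<omega>, \<omega>') \<in> symbol_map (T1, T2, \<sigma>)"
  then obtain l' \<omega>0 where l': "l' \<in> leaves T1" "\<omega>0 \<in> \<Omega>" "l @- \<omega> = l' @- \<omega>0" "\<omega>' = \<sigma> l' @- \<omega>0"
    unfolding symbol_map_mem by blast
  show "\<omega>' = \<sigma> l @- \<omega>"
    using complete_code_unique[OF leaves_complete_code[OF assms(1)] assms(2) l'(1,3) assms(3)] l'(4)
    by simp
next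
  assume "\<omega>' = \<sigma> l @- \<omega>"
  then show "(l @- \<omega>, \<omega>') \<in> symbol_map (T1, T2, \<sigma>)"
    unfolding symbol_map_mem using assms by blast
qed

lemma symbol_map_function:
  assumes "(T1, T2, \<sigma>) \<in> tree_diagrams n"
  shows "Domain (symbol_map (T1, T2, \<sigma>)) = \<Omega>" "single_valued (symbol_map (T1, T2, \<sigma>))"
proof -
  have T1: "T1 \<in> trees n" using assms by (simp add: tree_diagrams_iff)
  show "single_valued (symbol_map (T1, T2, \<sigma>))"
  proof (rule single_valuedI)
    fix \<omega> \<omega>' \<omega>''
    assume "(\<omega>, \<omega>') \<in> symbol_map (T1, T2, \<sigma>)" and 1: "(\<omega>, \<omega>'') \<in> symbol_map (T1, T2, \<sigma>)"
    then obtain l \<omega>0 where "l \<in> leaves T1" "\<omega>0 \<in> \<Omega>" "\<omega> = l @- \<omega>0" "\<omega>' = \<sigma> l @- \<omega>0"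
      unfolding symbol_map_mem by blast
    with 1 show "\<omega>' = \<omega>''" using symbol_map_leaf[OF T1] by metis
  qed
  show "Domain (symbol_map (T1, T2, \<sigma>)) = \<Omega>"
  proof
    show "Domain (symbol_map (T1, T2, \<sigma>)) \<subseteq> \<Omega>"
      using leaves_in_words[OF T1] by (auto simp: symbol_map_mem)
    show "\<Omega> \<subseteq> Domain (symbol_map (T1, T2, \<sigma>))"
    proof
      fix \<omega> assume "\<omega> \<in> \<Omega>"
      then obtain l \<omega>0 where "l \<in> leaves T1" "\<omega> = l @- \<omega>0" "\<omega>0 \<in> \<Omega>"
        using complete_code_split[OF leaves_complete_code[OF T1]] by metis
      then show "\<omega> \<in> Domain (symbol_map (T1, T2, \<sigma>))"
        using symbol_map_leaf[OF T1] by blast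
    qed
  qed
qed

text \<open>Reading a diagram backwards turns totality and uniqueness of images into surjectivity
  and injectivity, so \<open>symbol_map_function\<close> yields both halves of bijectivity.\<close>

lemma diagram_inverse:
  assumes "(T1, T2, \<sigma>) \<in> tree_diagrams n"
  obtains \<tau> where "(T2, T1, \<tau>) \<in> tree_diagrams n"
    "symbol_map (T2, T1, \<tau>) = (symbol_map (T1, T2, \<sigma>))\<inverse>"
proof
  let ?\<tau> = "restrict (inv_into (leaves T1) \<sigma>) (leaves T2)"
  have bij: "bij_betw \<sigma> (leaves T1) (leaves T2)"
    using assms by (simp add: tree_diagrams_iff)
  have "bij_betw ?\<tau> (leaves T2) (leaves T1)"
    using bij_betw_inv_into[OF bij] by (simp add: bij_betw_restrict_eq)
  then show "(T2, T1, ?\<tau>) \<in> tree_diagrams n"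
    using assms by (simp add: tree_diagrams_iff)
  have inv: "l' \<in> leaves T2 \<Longrightarrow> ?\<tau> l' \<in> leaves T1 \<and> \<sigma> (?\<tau> l') = l'"
    "l \<in> leaves T1 \<Longrightarrow> \<sigma> l \<in> leaves T2 \<and> ?\<tau> (\<sigma> l) = l" for l l'
    using bij bij_betw_inv_into_right[OF bij] bij_betw_inv_into_left[OF bij]
      bij_betw_apply[OF bij_betw_inv_into[OF bij]] bij_betw_apply[OF bij] by auto
  show "symbol_map (T2, T1, ?\<tau>) = (symbol_map (T1, T2, \<sigma>))\<inverse>"
  proof -
    have "(\<omega>, \<omega>') \<in> symbol_map (T2, T1, ?\<tau>) \<longleftrightarrow> (\<omega>', \<omega>) \<in> symbol_map (T1, T2, \<sigma>)" for \<omega> \<omega>'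
      unfolding symbol_map_mem using inv by metis
    then show ?thesis by auto
  qed
qed

lemma symbol_map_in_\<Gamma>:
  assumes "d \<in> tree_diagrams n"
  shows "symbol_map d \<in> \<Gamma>"
proof -
  obtain T1 T2 \<sigma> where d: "d = (T1, T2, \<sigma>)" by (cases d)
  note TD = assms[unfolded d]
  have T: "T1 \<in> trees n" "T2 \<in> trees n" "bij_betw \<sigma> (leaves T1) (leaves T2)"
    using TD by (auto simp: tree_diagrams_iff)
  obtain \<tau> where \<tau>: "(T2, T1, \<tau>) \<in> tree_diagrams n"
    "symbol_map (T2, T1, \<tau>) = (symbol_map (T1, T2, \<sigma>))\<inverse>"
    using diagram_inverse[OF TD] .
  have wb: "word_bij (symbol_map d)"
    unfolding word_bij_def d
    using symbol_map_function[OF TD] symbol_map_function[OF \<tau>(1)] unfolding \<tau>(2) by simp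
  have fin: "finite (leaves T1)"
    using leaves_complete_code[OF T(1)] by (simp add: complete_code_def)
  \<comment> \<open>A word at least as long as every leaf has a leaf as prefix, and the rest of it
    is carried along.\<close>
  have "prefix_local (Max (length ` leaves T1)) (symbol_map d)"
    unfolding prefix_local_def
  proof (intro ballI impI)
    fix w assume w: "w \<in> words" "length w = Max (length ` leaves T1)"
    obtain \<omega>0 where \<omega>0: "\<omega>0 \<in> \<Omega>" using \<Omega>_nonempty by blast
    then have "w @- \<omega>0 \<in> \<Omega>" using w by simp
    then obtain l \<omega>' where l: "l \<in> leaves T1" "w @- \<omega>0 = l @- \<omega>'" "l \<in> words" "\<omega>' \<in> \<Omega>"
      using complete_code_split[OF leaves_complete_code[OF T(1)]] by metis
    have "length l \<le> length w" using l(1) fin w(2) by simp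
    with l(2) obtain v where v: "w = l @ v" by (rule shift_longer)
    have "\<sigma> l \<in> words" using T l(1) leaves_in_words bij_betw_apply by metis
    then show "\<exists>w'\<in>words. \<forall>\<omega>\<in>\<Omega>. (w @- \<omega>, w' @- \<omega>) \<in> symbol_map d"
      using v w(1) symbol_map_leaf[OF T(1) l(1)] by (intro bexI[of _ "\<sigma> l @ v"]) (auto simp: d)
  qed
  with wb show ?thesis by (auto simp: \<Gamma>_def)
qed

text \<open>If \<open>v\<close> is nonempty, the constant word of a letter other than its first one
  is not fixed; such a letter exists because \<open>n \<ge> 2\<close>.\<close>

lemma shift_fixed_Nil:
  assumes "\<And>\<omega>. \<omega> \<in> \<Omega> \<Longrightarrow> \<omega> = v @- \<omega>"
  shows "v = []"
proof (rule ccontr)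
  assume "v \<noteq> []"
  then obtain a v' where v: "v = a # v'" by (cases v) auto
  obtain b where b: "b \<in> {1..n}" "b \<noteq> a"
    using n2 that[of 1] that[of 2] by (cases "a = 1") auto
  then have "sconst b \<in> \<Omega>" by (intro sconst_streams)
  from assms[OF this] have "shd (sconst b) = shd (v @- sconst b)" by simp
  then show False using v b by simp
qed

text \<open>One of the two words extends the other, and the surplus fixes every infinite
  word.\<close>

lemma shift_eq_all:
  assumes "\<And>\<omega>. \<omega> \<in> \<Omega> \<Longrightarrow> w @- \<omega> = w' @- \<omega>"
  shows "w = w'"
proof -
  obtain \<omega> where "\<omega> \<in> \<Omega>" using \<Omega>_nonempty by blast
  from assms[OF this] show ?thesis
  proof (cases rule: shift_eq_shift_cases)
    case (1 v)
    have "v = []" by (rule shift_fixed_Nil) (use assms 1 in simp)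
    with 1 show ?thesis by simp
  next
    case (2 v)
    have "v = []" by (rule shift_fixed_Nil) (metis assms 2(1) shift_append shift_left_inj)
    with 2 show ?thesis by simp
  qed
qed

text \<open>The words that \<open>q\<close> writes for the prefixes of length \<open>M\<close> again
  form a complete code, hence are the leaves of a tree. The source is a full tree so that two
  elements of \<Gamma> can be given a common source.\<close>

lemma \<Gamma>_diagram:
  assumes q: "q \<in> \<Gamma>" and M: "prefix_local M q"
  obtains T2 \<sigma> where "(full_tree M, T2, \<sigma>) \<in> tree_diagrams n" "symbol_map (full_tree M, T2, \<sigma>) = q"
proof -
  have wb: "word_bij q" using q by (rule \<Gamma>_word_bij)
  define A where "A = {w \<in> words. length w = M}"
  have "\<forall>w\<in>A. \<exists>w'. w' \<in> words \<and> (\<forall>\<omega>\<in>\<Omega>. (w @- \<omega>, w' @- \<omega>) \<in> q)"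
    using M unfolding prefix_local_def A_def by blast
  then obtain g where g: "\<And>w. w \<in> A \<Longrightarrow> g w \<in> words"
    "\<And>w \<omega>. w \<in> A \<Longrightarrow> \<omega> \<in> \<Omega> \<Longrightarrow> (w @- \<omega>, g w @- \<omega>) \<in> q"
    by metis
  have onto: "\<exists>w\<in>A. \<exists>\<omega>0\<in>\<Omega>. \<omega> = w @- \<omega>0 \<and> \<omega>' = g w @- \<omega>0" if "(\<omega>, \<omega>') \<in> q" for \<omega> \<omega>'
  proof -
    have "\<omega> \<in> \<Omega>" using word_bij_subset[OF wb that] by simp
    then obtain w \<omega>0 where w: "\<omega> = w @- \<omega>0" "length w = M" "w \<in> words" "\<omega>0 \<in> \<Omega>"
      by (rule \<Omega>_split)
    then have "w \<in> A" by (simp add: A_def)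
    then have "\<omega>' = g w @- \<omega>0" using g(2) w word_bij_fun[OF wb that] by blast
    then show ?thesis using \<open>w \<in> A\<close> w by blast
  qed
  have inj: "w = w' \<and> \<omega> = \<omega>'" if "w \<in> A" "w' \<in> A" "\<omega> \<in> \<Omega>" "\<omega>' \<in> \<Omega>" "g w @- \<omega> = g w' @- \<omega>'" for w w' \<omega> \<omega>'
  proof -
    have "w @- \<omega> = w' @- \<omega>'"
      using g(2)[OF that(1,3)] g(2)[OF that(2,4)] that(5) word_bij_inj[OF wb] by metis
    then show ?thesis using that(1,2) shift_eq_shift_length[of w w'] by (simp add: A_def)
  qed
  have "finite A"
    unfolding A_def using finite_lists_length_eq[of "{1..n}" M] by (simp add: lists_eq_set)
  \<comment> \<open>Completeness comes from surjectivity of \<open>q\<close>, uniqueness of the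
    prefix from its injectivity.\<close>
  have "complete_code (g ` A)"
    unfolding complete_code_def
  proof (intro conjI ballI)
    show "g ` A \<subseteq> words" using g(1) by blast
    show "finite (g ` A)" using \<open>finite A\<close> by simp
  next
    fix \<omega>' assume \<omega>': "\<omega>' \<in> \<Omega>"
    then obtain \<omega> where "(\<omega>, \<omega>') \<in> q" using word_bij_onto[OF wb] by blast
    then obtain w \<omega>0 where w: "w \<in> A" "\<omega>0 \<in> \<Omega>" "\<omega>' = g w @- \<omega>0" using onto by blast
    show "\<exists>!l. l \<in> g ` A \<and> (\<exists>\<omega>0. \<omega>' = l @- \<omega>0)"
    proof (rule ex1I[of _ "g w"])
      show "g w \<in> g ` A \<and> (\<exists>\<omega>0. \<omega>' = g w @- \<omega>0)" using w by blast
    next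
      fix l assume "l \<in> g ` A \<and> (\<exists>\<omega>0. \<omega>' = l @- \<omega>0)"
      then obtain w' \<omega>1 where w': "w' \<in> A" "l = g w'" "\<omega>' = g w' @- \<omega>1" by blast
      have "\<omega>1 \<in> \<Omega>" using \<omega>' w'(3) by simp
      then show "l = g w" using inj[OF w(1) w'(1) w(2)] w w' by metis
    qed
  qed
  moreover have "\<forall>l\<in>g ` A. length l \<le> Max (length ` g ` A)"
    using \<open>finite A\<close> by simp
  ultimately obtain T2 where T2: "T2 \<in> trees n" "leaves T2 = g ` A"
    using complete_code_tree by metis
  define \<sigma> where "\<sigma> = restrict g A"
  have lv: "leaves (full_tree M) = A" using leaves_full_tree by (simp add: A_def)
  obtain \<omega>0 where \<omega>0: "\<omega>0 \<in> \<Omega>" using \<Omega>_nonempty by blast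
  have "inj_on g A" by (rule inj_onI) (use inj[OF _ _ \<omega>0 \<omega>0] in auto)
  then have "bij_betw \<sigma> A (g ` A)"
    unfolding \<sigma>_def by (simp add: bij_betw_restrict_eq inj_on_imp_bij_betw)
  then have TD: "(full_tree M, T2, \<sigma>) \<in> tree_diagrams n"
    unfolding tree_diagrams_iff lv T2(2) using full_tree_in_trees T2(1) by (simp add: \<sigma>_def)
  have "symbol_map (full_tree M, T2, \<sigma>) \<subseteq> q"
    using g(2) by (auto simp: symbol_map_def lv \<sigma>_def)
  then have "symbol_map (full_tree M, T2, \<sigma>) = q"
    using word_bij_mono_eq \<Gamma>_word_bij[OF symbol_map_in_\<Gamma>[OF TD]] wb by blast
  with TD that show ?thesis by blast
qed

text \<open>The symmetry of \<open>prefix_local\<close> is not evident, but a diagram of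
  \<open>q\<close> can simply be reversed.\<close>

lemma \<Gamma>_converse:
  assumes "q \<in> \<Gamma>"
  shows "q\<inverse> \<in> \<Gamma>"
proof -
  obtain M where "prefix_local M q" using assms by (auto simp: \<Gamma>_def)
  then obtain T2 \<sigma> where d: "(full_tree M, T2, \<sigma>) \<in> tree_diagrams n" "symbol_map (full_tree M, T2, \<sigma>) = q"
    using \<Gamma>_diagram[OF assms] by blast
  obtain \<tau> where "(T2, full_tree M, \<tau>) \<in> tree_diagrams n" "symbol_map (T2, full_tree M, \<tau>) = q\<inverse>"
    using diagram_inverse[OF d(1)] d(2) by metis
  then show ?thesis using symbol_map_in_\<Gamma> by metis
qed

section \<open>Equivalence of tree diagrams\<close>

lemma leaves_prefix_free:
  assumes "T \<in> trees n" "l \<in> leaves T" "l @ v \<in> leaves T"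
  shows "v = []"
proof -
  obtain \<omega> where \<omega>: "\<omega> \<in> \<Omega>" using \<Omega>_nonempty by blast
  have "l @ v = l"
    by (rule complete_code_unique(1)[OF leaves_complete_code[OF assms(1)] assms(3,2) _ \<omega>, of "v @- \<omega>"]) simp
  then show ?thesis by simp
qed

lemma expand_tree_leaves:
  "T \<in> trees n \<Longrightarrow> l \<in> leaves T \<Longrightarrow>
     expand_tree n T l \<in> trees n \<and>
     leaves (expand_tree n T l) = (leaves T - {l}) \<union> (\<lambda>i. l @ [i]) ` {1..n}"
proof (induction arbitrary: l rule: trees.induct)
  case Leaf
  have "w \<in> leaves (expand_tree n Leaf []) \<longleftrightarrow> (\<exists>i\<in>{1..n}. w = [i])" for w
    by (cases w) (auto simp: Cons_in_leaves_Node Nil_notin_leaves_Node)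
  with Leaf show ?case by (auto intro!: trees.intros)
next
  case (Node Ts)
  from Node.prems obtain i v where l: "l = i # v"
    using Nil_notin_leaves_Node by (cases l) auto
  with Node.prems have i: "1 \<le> i" "i \<le> n" "v \<in> leaves (Ts ! (i - 1))"
    using Node.hyps by (auto simp: Cons_in_leaves_Node)
  then have "Ts ! (i - 1) \<in> set Ts" using Node.hyps by auto
  with Node.IH i have IH: "expand_tree n (Ts ! (i - 1)) v \<in> trees n"
    "leaves (expand_tree n (Ts ! (i - 1)) v) = (leaves (Ts ! (i - 1)) - {v}) \<union> (\<lambda>j. v @ [j]) ` {1..n}"
    by auto
  let ?Ts = "Ts[i - 1 := expand_tree n (Ts ! (i - 1)) v]"
  have "expand_tree n (Node Ts) l \<in> trees n"
    unfolding l expand_tree.simps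
  proof (rule trees.Node)
    show "length ?Ts = n" using Node.hyps by simp
    show "\<forall>T\<in>set ?Ts. T \<in> trees n"
      using Node.IH IH(1) set_update_subset_insert by fastforce
  qed
  moreover have "w \<in> leaves (expand_tree n (Node Ts) l) \<longleftrightarrow>
      w \<in> (leaves (Node Ts) - {l}) \<union> (\<lambda>j. l @ [j]) ` {1..n}" for w
  proof (cases w)
    case Nil
    then show ?thesis using l by (auto simp: Nil_notin_leaves_Node)
  next
    case (Cons j w')
    show ?thesis
    proof (cases "j = i")
      case True
      then show ?thesis
        using Cons l i IH(2) Node.hyps by (auto simp: Cons_in_leaves_Node)
    next
      case False
      then have "1 \<le> j \<Longrightarrow> j - 1 \<noteq> i - 1" using i by auto
      then show ?thesis
        using Cons l i False Node.hyps by (auto simp: Cons_in_leaves_Node nth_list_update)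
    qed
  qed
  ultimately show ?case by blast
qed

text \<open>Exchanging \<open>l\<close> for \<open>\<sigma> l\<close> also exchanges
  \<open>l @ [i]\<close> for \<open>\<sigma> l @ [i]\<close>; an expansion describes the same action
  on longer prefixes.\<close>

lemma simple_expansion_symbol_map:
  assumes "simple_expansion n d e" "d \<in> tree_diagrams n"
  shows "e \<in> tree_diagrams n" "symbol_map e = symbol_map d"
proof -
  obtain T1 T2 \<sigma> l where d: "d = (T1, T2, \<sigma>)" and l: "l \<in> leaves T1"
    and e: "e = (expand_tree n T1 l, expand_tree n T2 (\<sigma> l), expand_bij n T1 l \<sigma>)"
    using assms(1) by (cases rule: simple_expansion.cases) auto
  have T: "T1 \<in> trees n" "T2 \<in> trees n" and bij: "bij_betw \<sigma> (leaves T1) (leaves T2)"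
    using assms(2) by (auto simp: d tree_diagrams_iff)
  have \<sigma>l: "\<sigma> l \<in> leaves T2" using bij l bij_betw_apply by metis
  note E1 = expand_tree_leaves[OF T(1) l] and E2 = expand_tree_leaves[OF T(2) \<sigma>l]
  let ?\<sigma> = "expand_bij n T1 l \<sigma>"
  have old: "?\<sigma> k = \<sigma> k" if "k \<in> leaves T1 - {l}" for k
    using that E1 by (simp add: expand_bij_def)
  \<comment> \<open>By prefix-freeness \<open>l @ [i]\<close> is not a leaf of \<open>T1\<close>, so
    the second branch of \<open>expand_bij\<close> applies.\<close>
  have new: "?\<sigma> (l @ [i]) = \<sigma> l @ [i]" if "i \<in> {1..n}" for i
    using that E1 leaves_prefix_free[OF T(1) l, of "[i]"] by (auto simp: expand_bij_def)
  have "bij_betw \<sigma> (leaves T1 - {l}) (leaves T2 - {\<sigma> l})"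
    by (rule bij_betw_DiffI[OF bij]) (use l \<sigma>l in \<open>auto simp: bij_betw_def\<close>)
  then have 1: "bij_betw ?\<sigma> (leaves T1 - {l}) (leaves T2 - {\<sigma> l})"
    using old by (subst bij_betw_cong) auto
  have 2: "bij_betw ?\<sigma> ((\<lambda>i. l @ [i]) ` {1..n}) ((\<lambda>i. \<sigma> l @ [i]) ` {1..n})"
    unfolding bij_betw_def using new by (auto simp: inj_on_def image_image intro!: image_cong)
  have "(leaves T2 - {\<sigma> l}) \<inter> (\<lambda>i. \<sigma> l @ [i]) ` {1..n} = {}"
    using leaves_prefix_free[OF T(2) \<sigma>l] by blast
  then have "bij_betw ?\<sigma> (leaves (expand_tree n T1 l)) (leaves (expand_tree n T2 (\<sigma> l)))"
    using bij_betw_combine[OF 1 2] E1 E2 by simp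
  then show TD: "e \<in> tree_diagrams n"
    using E1 E2 by (simp add: e tree_diagrams_iff expand_bij_def)
  have "symbol_map e \<subseteq> symbol_map d"
  proof (clarify)
    fix \<omega> \<omega>' assume "(\<omega>, \<omega>') \<in> symbol_map e"
    then obtain k \<omega>0 where k: "k \<in> leaves (expand_tree n T1 l)" "\<omega>0 \<in> \<Omega>" "\<omega> = k @- \<omega>0" "\<omega>' = ?\<sigma> k @- \<omega>0"
      unfolding e symbol_map_mem by blast
    show "(\<omega>, \<omega>') \<in> symbol_map d"
    proof (cases "k \<in> leaves T1 - {l}")
      case True
      then show ?thesis using k old[OF True] symbol_map_leaf[OF T(1)] by (simp add: d)
    next
      case False
      then obtain i where i: "i \<in> {1..n}" "k = l @ [i]" using k E1 by auto
      have "(l @- (i ## \<omega>0), \<sigma> l @- (i ## \<omega>0)) \<in> symbol_map d"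
        using i k symbol_map_leaf[OF T(1) l] by (simp add: d)
      then show ?thesis using k i new by simp
    qed
  qed
  then show "symbol_map e = symbol_map d"
    using word_bij_mono_eq \<Gamma>_word_bij symbol_map_in_\<Gamma> TD assms(2) by blast
qed

lemma expansion_symbol_map:
  assumes "(simple_expansion n)\<^sup>*\<^sup>* d e" "d \<in> tree_diagrams n"
  shows "e \<in> tree_diagrams n \<and> symbol_map e = symbol_map d"
  using assms by (induction rule: rtranclp_induct) (use simple_expansion_symbol_map in metis)+

text \<open>The measure counts the words shorter than \<open>M\<close> that lie at or below a leaf.
  Expanding a leaf \<open>l\<close> shorter than \<open>M\<close> takes \<open>l\<close> itself out
  of this set and adds nothing; once no such leaf is left, all leaves have length
  \<open>M\<close>.\<close>

lemma expansion_to_full_tree: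
  assumes "(T1, T2, \<sigma>) \<in> tree_diagrams n" "\<forall>l\<in>leaves T1. length l \<le> M"
  shows "\<exists>T2' \<sigma>'. (simple_expansion n)\<^sup>*\<^sup>* (T1, T2, \<sigma>) (full_tree M, T2', \<sigma>')"
  using assms
proof (induction "card {w \<in> words. length w < M \<and> (\<exists>l\<in>leaves T1. \<exists>v. w = l @ v)}"
    arbitrary: T1 T2 \<sigma> rule: less_induct)
  case (less T1 T2 \<sigma>)
  let ?S = "\<lambda>T. {w \<in> words. length w < M \<and> (\<exists>l\<in>leaves T. \<exists>v. w = l @ v)}"
  have T: "T1 \<in> trees n" using less.prems by (simp add: tree_diagrams_iff)
  show ?case
  proof (cases "\<exists>l\<in>leaves T1. length l < M")
    case True
    then obtain l where l: "l \<in> leaves T1" "length l < M" by blast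
    define E1 E2 \<sigma>' where "E1 = expand_tree n T1 l" and "E2 = expand_tree n T2 (\<sigma> l)"
      and "\<sigma>' = expand_bij n T1 l \<sigma>"
    have step: "simple_expansion n (T1, T2, \<sigma>) (E1, E2, \<sigma>')"
      unfolding E1_def E2_def \<sigma>'_def using l(1) by (rule simple_expansion.intros)
    have E1: "leaves E1 = (leaves T1 - {l}) \<union> (\<lambda>i. l @ [i]) ` {1..n}" "E1 \<in> trees n"
      using expand_tree_leaves[OF T l(1)] by (auto simp: E1_def)
    have fin: "finite (?S T1)"
      by (rule finite_subset[OF _ finite_lists_length_le[of "{1..n}" M]]) (auto simp: lists_eq_set)
    have "?S E1 \<subseteq> ?S T1"
    proof
      fix w assume "w \<in> ?S E1"
      then obtain k v where k: "w \<in> words" "length w < M" "k \<in> leaves E1" "w = k @ v" by blast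
      then consider "k \<in> leaves T1" | i where "k = l @ [i]" using E1 by blast
      then show "w \<in> ?S T1"
      proof cases
        case 1
        then show ?thesis using k by blast
      next
        case 2
        then have "w = l @ (i # v)" using k by simp
        then show ?thesis using k l by blast
      qed
    qed
    moreover have "l \<in> ?S T1" using l leaves_in_words[OF T] by auto
    moreover have "l \<notin> ?S E1"
    proof
      assume "l \<in> ?S E1"
      then obtain k v where k: "k \<in> leaves E1" "l = k @ v" by blast
      then have "k \<in> leaves T1" "k \<noteq> l" using E1 by auto
      then show False using leaves_prefix_free[OF T, of k v] k l by auto
    qed
    ultimately have "?S E1 \<subset> ?S T1" by blast
    then have "card (?S E1) < card (?S T1)" by (rule psubset_card_mono[OF fin])
    moreover have "\<forall>k\<in>leaves E1. length k \<le> M" using E1 less.prems(2) l by auto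
    moreover have "(E1, E2, \<sigma>') \<in> tree_diagrams n"
      using simple_expansion_symbol_map(1)[OF step less.prems(1)] .
    ultimately obtain T2' \<sigma>'' where "(simple_expansion n)\<^sup>*\<^sup>* (E1, E2, \<sigma>') (full_tree M, T2', \<sigma>'')"
      using less.hyps by blast
    then show ?thesis using step converse_rtranclp_into_rtranclp by metis
  next
    case False
    then have len: "length l = M" if "l \<in> leaves T1" for l
      using that less.prems(2) by (meson le_neq_implies_less)
    have "leaves T1 = leaves (full_tree M)"
      unfolding leaves_full_tree
    proof
      show "leaves T1 \<subseteq> {w \<in> words. length w = M}" using len leaves_in_words[OF T] by blast
      show "{w \<in> words. length w = M} \<subseteq> leaves T1"
      proof
        fix w assume "w \<in> {w \<in> words. length w = M}"
        then have w: "w \<in> words" "length w = M" by auto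
        obtain \<omega> where "\<omega> \<in> \<Omega>" using \<Omega>_nonempty by blast
        then have w\<omega>: "w @- \<omega> \<in> \<Omega>" using w(1) by simp
        obtain l \<omega>' where "l \<in> leaves T1" "w @- \<omega> = l @- \<omega>'"
          using complete_code_split[OF leaves_complete_code[OF T] w\<omega>] .
        then show "w \<in> leaves T1" using shift_eq_shift_length[of w l] len w(2) by metis
      qed
    qed
    then have "T1 = full_tree M" using leaves_inj T full_tree_in_trees by blast
    then show ?thesis by blast
  qed
qed

text \<open>Once the source trees agree, the action determines the image of each leaf by
  \<open>shift_eq_all\<close>, and the target tree is determined by its leaves.\<close>

lemma symbol_map_inj:
  assumes TD: "(T, T2, \<sigma>) \<in> tree_diagrams n" "(T, T2', \<sigma>') \<in> tree_diagrams n"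
    and eq: "symbol_map (T, T2, \<sigma>) = symbol_map (T, T2', \<sigma>')"
  shows "T2 = T2' \<and> \<sigma> = \<sigma>'"
proof -
  have T: "T \<in> trees n" "T2 \<in> trees n" "T2' \<in> trees n"
    and bij: "bij_betw \<sigma> (leaves T) (leaves T2)" "bij_betw \<sigma>' (leaves T) (leaves T2')"
    and ext: "\<sigma> \<in> extensional (leaves T)" "\<sigma>' \<in> extensional (leaves T)"
    using TD by (auto simp: tree_diagrams_iff)
  have "\<sigma> = \<sigma>'"
  proof (rule extensionalityI[OF ext])
    fix l assume l: "l \<in> leaves T"
    show "\<sigma> l = \<sigma>' l"
    proof (rule shift_eq_all)
      fix \<omega> assume "\<omega> \<in> \<Omega>"
      then show "\<sigma> l @- \<omega> = \<sigma>' l @- \<omega>"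
        using symbol_map_leaf[OF T(1) l] eq by metis
    qed
  qed
  moreover from this have "T2 = T2'"
    using bij leaves_inj[OF T(2,3)] by (simp add: bij_betw_def)
  ultimately show ?thesis by simp
qed

text \<open>Equivalence becomes the kernel of \<open>symbol_map\<close>, so its transitivity
  requires no confluence argument for expansions.\<close>

lemma diagram_equiv_symbol_map:
  "diagram_equiv n =
     {(d, d'). d \<in> tree_diagrams n \<and> d' \<in> tree_diagrams n \<and> symbol_map d = symbol_map d'}"
proof -
  have "\<exists>e. (simple_expansion n)\<^sup>*\<^sup>* d e \<and> (simple_expansion n)\<^sup>*\<^sup>* d' e"
    if TD: "d \<in> tree_diagrams n" "d' \<in> tree_diagrams n" and eq: "symbol_map d = symbol_map d'" for d d'
  proof -
    obtain T1 T2 \<sigma> where d: "d = (T1, T2, \<sigma>)" by (cases d)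
    obtain T1' T2' \<sigma>' where d': "d' = (T1', T2', \<sigma>')" by (cases d')
    have "finite (leaves T1 \<union> leaves T1')"
      using TD leaves_complete_code by (simp add: d d' tree_diagrams_iff complete_code_def)
    then have M: "\<forall>l\<in>leaves T1. length l \<le> Max (length ` (leaves T1 \<union> leaves T1'))"
      "\<forall>l\<in>leaves T1'. length l \<le> Max (length ` (leaves T1 \<union> leaves T1'))"
      by auto
    let ?M = "Max (length ` (leaves T1 \<union> leaves T1'))"
    obtain U \<tau> where e: "(simple_expansion n)\<^sup>*\<^sup>* d (full_tree ?M, U, \<tau>)"
      using expansion_to_full_tree[OF TD(1)[unfolded d] M(1)] d by blast
    obtain U' \<tau>' where e': "(simple_expansion n)\<^sup>*\<^sup>* d' (full_tree ?M, U', \<tau>')"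
      using expansion_to_full_tree[OF TD(2)[unfolded d'] M(2)] d' by blast
    have "U = U' \<and> \<tau> = \<tau>'"
      by (rule symbol_map_inj)
        (use expansion_symbol_map[OF e TD(1)] expansion_symbol_map[OF e' TD(2)] eq in auto)
    then show ?thesis using e e' by blast
  qed
  moreover have "symbol_map d = symbol_map d'"
    if "d \<in> tree_diagrams n" "d' \<in> tree_diagrams n"
      "(simple_expansion n)\<^sup>*\<^sup>* d e" "(simple_expansion n)\<^sup>*\<^sup>* d' e" for d d' e
    using expansion_symbol_map that by metis
  ultimately show ?thesis unfolding diagram_equiv_def by blast
qed

section \<open>The group of tree symbols as a copy of \<Gamma>\<close>

definition symbol_class :: "nat stream rel \<Rightarrow> tree_diagram set" where
  "symbol_class q = {d \<in> tree_diagrams n. symbol_map d = q}"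

lemma symbol_class_nonempty: "q \<in> \<Gamma> \<Longrightarrow> symbol_class q \<noteq> {}"
proof -
  assume q: "q \<in> \<Gamma>"
  then obtain M where "prefix_local M q" by (auto simp: \<Gamma>_def)
  then show ?thesis using \<Gamma>_diagram[OF q] unfolding symbol_class_def by blast
qed

lemma diagram_equiv_class:
  "d \<in> tree_diagrams n \<Longrightarrow> diagram_equiv n `` {d} = symbol_class (symbol_map d)"
  by (auto simp: diagram_equiv_symbol_map symbol_class_def)

lemma carrier_G_n1: "carrier (G_n1 n) = symbol_class ` \<Gamma>"
proof -
  have "carrier (G_n1 n) = (\<lambda>d. symbol_class (symbol_map d)) ` tree_diagrams n"
    by (auto simp: G_n1_def quotient_def diagram_equiv_class)
  also have "\<dots> = symbol_class ` \<Gamma>"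
  proof
    show "(\<lambda>d. symbol_class (symbol_map d)) ` tree_diagrams n \<subseteq> symbol_class ` \<Gamma>"
      using symbol_map_in_\<Gamma> by blast
    show "symbol_class ` \<Gamma> \<subseteq> (\<lambda>d. symbol_class (symbol_map d)) ` tree_diagrams n"
      using symbol_class_nonempty by (fastforce simp: symbol_class_def)
  qed
  finally show ?thesis .
qed

lemma inj_on_symbol_class: "inj_on symbol_class \<Gamma>"
proof (rule inj_onI)
  fix q q' assume "q \<in> \<Gamma>" "q' \<in> \<Gamma>" "symbol_class q = symbol_class q'"
  moreover from this obtain d where "d \<in> symbol_class q" using symbol_class_nonempty by blast
  ultimately have "d \<in> symbol_class q" "d \<in> symbol_class q'" by auto
  then show "q = q'" by (simp add: symbol_class_def)
qed

lemma symbol_map_compose: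
  assumes d: "(T1, T, \<sigma>) \<in> tree_diagrams n" and d': "(T, T2, \<sigma>') \<in> tree_diagrams n"
  shows "(T1, T2, compose (leaves T1) \<sigma>' \<sigma>) \<in> tree_diagrams n"
    "symbol_map (T1, T2, compose (leaves T1) \<sigma>' \<sigma>) = symbol_map (T1, T, \<sigma>) O symbol_map (T, T2, \<sigma>')"
proof -
  have T: "T1 \<in> trees n" "T \<in> trees n" "bij_betw \<sigma> (leaves T1) (leaves T)"
    using d by (auto simp: tree_diagrams_iff)
  show TD: "(T1, T2, compose (leaves T1) \<sigma>' \<sigma>) \<in> tree_diagrams n"
    using d d' by (auto simp: tree_diagrams_iff intro!: bij_betw_compose)
  have "symbol_map (T1, T2, compose (leaves T1) \<sigma>' \<sigma>) \<subseteq> symbol_map (T1, T, \<sigma>) O symbol_map (T, T2, \<sigma>')"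
  proof clarify
    fix \<omega> \<omega>' assume "(\<omega>, \<omega>') \<in> symbol_map (T1, T2, compose (leaves T1) \<sigma>' \<sigma>)"
    then obtain l \<omega>0 where l: "l \<in> leaves T1" "\<omega>0 \<in> \<Omega>" "\<omega> = l @- \<omega>0" "\<omega>' = \<sigma>' (\<sigma> l) @- \<omega>0"
      unfolding symbol_map_mem by (auto simp: compose_def)
    have "\<sigma> l \<in> leaves T" using T(3) l(1) bij_betw_apply by metis
    then show "(\<omega>, \<omega>') \<in> symbol_map (T1, T, \<sigma>) O symbol_map (T, T2, \<sigma>')"
      using l symbol_map_leaf[OF T(1)] symbol_map_leaf[OF T(2)] by blast
  qed
  then show "symbol_map (T1, T2, compose (leaves T1) \<sigma>' \<sigma>) = symbol_map (T1, T, \<sigma>) O symbol_map (T, T2, \<sigma>')"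
    using word_bij_mono_eq word_bij_comp \<Gamma>_word_bij symbol_map_in_\<Gamma> TD d d' by blast
qed

text \<open>The product in \<open>G_n1\<close> is a union over all representatives with a common
  middle tree. Each such pair contributes the same class, so what remains is to exhibit one.\<close>

lemma mult_G_n1:
  assumes q: "q \<in> \<Gamma>" "q' \<in> \<Gamma>"
  shows "symbol_class q \<otimes>\<^bsub>G_n1 n\<^esub> symbol_class q' = symbol_class (q O q')"
proof -
  have prod: "diagram_equiv n `` {(T1, T2, compose (leaves T1) \<sigma>' \<sigma>)} = symbol_class (q O q')"
    if "(T1, T, \<sigma>) \<in> symbol_class q" "(T, T2, \<sigma>') \<in> symbol_class q'" for T1 T T2 \<sigma> \<sigma>'
  proof -
    have TD: "(T1, T, \<sigma>) \<in> tree_diagrams n" "(T, T2, \<sigma>') \<in> tree_diagrams n"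
      and eq: "symbol_map (T1, T, \<sigma>) = q" "symbol_map (T, T2, \<sigma>') = q'"
      using that by (auto simp: symbol_class_def)
    show ?thesis
      using diagram_equiv_class[OF symbol_map_compose(1)[OF TD]] symbol_map_compose(2)[OF TD] eq by simp
  qed
  \<comment> \<open>The middle tree is the full tree of depth \<open>M + M'\<close>: it is a source
    for \<open>q'\<close> directly, and a target for \<open>q\<close> after reversing a diagram of
    \<open>q\<inverse>\<close>.\<close>
  have q1: "q\<inverse> \<in> \<Gamma>" using \<Gamma>_converse q by blast
  obtain M M' where "prefix_local M (q\<inverse>)" "prefix_local M' q'"
    using q1 q(2) by (auto simp: \<Gamma>_def)
  then have M: "prefix_local (M + M') (q\<inverse>)" "prefix_local (M + M') q'"
    by (auto elim: prefix_local_mono)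
  obtain T1 \<tau> where \<tau>: "(full_tree (M + M'), T1, \<tau>) \<in> tree_diagrams n" "symbol_map (full_tree (M + M'), T1, \<tau>) = q\<inverse>"
    using \<Gamma>_diagram[OF q1 M(1)] .
  obtain \<sigma> where "(T1, full_tree (M + M'), \<sigma>) \<in> tree_diagrams n" "symbol_map (T1, full_tree (M + M'), \<sigma>) = q"
    using diagram_inverse[OF \<tau>(1)] unfolding \<tau>(2) by auto
  moreover obtain T2 \<sigma>' where "(full_tree (M + M'), T2, \<sigma>') \<in> tree_diagrams n" "symbol_map (full_tree (M + M'), T2, \<sigma>') = q'"
    using \<Gamma>_diagram[OF q(2) M(2)] .
  ultimately have ex: "\<exists>T1 T T2 \<sigma> \<sigma>'. (T1, T, \<sigma>) \<in> symbol_class q \<and> (T, T2, \<sigma>') \<in> symbol_class q'"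
    unfolding symbol_class_def by blast
  have "{diagram_equiv n `` {(T1, T2, compose (leaves T1) \<sigma>' \<sigma>)} | T1 T T2 \<sigma> \<sigma>'.
      (T1, T, \<sigma>) \<in> symbol_class q \<and> (T, T2, \<sigma>') \<in> symbol_class q'} = {symbol_class (q O q')}"
    using prod ex by blast
  then show ?thesis by (simp add: G_n1_def)
qed

end

section \<open>Labelled infinite words of a term\<close>

text \<open>An infinite word \<open>\<omega>\<close>, read as a path from the root, leaves a term through one of its
  variables.  \<open>lab\<close> returns that variable and the part of \<open>\<omega>\<close> that is left over.\<close>

primrec lab :: "('f, 'v) trm \<Rightarrow> nat stream \<Rightarrow> 'v \<times> nat stream" where
  "lab (Var x) = (\<lambda>\<omega>. (x, \<omega>))"
| "lab (App f ts) = (\<lambda>\<omega>. (map lab ts ! (shd \<omega> - 1)) (stl \<omega>))"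

text \<open>Multiplicities are kept: distinctness expresses linearity, and the multiset is the
  invariant of the equations.\<close>

primrec var_seq :: "('f, 'v) trm \<Rightarrow> 'v list" where
  "var_seq (Var x) = [x]"
| "var_seq (App f ts) = concat (map var_seq ts)"

lemma set_var_seq [simp]: "set (var_seq t) = vars t"
  by (induction t) auto

text \<open>No variable occurs at a depth less than \<open>k\<close>. This is the supply of function
  symbols that matching and rewriting consume.\<close>

primrec deep :: "nat \<Rightarrow> ('f, 'v) trm \<Rightarrow> bool" where
  "deep 0 t \<longleftrightarrow> True"
| "deep (Suc k) t \<longleftrightarrow> (\<exists>f ts. t = App f ts \<and> (\<forall>u\<in>set ts. deep k u))"

lemma Var_in_terms [simp]: "Var x \<in> terms a" "Var ` A \<subseteq> terms a"
  by (auto intro: terms.Var)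

lemma deep_Suc: "deep (Suc k) t \<Longrightarrow> deep k t"
  by (induction k arbitrary: t) force+

lemma deep_mono: "k \<le> m \<Longrightarrow> deep m t \<Longrightarrow> deep k t"
  by (induction m rule: dec_induct) (auto dest: deep_Suc simp del: deep.simps)

lemma deep_subst: "(\<And>x. x \<in> vars t \<Longrightarrow> deep k (\<phi> x)) \<Longrightarrow> deep k (subst \<phi> t)"
proof (induction t)
  case (App f ts)
  then have "deep (Suc k) (subst \<phi> (App f ts))" by auto
  then show ?case by (rule deep_Suc)
qed auto

context catalan begin

abbreviation ar :: "SC_symbol \<Rightarrow> nat" where
  "ar \<equiv> SC_arity n"

abbreviation SC_terms :: "(SC_symbol, nat) trm set" where
  "SC_terms \<equiv> terms ar"

lemma App_in_terms: "App f ts \<in> SC_terms \<longleftrightarrow> length ts = n \<and> set ts \<subseteq> SC_terms"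
  by (auto simp: SC_arity_def elim: terms.cases intro: terms.App)

lemma SC_terms_induct [consumes 1, case_names Var App]:
  assumes "t \<in> SC_terms"
    and "\<And>x. P (Var x)"
    and "\<And>ts. length ts = n \<Longrightarrow> set ts \<subseteq> SC_terms \<Longrightarrow>
      (\<And>i. i \<in> {1..n} \<Longrightarrow> P (ts ! (i - 1))) \<Longrightarrow> P (otimes ts)"
  shows "P t"
  using assms(1)
proof (induction rule: terms.induct)
  case (App ts f)
  have "f = Otimes" by (cases f)
  have len: "length ts = n" using App.hyps by (simp add: SC_arity_def)
  have "P (ts ! (i - 1))" if "i \<in> {1..n}" for i
  proof -
    have "ts ! (i - 1) \<in> set ts" using that len by auto
    then show ?thesis using App.IH by blast
  qed
  moreover have "set ts \<subseteq> SC_terms" using App.IH by blast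
  ultimately show ?case using assms(3)[OF len] \<open>f = Otimes\<close> by blast
qed (rule assms(2))

lemma lab_App [simp]:
  assumes "i \<in> {1..length ts}"
  shows "lab (App f ts) (i ## \<omega>) = lab (ts ! (i - 1)) \<omega>"
  using assms by auto

declare lab.simps(2) [simp del]

lemma vars_App_nth: "length ts = n \<Longrightarrow> x \<in> vars (App f ts) \<longleftrightarrow> (\<exists>i\<in>{1..n}. x \<in> vars (ts ! (i - 1)))"
proof
  assume len: "length ts = n" and "x \<in> vars (App f ts)"
  then obtain j where "j < n" "x \<in> vars (ts ! j)" by (auto simp: in_set_conv_nth)
  then show "\<exists>i\<in>{1..n}. x \<in> vars (ts ! (i - 1))" by (intro bexI[of _ "Suc j"]) auto
next
  assume len: "length ts = n" and "\<exists>i\<in>{1..n}. x \<in> vars (ts ! (i - 1))"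
  then obtain i where i: "i \<in> {1..n}" "x \<in> vars (ts ! (i - 1))" by blast
  then have "ts ! (i - 1) \<in> set ts" using len by auto
  then show "x \<in> vars (App f ts)" using i(2) by auto
qed

text \<open>A path that leaves \<open>t\<close> through \<open>x\<close> continues inside
  \<open>\<phi> x\<close>. Hence one comparison of the two sides of an equation controls all its
  substitution instances.\<close>

lemma lab_subst:
  "t \<in> SC_terms \<Longrightarrow> \<omega> \<in> \<Omega> \<Longrightarrow> lab (subst \<phi> t) \<omega> = (case lab t \<omega> of (x, \<omega>') \<Rightarrow> lab (\<phi> x) \<omega>')"
proof (induction arbitrary: \<omega> rule: SC_terms_induct)
  case (App ts)
  from App.prems show ?case
  proof (cases rule: \<Omega>_cases)
    case (1 i \<omega>')
    then show ?thesis using App.IH[of i \<omega>'] App.hyps by simp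
  qed
qed simp

lemma lab_in:
  "t \<in> SC_terms \<Longrightarrow> \<omega> \<in> \<Omega> \<Longrightarrow> lab t \<omega> = (x, \<omega>') \<Longrightarrow> x \<in> vars t \<and> \<omega>' \<in> \<Omega>"
proof (induction arbitrary: \<omega> rule: SC_terms_induct)
  case (App ts)
  from App.prems(1) show ?case
  proof (cases rule: \<Omega>_cases)
    case (1 i \<omega>1)
    then have "x \<in> vars (ts ! (i - 1)) \<and> \<omega>' \<in> \<Omega>"
      using App.IH[of i \<omega>1] App.hyps App.prems by simp
    then show ?thesis using vars_App_nth[OF App.hyps(1)] 1 by auto
  qed
qed simp

text \<open>\<open>l\<close> is the path to some occurrence of \<open>x\<close>.\<close>

lemma lab_onto:
  "t \<in> SC_terms \<Longrightarrow> x \<in> vars t \<Longrightarrow> \<exists>l\<in>words. \<forall>\<omega>\<in>\<Omega>. lab t (l @- \<omega>) = (x, \<omega>)"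
proof (induction rule: SC_terms_induct)
  case (Var y)
  then show ?case by (intro bexI[of _ "[]"]) auto
next
  case (App ts)
  from App.prems obtain i where i: "i \<in> {1..n}" "x \<in> vars (ts ! (i - 1))"
    unfolding vars_App_nth[OF App.hyps(1)] by blast
  then obtain l where "l \<in> words" "\<forall>\<omega>\<in>\<Omega>. lab (ts ! (i - 1)) (l @- \<omega>) = (x, \<omega>)"
    using App.IH by blast
  then show ?case using i App.hyps by (intro bexI[of _ "i # l"]) auto
qed

lemma vars_nonempty: "t \<in> SC_terms \<Longrightarrow> vars t \<noteq> {}"
proof -
  assume t: "t \<in> SC_terms"
  obtain \<omega> where "\<omega> \<in> \<Omega>" using \<Omega>_nonempty by blast
  then show ?thesis using lab_in[OF t] by (metis empty_iff surj_pair)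
qed

text \<open>\<open>N\<close> is the depth of \<open>t\<close>: a word of that length has already
  left the term, and its unread rest is \<open>v\<close>.\<close>

lemma lab_local:
  "t \<in> SC_terms \<Longrightarrow> \<exists>N. \<forall>w\<in>words. N \<le> length w \<longrightarrow>
     (\<exists>x\<in>vars t. \<exists>v\<in>words. \<forall>\<omega>\<in>\<Omega>. lab t (w @- \<omega>) = (x, v @- \<omega>))"
proof (induction rule: SC_terms_induct)
  case (Var x)
  then show ?case by (intro exI[of _ 0]) auto
next
  case (App ts)
  then have "\<forall>i\<in>{1..n}. \<exists>N. \<forall>w\<in>words. N \<le> length w \<longrightarrow>
     (\<exists>x\<in>vars (ts ! (i - 1)). \<exists>v\<in>words. \<forall>\<omega>\<in>\<Omega>. lab (ts ! (i - 1)) (w @- \<omega>) = (x, v @- \<omega>))"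
    by blast
  then obtain N where N: "\<And>i w. i \<in> {1..n} \<Longrightarrow> w \<in> words \<Longrightarrow> N i \<le> length w \<Longrightarrow>
     (\<exists>x\<in>vars (ts ! (i - 1)). \<exists>v\<in>words. \<forall>\<omega>\<in>\<Omega>. lab (ts ! (i - 1)) (w @- \<omega>) = (x, v @- \<omega>))"
    unfolding bchoice_iff by blast
  have "\<exists>x\<in>vars (otimes ts). \<exists>v\<in>words. \<forall>\<omega>\<in>\<Omega>. lab (otimes ts) (w @- \<omega>) = (x, v @- \<omega>)"
    if w: "w \<in> words" "Suc (Max (N ` {1..n})) \<le> length w" for w
  proof -
    from w obtain i w' where iw: "w = i # w'" "i \<in> {1..n}" "w' \<in> words" "Max (N ` {1..n}) \<le> length w'"
      by (cases w) auto
    then have "N i \<le> length w'" by (meson Max_ge finite_atLeastAtMost finite_imageI imageI le_trans)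
    then obtain x v where "x \<in> vars (ts ! (i - 1))" "v \<in> words"
      "\<forall>\<omega>\<in>\<Omega>. lab (ts ! (i - 1)) (w' @- \<omega>) = (x, v @- \<omega>)"
      using N iw by blast
    moreover from this have "x \<in> vars (otimes ts)"
      unfolding vars_App_nth[OF App.hyps(1)] using iw(2) by blast
    ultimately show ?thesis using iw App.hyps(1) by (intro bexI[of _ x] bexI[of _ v]) auto
  qed
  then show ?case by blast
qed

lemma distinct_var_seq_App:
  assumes "distinct (var_seq (App f ts))" "length ts = n"
  shows "i \<in> {1..n} \<Longrightarrow> distinct (var_seq (ts ! (i - 1)))"
    and "i \<in> {1..n} \<Longrightarrow> j \<in> {1..n} \<Longrightarrow> x \<in> vars (ts ! (i - 1)) \<Longrightarrow> x \<in> vars (ts ! (j - 1)) \<Longrightarrow> i = j"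
proof -
  have d: "\<forall>i<n. distinct (var_seq (ts ! i))"
    "\<And>i j. i < j \<Longrightarrow> j < n \<Longrightarrow> vars (ts ! i) \<inter> vars (ts ! j) = {}"
    using assms unfolding var_seq.simps distinct_concat_nth by auto
  show "i \<in> {1..n} \<Longrightarrow> distinct (var_seq (ts ! (i - 1)))" using d(1) by auto
  assume ij: "i \<in> {1..n}" "j \<in> {1..n}" and x: "x \<in> vars (ts ! (i - 1))" "x \<in> vars (ts ! (j - 1))"
  show "i = j"
  proof (rule ccontr)
    assume "i \<noteq> j"
    then have "i - 1 < j - 1 \<or> j - 1 < i - 1" "i - 1 < n" "j - 1 < n" using ij by auto
    then show False using d(2)[of "i - 1" "j - 1"] d(2)[of "j - 1" "i - 1"] x by blast
  qed
qed

text \<open>In a linear term the exit variable reveals the occurrence, hence the path to it; the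
  remainder gives the rest of the word.\<close>

lemma lab_inj:
  "t \<in> SC_terms \<Longrightarrow> distinct (var_seq t) \<Longrightarrow> \<omega> \<in> \<Omega> \<Longrightarrow> \<omega>' \<in> \<Omega> \<Longrightarrow> lab t \<omega> = lab t \<omega>' \<Longrightarrow> \<omega> = \<omega>'"
proof (induction arbitrary: \<omega> \<omega>' rule: SC_terms_induct)
  case (App ts)
  obtain i \<omega>1 where \<omega>: "\<omega> = i ## \<omega>1" "i \<in> {1..n}" "\<omega>1 \<in> \<Omega>"
    using App.prems(2) by (cases rule: \<Omega>_cases) auto
  obtain j \<omega>2 where \<omega>': "\<omega>' = j ## \<omega>2" "j \<in> {1..n}" "\<omega>2 \<in> \<Omega>"
    using App.prems(3) by (cases rule: \<Omega>_cases) auto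
  have eq: "lab (ts ! (i - 1)) \<omega>1 = lab (ts ! (j - 1)) \<omega>2"
    using App.prems(4) \<omega> \<omega>' App.hyps by simp
  obtain x \<omega>0 where x: "lab (ts ! (i - 1)) \<omega>1 = (x, \<omega>0)" by fastforce
  have "ts ! (i - 1) \<in> SC_terms" "ts ! (j - 1) \<in> SC_terms" using \<omega>(2) \<omega>'(2) App.hyps by auto
  then have "x \<in> vars (ts ! (i - 1))" "x \<in> vars (ts ! (j - 1))"
    using lab_in x eq \<omega>(3) \<omega>'(3) by metis+
  then have "i = j" using distinct_var_seq_App(2)[OF App.prems(1) App.hyps(1)] \<omega> \<omega>' by blast
  moreover have "\<omega>1 = \<omega>2"
    using App.IH[OF \<omega>(2) distinct_var_seq_App(1)[OF App.prems(1) App.hyps(1) \<omega>(2)] \<omega>(3) \<omega>'(3)] eq \<open>i = j\<close>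
    by simp
  ultimately show ?case using \<omega> \<omega>' by simp
qed simp

text \<open>Equal exits force equal shapes: a variable returns the word unread, whereas a compound
  term consumes at least one letter on every path.\<close>

lemma lab_eq_imp_eq:
  "u \<in> SC_terms \<Longrightarrow> v \<in> SC_terms \<Longrightarrow> (\<And>\<omega>. \<omega> \<in> \<Omega> \<Longrightarrow> lab u \<omega> = lab v \<omega>) \<Longrightarrow> u = v"
proof (induction arbitrary: v rule: SC_terms_induct)
  \<comment> \<open>The path \<open>1 # l\<close> to a variable in the first argument would have to
    fix every infinite word.\<close>
  have Var_App: False
    if "otimes ts \<in> SC_terms" "\<And>\<omega>. \<omega> \<in> \<Omega> \<Longrightarrow> lab (otimes ts) \<omega> = (x, \<omega>)" for x and ts :: "(SC_symbol, nat) trm list"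
  proof -
    have ts: "length ts = n" "ts ! 0 \<in> SC_terms"
      using that(1) n2 unfolding App_in_terms by (auto simp: subset_iff)
    obtain y where "y \<in> vars (ts ! 0)" using vars_nonempty[OF ts(2)] by blast
    then obtain l where l: "l \<in> words" "\<And>\<omega>. \<omega> \<in> \<Omega> \<Longrightarrow> lab (ts ! 0) (l @- \<omega>) = (y, \<omega>)"
      using lab_onto[OF ts(2)] by blast
    have "\<omega> = (1 # l) @- \<omega>" if "\<omega> \<in> \<Omega>" for \<omega>
    proof -
      have "1 ## l @- \<omega> \<in> \<Omega>" using that l n2 by simp
      from \<open>\<And>\<omega>. \<omega> \<in> \<Omega> \<Longrightarrow> lab (otimes ts) \<omega> = (x, \<omega>)\<close>[OF this]
      have "(y, \<omega>) = (x, 1 ## l @- \<omega>)" using l(2)[OF that] ts n2 by simp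
      then show ?thesis by simp
    qed
    then have "1 # l = []" by (rule shift_fixed_Nil)
    then show False by simp
  qed
  {
    case (Var x)
    show ?case
    proof (cases v)
      case (Var y)
      obtain \<omega> where "\<omega> \<in> \<Omega>" using \<Omega>_nonempty by blast
      with Var Var.prems(2) show ?thesis by fastforce
    next
      case (App f ts)
      moreover have "f = Otimes" by (cases f)
      ultimately show ?thesis using Var_App[of ts x] Var.prems by fastforce
    qed
  next
    case (App ts)
    show ?case
    proof (cases v)
      case (Var y)
      have "otimes ts \<in> SC_terms" using App.hyps by (simp add: App_in_terms)
      then show ?thesis using Var_App[of ts y] App.prems Var by fastforce
    next
      case v: (App f us)
      have f: "f = Otimes" by (cases f)
      have us: "length us = n" "set us \<subseteq> SC_terms"
        using App.prems(1) v by (simp_all add: App_in_terms)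
      have "ts = us"
      proof (rule nth_equalityI)
        show "length ts = length us" using App.hyps us by simp
      next
        fix j assume j: "j < length ts"
        define i where "i = Suc j"
        have i: "i \<in> {1..n}" "j = i - 1" using j App.hyps by (auto simp: i_def)
        have "us ! (i - 1) \<in> SC_terms" using i us by auto
        moreover have "lab (ts ! (i - 1)) \<omega> = lab (us ! (i - 1)) \<omega>" if "\<omega> \<in> \<Omega>" for \<omega>
          using App.prems(2)[of "i ## \<omega>"] that i us App.hyps by (simp add: v f)
        ultimately show "ts ! j = us ! j" using App.IH[OF i(1)] i(2) by blast
      qed
      then show ?thesis using v f by simp
    qed
  }
qed

text \<open>\<open>N\<close> is the depth of \<open>s\<close>: below it nothing of \<open>s\<close>
  is left to compare, and linearity removes every consistency condition between occurrences. The
  surplus depth \<open>k\<close> survives in the values of the substitution.\<close>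

lemma deep_match:
  "s \<in> SC_terms \<Longrightarrow> distinct (var_seq s) \<Longrightarrow>
     \<exists>N. \<forall>k u. u \<in> SC_terms \<longrightarrow> deep (N + k) u \<longrightarrow>
       (\<exists>\<phi>\<in>substs ar. subst \<phi> s = u \<and> (\<forall>x\<in>vars s. deep k (\<phi> x)))"
proof (induction rule: SC_terms_induct)
  case (Var x)
  have "\<exists>\<phi>\<in>substs ar. subst \<phi> (Var x) = u \<and> (\<forall>y\<in>vars (Var x :: (SC_symbol, nat) trm). deep k (\<phi> y))"
    if "u \<in> SC_terms" "deep k u" for k u
    using that by (intro bexI[of _ "\<lambda>_. u"]) (auto simp: substs_def)
  then show ?case by (intro exI[of _ 0]) simp
next
  case (App ts)
  then have "\<forall>i\<in>{1..n}. \<exists>N. \<forall>k u. u \<in> SC_terms \<longrightarrow> deep (N + k) u \<longrightarrow>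
       (\<exists>\<phi>\<in>substs ar. subst \<phi> (ts ! (i - 1)) = u \<and> (\<forall>x\<in>vars (ts ! (i - 1)). deep k (\<phi> x)))"
    using distinct_var_seq_App(1)[OF App.prems App.hyps(1)] by blast
  then obtain N where N: "\<And>i k u. i \<in> {1..n} \<Longrightarrow> u \<in> SC_terms \<Longrightarrow> deep (N i + k) u \<Longrightarrow>
       (\<exists>\<phi>\<in>substs ar. subst \<phi> (ts ! (i - 1)) = u \<and> (\<forall>x\<in>vars (ts ! (i - 1)). deep k (\<phi> x)))"
    unfolding bchoice_iff by blast
  let ?N = "Max (N ` {1..n})"
  have "\<exists>\<phi>\<in>substs ar. subst \<phi> (otimes ts) = u \<and> (\<forall>x\<in>vars (otimes ts). deep k (\<phi> x))"
    if u: "u \<in> SC_terms" "deep (Suc ?N + k) u" for k u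
  proof -
    obtain f us where "u = App f us" "\<forall>u\<in>set us. deep (?N + k) u"
      using u(2) by auto
    moreover have "f = Otimes" by (cases f)
    ultimately have us: "u = otimes us" "\<forall>u\<in>set us. deep (?N + k) u" "length us = n" "set us \<subseteq> SC_terms"
      using u(1) by (auto simp: App_in_terms)
    have "\<exists>\<phi>\<in>substs ar. subst \<phi> (ts ! (i - 1)) = us ! (i - 1) \<and> (\<forall>x\<in>vars (ts ! (i - 1)). deep k (\<phi> x))"
      if i: "i \<in> {1..n}" for i
    proof (rule N[OF i])
      have mem: "us ! (i - 1) \<in> set us" using i us(3) by auto
      then show "us ! (i - 1) \<in> SC_terms" using us(4) by blast
      have "N i + k \<le> ?N + k" using i by simp
      then show "deep (N i + k) (us ! (i - 1))" using us(2) mem deep_mono by blast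
    qed
    then obtain \<phi> where \<phi>: "\<And>i. i \<in> {1..n} \<Longrightarrow> \<phi> i \<in> substs ar \<and> subst (\<phi> i) (ts ! (i - 1)) = us ! (i - 1) \<and>
        (\<forall>x\<in>vars (ts ! (i - 1)). deep k (\<phi> i x))"
      by metis
    \<comment> \<open>By linearity each variable of the term lies in exactly one argument, so the
      substitutions found for the arguments can be glued; \<open>ix\<close> picks the
      argument.\<close>
    define ix where "ix x = (SOME i. i \<in> {1..n} \<and> x \<in> vars (ts ! (i - 1)))" for x
    have ix: "ix x = i" if "i \<in> {1..n}" "x \<in> vars (ts ! (i - 1))" for i x
      unfolding ix_def using that distinct_var_seq_App(2)[OF App.prems App.hyps(1)]
      by (intro some_equality) blast+
    define \<psi> where "\<psi> x = (if x \<in> vars (otimes ts) then \<phi> (ix x) x else Var x)" for x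
    have \<psi>: "\<psi> x = \<phi> i x" if "i \<in> {1..n}" "x \<in> vars (ts ! (i - 1))" for i x
      unfolding \<psi>_def ix[OF that] using that vars_App_nth[OF App.hyps(1)] by metis
    have "\<psi> \<in> substs ar"
      unfolding substs_def
    proof clarify
      fix x
      show "\<psi> x \<in> SC_terms"
      proof (cases "x \<in> vars (otimes ts)")
        case True
        then obtain i where i: "i \<in> {1..n}" "x \<in> vars (ts ! (i - 1))"
          using vars_App_nth[OF App.hyps(1)] by blast
        then show ?thesis using \<phi>[OF i(1)] \<psi>[OF i] by (auto simp: substs_def)
      qed (auto simp: \<psi>_def intro: terms.Var)
    qed
    moreover have "map (subst \<psi>) ts = us"
    proof (rule nth_equalityI)
      show "length (map (subst \<psi>) ts) = length us" using App.hyps us(3) by simp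
    next
      fix j assume j: "j < length (map (subst \<psi>) ts)"
      define i where "i = Suc j"
      have i: "i \<in> {1..n}" "j = i - 1" using j App.hyps by (auto simp: i_def)
      have "subst \<psi> (ts ! (i - 1)) = subst (\<phi> i) (ts ! (i - 1))"
        unfolding subst_cong_vars using \<psi>[OF i(1)] by blast
      then show "map (subst \<psi>) ts ! j = us ! j" using \<phi>[OF i(1)] j i(2) by simp
    qed
    moreover have "\<forall>x\<in>vars (otimes ts). deep k (\<psi> x)"
      using \<phi> \<psi> vars_App_nth[OF App.hyps(1)] by metis
    ultimately show ?thesis using us(1) by (intro bexI[of _ \<psi>]) auto
  qed
  then show ?case by blast
qed

lemma subst_in_terms:
  "t \<in> SC_terms \<Longrightarrow> \<phi> \<in> substs ar \<Longrightarrow> subst \<phi> t \<in> SC_terms"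
  by (induction rule: terms.induct) (auto simp: substs_def intro!: terms.App)

section \<open>The bijection of infinite words represented by a map of terms\<close>

text \<open>The condition is vacuous for an empty \<open>f\<close>. Uniqueness of \<open>q\<close>
  therefore rests on a term in the domain of \<open>f\<close>, and on its linearity, which makes
  \<open>lab\<close> injective.\<close>

definition represents :: "nat stream rel \<Rightarrow> (SC_symbol, nat) trm rel \<Rightarrow> bool" where
  "represents q f \<longleftrightarrow> (\<forall>(u, v)\<in>f. \<forall>(\<omega>, \<omega>')\<in>q. lab u \<omega> = lab v \<omega>')"

text \<open>For linear terms with the same variables this is the prefix exchange between the
  occurrences of each variable.\<close>

definition match_rel :: "(SC_symbol, nat) trm \<Rightarrow> (SC_symbol, nat) trm \<Rightarrow> nat stream rel" where
  "match_rel s t = {(\<omega>, \<omega>') \<in> \<Omega> \<times> \<Omega>. lab s \<omega> = lab t \<omega>'}"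

definition linear_pair :: "(SC_symbol, nat) trm \<Rightarrow> (SC_symbol, nat) trm \<Rightarrow> bool" where
  "linear_pair s t \<longleftrightarrow> s \<in> SC_terms \<and> t \<in> SC_terms \<and>
     distinct (var_seq s) \<and> distinct (var_seq t) \<and> vars s = vars t"

lemma linear_pair_sym: "linear_pair s t \<longleftrightarrow> linear_pair t s"
  by (auto simp: linear_pair_def)

lemma match_rel_total:
  assumes "s \<in> SC_terms" "t \<in> SC_terms" "vars s = vars t" "\<omega> \<in> \<Omega>"
  shows "\<exists>\<omega>'. (\<omega>, \<omega>') \<in> match_rel s t"
proof -
  obtain x \<omega>0 where x: "lab s \<omega> = (x, \<omega>0)" by fastforce
  then have "x \<in> vars t" "\<omega>0 \<in> \<Omega>" using lab_in assms by metis+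
  then obtain l where "l \<in> words" "lab t (l @- \<omega>0) = (x, \<omega>0)" using lab_onto assms(2) by blast
  then have "(\<omega>, l @- \<omega>0) \<in> match_rel s t"
    using x \<open>\<omega>0 \<in> \<Omega>\<close> assms(4) by (simp add: match_rel_def)
  then show ?thesis by blast
qed

lemma match_rel_in_\<Gamma>:
  assumes "linear_pair s t"
  shows "match_rel s t \<in> \<Gamma>"
proof -
  have st: "s \<in> SC_terms" "t \<in> SC_terms" "distinct (var_seq s)" "distinct (var_seq t)" "vars s = vars t"
    using assms by (auto simp: linear_pair_def)
  have "word_bij (match_rel s t)"
  proof (rule word_bijI)
    show "match_rel s t \<subseteq> \<Omega> \<times> \<Omega>" by (auto simp: match_rel_def)
    show "\<exists>\<omega>'. (\<omega>, \<omega>') \<in> match_rel s t" if "\<omega> \<in> \<Omega>" for \<omega>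
      using match_rel_total[OF st(1,2,5) that] .
    show "\<exists>\<omega>. (\<omega>, \<omega>') \<in> match_rel s t" if "\<omega>' \<in> \<Omega>" for \<omega>'
      using match_rel_total[OF st(2,1) st(5)[symmetric] that] by (auto simp: match_rel_def)
    show "\<omega>' = \<omega>''" if "(\<omega>, \<omega>') \<in> match_rel s t" "(\<omega>, \<omega>'') \<in> match_rel s t" for \<omega> \<omega>' \<omega>''
      using that lab_inj[OF st(2,4)] by (auto simp: match_rel_def)
    show "\<omega> = \<omega>'" if "(\<omega>, \<omega>'') \<in> match_rel s t" "(\<omega>', \<omega>'') \<in> match_rel s t" for \<omega> \<omega>' \<omega>''
      using that lab_inj[OF st(1,3)] by (auto simp: match_rel_def)
  qed
  moreover obtain N where N: "\<forall>w\<in>words. N \<le> length w \<longrightarrow>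
      (\<exists>x\<in>vars s. \<exists>v\<in>words. \<forall>\<omega>\<in>\<Omega>. lab s (w @- \<omega>) = (x, v @- \<omega>))"
    using lab_local[OF st(1)] by blast
  have "prefix_local N (match_rel s t)"
    unfolding prefix_local_def
  proof (intro ballI impI)
    fix w assume w: "w \<in> words" "length w = N"
    then obtain x v where x: "x \<in> vars s" "v \<in> words" "\<forall>\<omega>\<in>\<Omega>. lab s (w @- \<omega>) = (x, v @- \<omega>)"
      using N by blast
    then obtain l where l: "l \<in> words" "\<forall>\<omega>\<in>\<Omega>. lab t (l @- \<omega>) = (x, \<omega>)"
      using lab_onto[OF st(2)] st(5) by blast
    show "\<exists>w'\<in>words. \<forall>\<omega>\<in>\<Omega>. (w @- \<omega>, w' @- \<omega>) \<in> match_rel s t"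
      using w x l by (intro bexI[of _ "l @ v"]) (auto simp: match_rel_def)
  qed
  ultimately show ?thesis by (auto simp: \<Gamma>_def)
qed

lemma represents_rho:
  assumes "s \<in> SC_terms" "t \<in> SC_terms"
  shows "represents (match_rel s t) (rho ar s t)"
  unfolding represents_def rho_def match_rel_def using assms by (auto simp: lab_subst)

lemma represents_comp:
  "represents q f \<Longrightarrow> represents q' g \<Longrightarrow> represents (q O q') (f O g)"
  unfolding represents_def by fastforce

lemma represents_converse: "represents q f \<Longrightarrow> represents (q\<inverse>) (f\<inverse>)"
  unfolding represents_def by fastforce

text \<open>Both \<open>q\<close> and \<open>q'\<close> have a source word for
  \<open>\<omega>'\<close> with the same value of \<open>lab u\<close>, and linearity of
  \<open>u\<close> makes the two source words equal.\<close>

lemma represents_word_bij_subset: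
  assumes q: "word_bij q" "word_bij q'" and rep: "represents q f" "represents q' f"
    and uv: "(u, v) \<in> f" "v \<in> SC_terms" and u: "u \<in> SC_terms" "distinct (var_seq u)"
  shows "q \<subseteq> q'"
proof clarify
  fix \<omega> \<omega>' assume 1: "(\<omega>, \<omega>') \<in> q"
  then have "\<omega> \<in> \<Omega>" "\<omega>' \<in> \<Omega>" using word_bij_subset[OF q(1)] by auto
  obtain \<omega>1 where 2: "(\<omega>1, \<omega>') \<in> q'" using word_bij_onto[OF q(2) \<open>\<omega>' \<in> \<Omega>\<close>] by blast
  have "lab u \<omega> = lab v \<omega>'" "lab u \<omega>1 = lab v \<omega>'"
    using rep uv(1) 1 2 unfolding represents_def by fast+
  then have "\<omega> = \<omega>1"
    using lab_inj[OF u \<open>\<omega> \<in> \<Omega>\<close>] word_bij_subset[OF q(2) 2] by simp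
  then show "(\<omega>, \<omega>') \<in> q'" using 2 by simp
qed

lemma represents_unique:
  assumes "word_bij q" "word_bij q'" "represents q f" "represents q' f"
    "(u, v) \<in> f" "v \<in> SC_terms" "u \<in> SC_terms" "distinct (var_seq u)"
  shows "q = q'"
  using represents_word_bij_subset[OF assms] represents_word_bij_subset[OF assms(2,1,4,3,5-8)] by blast

section \<open>Terms with prescribed shape\<close>

text \<open>The leaf at address \<open>w\<close> carries the variable \<open>g w\<close>, so an
  injective \<open>g\<close> yields a linear term of shape \<open>T\<close>.\<close>

function tree_term :: "tree \<Rightarrow> (nat list \<Rightarrow> nat) \<Rightarrow> (SC_symbol, nat) trm" where
  "tree_term Leaf g = Var (g [])"
| "tree_term (Node Ts) g =
     otimes (map (\<lambda>i. tree_term (Ts ! (i - 1)) (\<lambda>w. g (i # w))) [1..<Suc (length Ts)])"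
  by pat_completeness auto
termination
proof (relation "measure (size \<circ> fst)")
  fix Ts :: "tree list" and i and g :: "nat list \<Rightarrow> nat"
  assume "i \<in> set [1..<Suc (length Ts)]"
  then have "Ts ! (i - 1) \<in> set Ts" by (auto simp del: upt_Suc)
  then have "size (Ts ! (i - 1)) < Suc (size_list size Ts)"
    by (simp add: size_list_estimation' less_Suc_eq_le)
  then show "((Ts ! (i - 1), \<lambda>w. g (i # w)), Node Ts, g) \<in> measure (size \<circ> fst)" by simp
qed simp

declare tree_term.simps(2) [simp del]

lemma tree_term_Node:
  assumes "length Ts = n"
  obtains ts where "tree_term (Node Ts) g = otimes ts" "length ts = n"
    "\<And>i. i \<in> {1..n} \<Longrightarrow> ts ! (i - 1) = tree_term (Ts ! (i - 1)) (\<lambda>w. g (i # w))"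
proof
  let ?ts = "map (\<lambda>i. tree_term (Ts ! (i - 1)) (\<lambda>w. g (i # w))) [1..<Suc n]"
  show "tree_term (Node Ts) g = otimes ?ts" using assms by (simp add: tree_term.simps(2))
  show "length ?ts = n" by simp
  show "\<And>i. i \<in> {1..n} \<Longrightarrow> ?ts ! (i - 1) = tree_term (Ts ! (i - 1)) (\<lambda>w. g (i # w))"
    by (auto simp del: upt_Suc)
qed

lemma all_set_nth: "length ts = n \<Longrightarrow> (\<forall>t\<in>set ts. P t) \<longleftrightarrow> (\<forall>i\<in>{1..n}. P (ts ! (i - 1)))"
proof
  assume len: "length ts = n" and P: "\<forall>i\<in>{1..n}. P (ts ! (i - 1))"
  show "\<forall>t\<in>set ts. P t"
  proof
    fix t assume "t \<in> set ts"
    then obtain j where "j < n" "t = ts ! j" using len by (auto simp: in_set_conv_nth)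
    then show "P t" using P[rule_format, of "Suc j"] by auto
  qed
qed auto

lemma tree_term_in_terms: "T \<in> trees n \<Longrightarrow> tree_term T g \<in> SC_terms"
proof (induction arbitrary: g rule: trees.induct)
  case (Node Ts)
  obtain ts where ts: "tree_term (Node Ts) g = otimes ts" "length ts = n"
    "\<And>i. i \<in> {1..n} \<Longrightarrow> ts ! (i - 1) = tree_term (Ts ! (i - 1)) (\<lambda>w. g (i # w))"
    using tree_term_Node[OF Node(1)] by blast
  have "\<forall>i\<in>{1..n}. ts ! (i - 1) \<in> SC_terms" using ts(3) Node.IH Node.hyps by auto
  then show ?case using ts(1,2) all_set_nth[OF ts(2), of "\<lambda>t. t \<in> SC_terms"] by (auto simp: App_in_terms)
qed (auto intro: terms.Var)

lemma lab_tree_term: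
  "T \<in> trees n \<Longrightarrow> l \<in> leaves T \<Longrightarrow> lab (tree_term T g) (l @- \<omega>) = (g l, \<omega>)"
proof (induction arbitrary: g l rule: trees.induct)
  case (Node Ts)
  obtain ts where ts: "tree_term (Node Ts) g = otimes ts" "length ts = n"
    "\<And>i. i \<in> {1..n} \<Longrightarrow> ts ! (i - 1) = tree_term (Ts ! (i - 1)) (\<lambda>w. g (i # w))"
    using tree_term_Node[OF Node(1)] by blast
  obtain i l' where l: "l = i # l'" using Node.prems Nil_notin_leaves_Node by (cases l) auto
  with Node.prems have i: "i \<in> {1..n}" "l' \<in> leaves (Ts ! (i - 1))"
    using Node.hyps by (auto simp: Cons_in_leaves_Node)
  have "Ts ! (i - 1) \<in> set Ts" using i Node.hyps by auto
  then show ?case using Node.IH i ts l by simp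
qed simp

lemma vars_tree_term: "T \<in> trees n \<Longrightarrow> vars (tree_term T g) = g ` leaves T"
proof (induction arbitrary: g rule: trees.induct)
  case (Node Ts)
  obtain ts where ts: "tree_term (Node Ts) g = otimes ts" "length ts = n"
    "\<And>i. i \<in> {1..n} \<Longrightarrow> ts ! (i - 1) = tree_term (Ts ! (i - 1)) (\<lambda>w. g (i # w))"
    using tree_term_Node[OF Node(1)] by blast
  have "x \<in> vars (otimes ts) \<longleftrightarrow> x \<in> g ` leaves (Node Ts)" for x
  proof -
    have "x \<in> vars (otimes ts) \<longleftrightarrow> (\<exists>i\<in>{1..n}. x \<in> vars (ts ! (i - 1)))"
      by (rule vars_App_nth[OF ts(2)])
    also have "\<dots> \<longleftrightarrow> (\<exists>i\<in>{1..n}. x \<in> (\<lambda>w. g (i # w)) ` leaves (Ts ! (i - 1)))"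
      by (rule bex_cong[OF HOL.refl]) (use ts(3) Node.IH Node.hyps in auto)
    also have "\<dots> \<longleftrightarrow> x \<in> g ` leaves (Node Ts)"
      unfolding leaves.simps(2) using Node.hyps by blast
    finally show ?thesis .
  qed
  then show ?case using ts(1) by auto
qed simp

lemma distinct_tree_term:
  "T \<in> trees n \<Longrightarrow> inj_on g (leaves T) \<Longrightarrow> distinct (var_seq (tree_term T g))"
proof (induction arbitrary: g rule: trees.induct)
  case (Node Ts)
  obtain ts where ts: "tree_term (Node Ts) g = otimes ts" "length ts = n"
    "\<And>i. i \<in> {1..n} \<Longrightarrow> ts ! (i - 1) = tree_term (Ts ! (i - 1)) (\<lambda>w. g (i # w))"
    using tree_term_Node[OF Node(1)] by blast
  have tsj: "ts ! j = tree_term (Ts ! j) (\<lambda>w. g (Suc j # w))" "Ts ! j \<in> set Ts" if "j < n" for j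
    using ts(3)[of "Suc j"] that Node.hyps by auto
  have mem: "Suc j # w \<in> leaves (Node Ts)" if "j < n" "w \<in> leaves (Ts ! j)" for j w
    using that Node.hyps by (simp add: Cons_in_leaves_Node)
  have "distinct (var_seq (ts ! j))" if "j < n" for j
  proof -
    have "inj_on (\<lambda>w. g (Suc j # w)) (leaves (Ts ! j))"
      using inj_onD[OF Node.prems] mem[OF that] by (intro inj_onI) blast
    then show ?thesis using tsj[OF that] Node.IH by simp
  qed
  moreover have "vars (ts ! j) \<inter> vars (ts ! k) = {}" if "j < k" "k < n" for j k
  proof -
    have jn: "j < n" using that by simp
    have "g (Suc j # w) \<noteq> g (Suc k # w')" if "w \<in> leaves (Ts ! j)" "w' \<in> leaves (Ts ! k)" for w w'
      using inj_onD[OF Node.prems _ mem[OF jn that(1)] mem[OF \<open>k < n\<close> that(2)]] \<open>j < k\<close> by auto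
    moreover have "Ts ! j \<in> trees n" "Ts ! k \<in> trees n" using tsj jn that Node.IH by auto
    ultimately show ?thesis using tsj(1)[OF jn] tsj(1)[OF that(2)] vars_tree_term by auto
  qed
  ultimately show ?case unfolding ts(1) var_seq.simps distinct_concat_nth using ts(2) by simp
qed simp

lemma deep_full_tree: "deep M (tree_term (full_tree M) g)"
proof (induction M arbitrary: g)
  case (Suc M)
  obtain ts where ts: "tree_term (full_tree (Suc M)) g = otimes ts" "length ts = n"
    "\<And>i. i \<in> {1..n} \<Longrightarrow> ts ! (i - 1) = tree_term (replicate n (full_tree M) ! (i - 1)) (\<lambda>w. g (i # w))"
    using tree_term_Node[of "replicate n (full_tree M)" g] by auto
  have "\<forall>i\<in>{1..n}. deep M (ts ! (i - 1))" using ts(3) Suc by auto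
  then show ?case using ts(1) all_set_nth[OF ts(2)] by auto
qed simp

lemma linear_deep_term:
  obtains u where "u \<in> SC_terms" "distinct (var_seq u)" "deep M u"
proof
  let ?u = "tree_term (full_tree M) to_nat"
  show "?u \<in> SC_terms" "deep M ?u"
    using tree_term_in_terms full_tree_in_trees deep_full_tree by auto
  show "distinct (var_seq ?u)"
    by (intro distinct_tree_term full_tree_in_trees) (simp add: inj_on_def)
qed

text \<open>A leaf of \<open>T1\<close> and its partner under \<open>\<sigma>\<close> get the same
  variable, namely the number of the partner.\<close>

lemma symbol_map_match_rel:
  assumes d: "(T1, T2, \<sigma>) \<in> tree_diagrams n"
  obtains u v where "linear_pair u v" "match_rel u v = symbol_map (T1, T2, \<sigma>)"
proof
  have T: "T1 \<in> trees n" "T2 \<in> trees n" "bij_betw \<sigma> (leaves T1) (leaves T2)"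
    using d by (auto simp: tree_diagrams_iff)
  let ?u = "tree_term T1 (to_nat \<circ> \<sigma>)" and ?v = "tree_term T2 to_nat"
  show lin: "linear_pair ?u ?v"
    unfolding linear_pair_def
  proof (intro conjI)
    show "distinct (var_seq ?u)" "distinct (var_seq ?v)"
      using T by (auto intro!: distinct_tree_term comp_inj_on simp: bij_betw_def inj_on_def)
    show "vars ?u = vars ?v"
      using T by (simp add: vars_tree_term bij_betw_def flip: image_image)
  qed (use T tree_term_in_terms in auto)
  have "symbol_map (T1, T2, \<sigma>) \<subseteq> match_rel ?u ?v"
  proof clarify
    fix \<omega> \<omega>' assume "(\<omega>, \<omega>') \<in> symbol_map (T1, T2, \<sigma>)"
    then obtain l \<omega>0 where l: "l \<in> leaves T1" "\<omega>0 \<in> \<Omega>" "\<omega> = l @- \<omega>0" "\<omega>' = \<sigma> l @- \<omega>0"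
      unfolding symbol_map_mem by blast
    have "\<sigma> l \<in> leaves T2" using T(3) l(1) bij_betw_apply by metis
    then show "(\<omega>, \<omega>') \<in> match_rel ?u ?v"
      using l lab_tree_term T leaves_in_words by (simp add: match_rel_def)
  qed
  then show "match_rel ?u ?v = symbol_map (T1, T2, \<sigma>)"
    using word_bij_mono_eq \<Gamma>_word_bij symbol_map_in_\<Gamma>[OF d] match_rel_in_\<Gamma>[OF lin] by blast
qed

section \<open>Maps of the structure monoid\<close>

lemma rho_at_Nil:
  assumes "s \<in> SC_terms"
  shows "rho_at ar s t [] = rho ar s t"
  using subst_in_terms[OF assms] unfolding rho_at_def rho_def by auto

text \<open>Peels off the outermost letter of the address, so that facts about \<open>rho_at\<close>
  follow from those about \<open>rho\<close> by induction.\<close>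

lemma rho_at_Cons:
  "rho_at ar s t ((f, i) # \<alpha>) =
     {(App f ts, App f (ts[i - 1 := v])) | ts v.
        App f ts \<in> SC_terms \<and> i \<in> {1..n} \<and> (ts ! (i - 1), v) \<in> rho_at ar s t \<alpha>}"
    (is "?L = ?R")
proof
  show "?L \<subseteq> ?R"
  proof clarify
    fix u u' assume "(u, u') \<in> ?L"
    then obtain v w where u: "u \<in> SC_terms" "sub u ((f, i) # \<alpha>) = Some v"
      "u' = replace u ((f, i) # \<alpha>) w" "(v, w) \<in> rho ar s t"
      unfolding rho_at_def by blast
    then obtain ts where ts: "u = App f ts" "i \<in> {1..n}" "sub (ts ! (i - 1)) \<alpha> = Some v"
      by (cases u) (auto simp: App_in_terms SC_arity_def split: if_splits)
    have "ts ! (i - 1) \<in> SC_terms" using u(1) ts by (auto simp: App_in_terms)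
    then have "(ts ! (i - 1), replace (ts ! (i - 1)) \<alpha> w) \<in> rho_at ar s t \<alpha>"
      unfolding rho_at_def using ts(3) u(4) by blast
    then show "\<exists>ts v. (u, u') = (App f ts, App f (ts[i - 1 := v])) \<and>
        App f ts \<in> SC_terms \<and> i \<in> {1..n} \<and> (ts ! (i - 1), v) \<in> rho_at ar s t \<alpha>"
      using u ts by auto
  qed
  show "?R \<subseteq> ?L"
  proof clarify
    fix ts v assume ts: "App f ts \<in> SC_terms" "i \<in> {1..n}" "(ts ! (i - 1), v) \<in> rho_at ar s t \<alpha>"
    then obtain x w where x: "sub (ts ! (i - 1)) \<alpha> = Some x" "v = replace (ts ! (i - 1)) \<alpha> w" "(x, w) \<in> rho ar s t"
      unfolding rho_at_def by blast
    then have "sub (App f ts) ((f, i) # \<alpha>) = Some x"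
      "App f (ts[i - 1 := v]) = replace (App f ts) ((f, i) # \<alpha>) w"
      using ts by (auto simp: App_in_terms)
    then show "(App f ts, App f (ts[i - 1 := v])) \<in> ?L"
      unfolding rho_at_def using ts(1) x(3) by blast
  qed
qed

lemma App_update_in_terms:
  assumes "App f ts \<in> SC_terms" "v \<in> SC_terms"
  shows "App f (ts[j := v]) \<in> SC_terms"
  using assms set_update_subset_insert[of ts j v] by (auto simp: App_in_terms)

lemma rho_at_in_terms:
  assumes "s \<in> SC_terms" "t \<in> SC_terms"
  shows "rho_at ar s t \<alpha> \<subseteq> SC_terms \<times> SC_terms"
proof (induction \<alpha>)
  case Nil
  show ?case unfolding rho_at_Nil[OF assms(1)] rho_def using subst_in_terms assms by auto
next
  case (Cons fi \<alpha>)
  obtain f i where fi: "fi = (f, i)" by (cases fi)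
  show ?case unfolding fi rho_at_Cons using Cons App_update_in_terms by auto
qed

lemma rho_at_converse_subset:
  assumes "s \<in> SC_terms" "t \<in> SC_terms"
  shows "(u, v) \<in> rho_at ar s t \<alpha> \<Longrightarrow> (v, u) \<in> rho_at ar t s \<alpha>"
proof (induction \<alpha> arbitrary: u v)
  case Nil
  then show ?case unfolding rho_at_Nil[OF assms(1)] rho_at_Nil[OF assms(2)] rho_def by auto
next
  case (Cons fi \<alpha>)
  obtain f i where fi: "fi = (f, i)" by (cases fi)
  from Cons.prems obtain ts w where ts: "u = App f ts" "v = App f (ts[i - 1 := w])" "App f ts \<in> SC_terms"
    "i \<in> {1..n}" "(ts ! (i - 1), w) \<in> rho_at ar s t \<alpha>"
    unfolding fi rho_at_Cons by auto
  have "w \<in> SC_terms" using rho_at_in_terms[OF assms] ts(5) by blast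
  then have "v \<in> SC_terms" using ts App_update_in_terms by simp
  moreover have "i - 1 < length ts" using ts(3,4) by (auto simp: App_in_terms)
  then have "ts[i - 1 := w] ! (i - 1) = w" "ts = (ts[i - 1 := w])[i - 1 := ts ! (i - 1)]"
    by auto
  ultimately have "u = App f ((ts[i - 1 := w])[i - 1 := ts ! (i - 1)])"
    "((ts[i - 1 := w]) ! (i - 1), ts ! (i - 1)) \<in> rho_at ar t s \<alpha>" "App f (ts[i - 1 := w]) \<in> SC_terms"
    using ts(1,2) Cons.IH[OF ts(5)] by simp_all
  then show ?case unfolding fi rho_at_Cons using ts(2,4) by blast
qed

lemma rho_at_converse:
  assumes "s \<in> SC_terms" "t \<in> SC_terms"
  shows "(rho_at ar s t \<alpha>)\<inverse> = rho_at ar t s \<alpha>"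
  using rho_at_converse_subset[OF assms] rho_at_converse_subset[OF assms(2,1)] by auto

lemma rho_at_represented:
  assumes "linear_pair s t"
  shows "\<exists>q\<in>\<Gamma>. represents q (rho_at ar s t \<alpha>)"
proof (induction \<alpha>)
  case Nil
  have "s \<in> SC_terms" "t \<in> SC_terms" using assms by (auto simp: linear_pair_def)
  then show ?case
    using match_rel_in_\<Gamma>[OF assms] represents_rho rho_at_Nil by metis
next
  case (Cons fi \<alpha>)
  obtain f i where fi: "fi = (f, i)" by (cases fi)
  obtain q where q: "q \<in> \<Gamma>" "represents q (rho_at ar s t \<alpha>)" using Cons by blast
  have "represents (embed_at i q) (rho_at ar s t ((f, i) # \<alpha>))"
    unfolding represents_def
  proof clarify
    fix u v \<omega> \<omega>'
    assume "(u, v) \<in> rho_at ar s t ((f, i) # \<alpha>)" and 2: "(\<omega>, \<omega>') \<in> embed_at i q"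
    then obtain ts w where ts: "u = App f ts" "v = App f (ts[i - 1 := w])" "App f ts \<in> SC_terms"
      "i \<in> {1..n}" "(ts ! (i - 1), w) \<in> rho_at ar s t \<alpha>"
      unfolding rho_at_Cons by auto
    from 2 obtain j \<omega>1 \<omega>2 where j: "\<omega> = j ## \<omega>1" "\<omega>' = j ## \<omega>2" "j \<in> {1..n}"
      "(\<omega>1, \<omega>2) \<in> (if j = i then q else Id_on \<Omega>)"
      unfolding embed_at_def by blast
    have len: "length ts = n" using ts(3) by (simp add: App_in_terms)
    have "lab u \<omega> = lab (ts ! (j - 1)) \<omega>1"
      unfolding ts(1) j(1) using j(3) len by (intro lab_App) simp
    moreover have "lab v \<omega>' = lab (ts[i - 1 := w] ! (j - 1)) \<omega>2"
      unfolding ts(2) j(2) using j(3) len by (intro lab_App) simp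
    moreover have "lab (ts ! (j - 1)) \<omega>1 = lab (ts[i - 1 := w] ! (j - 1)) \<omega>2"
    proof (cases "j = i")
      case True
      have "i - 1 < length ts" using ts(4) len by auto
      then show ?thesis using True q(2) ts(5) j(4) unfolding represents_def by auto
    next
      case False
      then have "i - 1 \<noteq> j - 1" using ts(4) j(3) by auto
      then show ?thesis using False j(4) by auto
    qed
    ultimately show "lab u \<omega> = lab v \<omega>'" by simp
  qed
  then show ?case using \<Gamma>_embed_at[OF q(1)] fi by blast
qed

text \<open>The loss of depth \<open>N\<close> does not depend on the term. It is the loss of
  matching \<open>s\<close>, plus one level per letter of the address.\<close>

lemma rho_at_deep:
  assumes "linear_pair s t" "\<alpha> \<in> addresses ar"
  shows "\<exists>N. \<forall>k u. u \<in> SC_terms \<longrightarrow> deep (N + k) u \<longrightarrow> (\<exists>v. (u, v) \<in> rho_at ar s t \<alpha> \<and> deep k v)"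
  using assms(2)
proof (induction \<alpha>)
  case Nil
  have st: "s \<in> SC_terms" "distinct (var_seq s)" "vars s = vars t"
    using assms(1) by (auto simp: linear_pair_def)
  obtain N where N: "\<And>k u. u \<in> SC_terms \<Longrightarrow> deep (N + k) u \<Longrightarrow>
       \<exists>\<phi>\<in>substs ar. subst \<phi> s = u \<and> (\<forall>x\<in>vars s. deep k (\<phi> x))"
    using deep_match[OF st(1,2)] by blast
  have "\<exists>v. (u, v) \<in> rho_at ar s t [] \<and> deep k v" if u: "u \<in> SC_terms" "deep (N + k) u" for k u
  proof -
    obtain \<phi> where \<phi>: "\<phi> \<in> substs ar" "subst \<phi> s = u" "\<forall>x\<in>vars s. deep k (\<phi> x)"
      using N[OF u] by blast
    then have "(u, subst \<phi> t) \<in> rho_at ar s t []"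
      unfolding rho_at_Nil[OF st(1)] rho_def by blast
    moreover have "deep k (subst \<phi> t)" using \<phi>(3) st(3) by (intro deep_subst) simp
    ultimately show ?thesis by blast
  qed
  then show ?case by blast
next
  case (Cons fi \<alpha>)
  obtain f i where fi: "fi = (f, i)" by (cases fi)
  have i: "i \<in> {1..n}" and "\<alpha> \<in> addresses ar"
    using Cons.prems unfolding fi by (auto simp: addresses_def SC_arity_def)
  then obtain N where N: "\<And>k u. u \<in> SC_terms \<Longrightarrow> deep (N + k) u \<Longrightarrow>
      \<exists>v. (u, v) \<in> rho_at ar s t \<alpha> \<and> deep k v"
    using Cons.IH by blast
  have "\<exists>v. (u, v) \<in> rho_at ar s t (fi # \<alpha>) \<and> deep k v" if u: "u \<in> SC_terms" "deep (Suc N + k) u" for k u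
  proof -
    obtain g ts where g: "u = App g ts" "\<forall>t\<in>set ts. deep (N + k) t" using u(2) by auto
    moreover have "g = f" by (cases g; cases f) simp
    ultimately have ts: "u = App f ts" "length ts = n" "set ts \<subseteq> SC_terms"
      using u(1) by (auto simp: App_in_terms)
    have "ts ! (i - 1) \<in> set ts" using i ts(2) by auto
    then obtain v where v: "(ts ! (i - 1), v) \<in> rho_at ar s t \<alpha>" "deep k v"
      using N g(2) ts(3) by blast
    have "(u, App f (ts[i - 1 := v])) \<in> rho_at ar s t (fi # \<alpha>)"
      unfolding fi rho_at_Cons using ts u(1) i v(1) by blast
    moreover have "\<forall>t\<in>set (ts[i - 1 := v]). deep k t"
    proof
      fix t assume "t \<in> set (ts[i - 1 := v])"
      then have "t = v \<or> t \<in> set ts" using set_update_subset_insert by fastforce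
      then show "deep k t" using v(2) g(2) deep_mono[of k "N + k"] by auto
    qed
    then have "deep (Suc k) (App f (ts[i - 1 := v]))" by simp
    then have "deep k (App f (ts[i - 1 := v]))" by (rule deep_Suc)
    ultimately show ?thesis by blast
  qed
  then show ?case by blast
qed

lemma concat_var_seq_Var: "concat (map (var_seq \<circ> Var) xs) = xs"
  by (induction xs) auto

lemma SC_linear_pair:
  assumes "(s, t) \<in> SC n"
  shows "linear_pair s t"
proof -
  have seq: "concat (map var_seq (var_list i j)) = [i..<Suc j]" for i j
    unfolding var_list_def by (simp add: concat_var_seq_Var del: upt_Suc)
  have Var: "set (var_list i j) \<subseteq> SC_terms" for i j
    by (auto simp: var_list_def intro: terms.Var)
  have len: "length (var_list i j) = Suc j - i" for i j
    by (simp add: var_list_def del: upt_Suc)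
  from assms consider
      (assoc) i where "0 < i" "i < n"
        "s = otimes (var_list 1 i @ [otimes (var_list (i + 1) (i + n))] @ var_list (i + n + 1) (2 * n - 1))"
        "t = otimes (var_list 1 (i - 1) @ [otimes (var_list i (i + n - 1))] @ var_list (i + n) (2 * n - 1))"
    | (swap) i where "0 < i" "i < n"
        "s = otimes (var_list 1 (i - 1) @ [Var i, Var (i + 1)] @ var_list (i + 2) n)"
        "t = otimes (var_list 1 (i - 1) @ [Var (i + 1), Var i] @ var_list (i + 2) n)"
    unfolding SC_def by auto
  then show ?thesis
  proof cases
    case assoc
    have "var_seq s = [1..<Suc i] @ [i + 1..<Suc (i + n)] @ [i + n + 1..<Suc (2 * n - 1)]"
      unfolding assoc by (simp add: seq del: upt_Suc)
    then have s: "distinct (var_seq s)" "set (var_seq s) = {1..2 * n - 1}"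
      using assoc(2) by (auto simp del: upt_Suc set_var_seq)
    have "var_seq t = [1..<Suc (i - 1)] @ [i..<Suc (i + n - 1)] @ [i + n..<Suc (2 * n - 1)]"
      unfolding assoc by (simp add: seq del: upt_Suc)
    then have t: "distinct (var_seq t)" "set (var_seq t) = {1..2 * n - 1}"
      using assoc(1,2) by (auto simp del: upt_Suc set_var_seq)
    have "s \<in> SC_terms" "t \<in> SC_terms"
      unfolding assoc using assoc(1,2) Var by (auto simp: App_in_terms len)
    then show ?thesis using s t unfolding linear_pair_def by simp
  next
    case swap
    have s': "var_seq s = [1..<Suc (i - 1)] @ [i, i + 1] @ [i + 2..<Suc n]"
      unfolding swap by (simp add: seq del: upt_Suc)
    then have s: "distinct (var_seq s)" by (auto simp del: upt_Suc set_var_seq)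
    have t': "var_seq t = [1..<Suc (i - 1)] @ [i + 1, i] @ [i + 2..<Suc n]"
      unfolding swap by (simp add: seq del: upt_Suc)
    then have t: "distinct (var_seq t)" by (auto simp del: upt_Suc set_var_seq)
    have "set (var_seq s) = set (var_seq t)" unfolding s' t' by (auto simp del: upt_Suc)
    moreover have "s \<in> SC_terms" "t \<in> SC_terms"
      unfolding swap using swap(1,2) Var by (auto simp: App_in_terms len intro: terms.Var)
    ultimately show ?thesis using s t unfolding linear_pair_def by simp
  qed
qed

lemma generator_linear_pair:
  "(s, t) \<in> SC n \<or> (t, s) \<in> SC n \<Longrightarrow> linear_pair s t"
  using SC_linear_pair linear_pair_sym by blast

abbreviation maps :: "(SC_symbol, nat) trm rel set" where
  "maps \<equiv> Struct_maps ar (SC n)"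

lemma maps_in_terms: "f \<in> maps \<Longrightarrow> f \<subseteq> SC_terms \<times> SC_terms"
proof (induction rule: Struct_maps.induct)
  case (generator s t \<alpha>)
  then have "s \<in> SC_terms" "t \<in> SC_terms"
    using generator_linear_pair unfolding linear_pair_def by blast+
  then show ?case by (rule rho_at_in_terms)
qed auto

lemma maps_converse: "f \<in> maps \<Longrightarrow> f\<inverse> \<in> maps"
proof (induction rule: Struct_maps.induct)
  case identity
  show ?case by (simp add: Struct_maps.identity)
next
  case (generator s t \<alpha>)
  then have "s \<in> SC_terms" "t \<in> SC_terms"
    using generator_linear_pair unfolding linear_pair_def by blast+
  then show ?case using generator Struct_maps.generator[of t s "SC n" \<alpha> ar] by (auto simp: rho_at_converse)
next
  case (composite f g)
  then show ?case by (simp add: converse_relcomp Struct_maps.composite)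
qed

text \<open>The free parameter \<open>k\<close> makes the losses of depth additive under
  composition; in particular no composite of generators has an empty domain.\<close>

lemma maps_deep:
  "f \<in> maps \<Longrightarrow> \<exists>N. \<forall>k u. u \<in> SC_terms \<longrightarrow> deep (N + k) u \<longrightarrow> (\<exists>v. (u, v) \<in> f \<and> deep k v)"
proof (induction rule: Struct_maps.induct)
  case identity
  then show ?case by (intro exI[of _ 0]) auto
next
  case (generator s t \<alpha>)
  then show ?case using rho_at_deep generator_linear_pair by blast
next
  case (composite f g)
  obtain N where N: "\<And>k u. u \<in> SC_terms \<Longrightarrow> deep (N + k) u \<Longrightarrow> \<exists>v. (u, v) \<in> f \<and> deep k v"
    using composite.IH(1) by blast
  obtain N' where N': "\<And>k u. u \<in> SC_terms \<Longrightarrow> deep (N' + k) u \<Longrightarrow> \<exists>v. (u, v) \<in> g \<and> deep k v"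
    using composite.IH(2) by blast
  have "\<exists>w. (u, w) \<in> f O g \<and> deep k w" if u: "u \<in> SC_terms" "deep (N + N' + k) u" for k u
  proof -
    obtain v where v: "(u, v) \<in> f" "deep (N' + k) v" using N[OF u(1), of "N' + k"] u(2) by (auto simp: add.assoc)
    have "v \<in> SC_terms" using maps_in_terms[OF composite.hyps(1)] v(1) by blast
    then obtain w where "(v, w) \<in> g" "deep k w" using N' v(2) by blast
    then show ?thesis using v(1) by blast
  qed
  then show ?case by blast
qed

lemma maps_represented: "f \<in> maps \<Longrightarrow> \<exists>q\<in>\<Gamma>. represents q f"
proof (induction rule: Struct_maps.induct)
  case identity
  have "represents (Id_on \<Omega>) (Id_on SC_terms)" by (auto simp: represents_def)
  then show ?case using \<Gamma>_Id by blast
next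
  case (generator s t \<alpha>)
  then show ?case using rho_at_represented generator_linear_pair by blast
next
  case (composite f g)
  then show ?case using represents_comp \<Gamma>_comp by blast
qed

lemma maps_represents_unique:
  assumes "f \<in> maps" "q \<in> \<Gamma>" "q' \<in> \<Gamma>" "represents q f" "represents q' f"
  shows "q = q'"
proof -
  obtain N where N: "\<And>k u. u \<in> SC_terms \<Longrightarrow> deep (N + k) u \<Longrightarrow> \<exists>v. (u, v) \<in> f \<and> deep k v"
    using maps_deep[OF assms(1)] by blast
  obtain u where u: "u \<in> SC_terms" "distinct (var_seq u)" "deep N u" by (rule linear_deep_term)
  then obtain v where "(u, v) \<in> f" using N[of u 0] by auto
  moreover from this have "v \<in> SC_terms" using maps_in_terms[OF assms(1)] by blast
  ultimately show ?thesis using represents_unique \<Gamma>_word_bij assms u by blast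
qed

section \<open>The homomorphism from structure maps to \<Gamma>\<close>

definition map_bij :: "(SC_symbol, nat) trm rel \<Rightarrow> nat stream rel" where
  "map_bij f = (THE q. q \<in> \<Gamma> \<and> represents q f)"

lemma map_bij:
  assumes "f \<in> maps"
  shows "map_bij f \<in> \<Gamma>" "represents (map_bij f) f"
proof -
  have "\<exists>!q. q \<in> \<Gamma> \<and> represents q f"
    using maps_represented[OF assms] maps_represents_unique[OF assms] by blast
  then have "map_bij f \<in> \<Gamma> \<and> represents (map_bij f) f" unfolding map_bij_def by (rule theI')
  then show "map_bij f \<in> \<Gamma>" "represents (map_bij f) f" by auto
qed

lemma map_bij_eqI:
  "f \<in> maps \<Longrightarrow> q \<in> \<Gamma> \<Longrightarrow> represents q f \<Longrightarrow> map_bij f = q"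
  using maps_represents_unique map_bij by blast

lemma map_bij_comp: "f \<in> maps \<Longrightarrow> g \<in> maps \<Longrightarrow> map_bij (f O g) = map_bij f O map_bij g"
  by (intro map_bij_eqI Struct_maps.composite \<Gamma>_comp represents_comp map_bij)

lemma map_bij_converse: "f \<in> maps \<Longrightarrow> map_bij (f\<inverse>) = (map_bij f)\<inverse>"
  by (intro map_bij_eqI maps_converse \<Gamma>_converse represents_converse map_bij)

lemma map_bij_Id: "map_bij (Id_on SC_terms) = Id_on \<Omega>"
  by (intro map_bij_eqI Struct_maps.identity \<Gamma>_Id) (auto simp: represents_def)

lemma map_bij_idem:
  assumes "e \<in> maps" "e O e = e"
  shows "map_bij e = Id_on \<Omega>"
  using word_bij_idem[OF \<Gamma>_word_bij[OF map_bij(1)[OF assms(1)]]] map_bij_comp[OF assms(1,1)] assms(2)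
  by simp

lemma map_bij_kernel:
  assumes "f \<in> maps" "map_bij f = Id_on \<Omega>"
  shows "f O f = f"
proof -
  have eq: "u = v" if "(u, v) \<in> f" for u v
  proof (rule lab_eq_imp_eq)
    show "u \<in> SC_terms" "v \<in> SC_terms" using maps_in_terms[OF assms(1)] that by auto
    show "lab u \<omega> = lab v \<omega>" if "\<omega> \<in> \<Omega>" for \<omega>
      using map_bij(2)[OF assms(1)] \<open>(u, v) \<in> f\<close> that unfolding assms(2) represents_def by blast
  qed
  show ?thesis
  proof (intro equalityI subrelI)
    fix u v assume "(u, v) \<in> f"
    with eq[OF this] show "(u, v) \<in> f O f" by auto
  qed (use eq in auto)
qed

section \<open>Equational consequences realised by structure maps\<close>

text \<open>The orbits of the structure monoid. Which map joins two terms may be forgotten: its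
  bijection is determined by the two terms as soon as the first is linear.\<close>

definition linked :: "(SC_symbol, nat) trm \<Rightarrow> (SC_symbol, nat) trm \<Rightarrow> bool" where
  "linked u v \<longleftrightarrow> (\<exists>f\<in>maps. (u, v) \<in> f)"

lemma linked_refl: "u \<in> SC_terms \<Longrightarrow> linked u u"
  unfolding linked_def using Struct_maps.identity by blast

lemma linked_sym: "linked u v \<Longrightarrow> linked v u"
  unfolding linked_def using maps_converse by blast

lemma linked_trans: "linked u v \<Longrightarrow> linked v w \<Longrightarrow> linked u w"
  unfolding linked_def using Struct_maps.composite by blast

lemma linked_in_terms: "linked u v \<Longrightarrow> u \<in> SC_terms \<and> v \<in> SC_terms"
  unfolding linked_def using maps_in_terms by blast

text \<open>\<open>f'\<close> arises from \<open>f\<close> by putting \<open>(Otimes, i)\<close> in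
  front of the address of every generator, so it serves for all surrounding arguments at
  once.\<close>

lemma maps_context:
  assumes i: "i \<in> {1..n}" and f: "f \<in> maps"
  shows "\<exists>f'\<in>maps. \<forall>ts v. otimes ts \<in> SC_terms \<longrightarrow> (ts ! (i - 1), v) \<in> f \<longrightarrow>
    (otimes ts, otimes (ts[i - 1 := v])) \<in> f'"
  using f
proof (induction rule: Struct_maps.induct)
  case identity
  then show ?case by (intro bexI[of _ "Id_on SC_terms"]) (auto intro: Struct_maps.identity)
next
  case (generator s t \<alpha>)
  have "(Otimes, i) # \<alpha> \<in> addresses ar"
    using generator(2) i by (auto simp: addresses_def SC_arity_def)
  then have "rho_at ar s t ((Otimes, i) # \<alpha>) \<in> maps"
    using generator(1) by (intro Struct_maps.generator)
  moreover have "(otimes ts, otimes (ts[i - 1 := v])) \<in> rho_at ar s t ((Otimes, i) # \<alpha>)"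
    if "otimes ts \<in> SC_terms" "(ts ! (i - 1), v) \<in> rho_at ar s t \<alpha>" for ts v
    unfolding rho_at_Cons using that i by blast
  ultimately show ?case by blast
next
  case (composite f g)
  obtain f' where f': "f' \<in> maps" "\<And>ts v. otimes ts \<in> SC_terms \<Longrightarrow> (ts ! (i - 1), v) \<in> f \<Longrightarrow>
    (otimes ts, otimes (ts[i - 1 := v])) \<in> f'" using composite.IH(1) by blast
  obtain g' where g': "g' \<in> maps" "\<And>ts v. otimes ts \<in> SC_terms \<Longrightarrow> (ts ! (i - 1), v) \<in> g \<Longrightarrow>
    (otimes ts, otimes (ts[i - 1 := v])) \<in> g'" using composite.IH(2) by blast
  have "(otimes ts, otimes (ts[i - 1 := w])) \<in> f' O g'"
    if ts: "otimes ts \<in> SC_terms" and w: "(ts ! (i - 1), w) \<in> f O g" for ts w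
  proof -
    obtain v where v: "(ts ! (i - 1), v) \<in> f" "(v, w) \<in> g" using w by blast
    have "v \<in> SC_terms" using maps_in_terms[OF composite.hyps(1)] v(1) by blast
    then have ts': "otimes (ts[i - 1 := v]) \<in> SC_terms" using ts App_update_in_terms by blast
    have "i - 1 < length ts" using ts i by (auto simp: App_in_terms)
    then have "(otimes (ts[i - 1 := v]), otimes (ts[i - 1 := w])) \<in> g'"
      using g'(2)[OF ts', of w] v(2) by simp
    then show ?thesis using f'(2)[OF ts v(1)] by blast
  qed
  moreover have "f' O g' \<in> maps" using f'(1) g'(1) by (rule Struct_maps.composite)
  ultimately show ?case by (intro bexI[of _ "f' O g'"] allI impI)
qed

lemma linked_context:
  assumes "linked u v" "otimes (as @ u # bs) \<in> SC_terms"
  shows "linked (otimes (as @ u # bs)) (otimes (as @ v # bs))"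
proof -
  obtain f where f: "f \<in> maps" "(u, v) \<in> f" using assms(1) by (auto simp: linked_def)
  define i where "i = Suc (length as)"
  have i: "i \<in> {1..n}" using assms(2) by (auto simp: App_in_terms i_def)
  obtain f' where f': "f' \<in> maps" "\<And>ts v. otimes ts \<in> SC_terms \<Longrightarrow> (ts ! (i - 1), v) \<in> f \<Longrightarrow>
    (otimes ts, otimes (ts[i - 1 := v])) \<in> f'" using maps_context[OF i f(1)] by blast
  from f'(2)[OF assms(2), of v] f(2) have "(otimes (as @ u # bs), otimes (as @ v # bs)) \<in> f'"
    by (simp add: i_def)
  then show ?thesis using f'(1) by (auto simp: linked_def)
qed

lemma linked_equation:
  assumes "(s, t) \<in> SC n" "\<phi> \<in> substs ar"
  shows "linked (subst \<phi> s) (subst \<phi> t)"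
proof -
  have "rho_at ar s t [] \<in> maps"
    using assms(1) by (intro Struct_maps.generator) (auto simp: addresses_def)
  moreover have "(subst \<phi> s, subst \<phi> t) \<in> rho_at ar s t []"
    using SC_linear_pair[OF assms(1)] assms(2) rho_at_Nil by (auto simp: linear_pair_def rho_def)
  ultimately show ?thesis by (auto simp: linked_def)
qed

text \<open>Variables count from 1, as in the equations; \<open>Var 0\<close> is an arbitrary value
  that makes the substitution total.\<close>

definition nth_subst :: "(SC_symbol, nat) trm list \<Rightarrow> nat \<Rightarrow> (SC_symbol, nat) trm" where
  "nth_subst xs k = (if k \<in> {1..length xs} then xs ! (k - 1) else Var 0)"

lemma nth_subst_in_substs: "set xs \<subseteq> SC_terms \<Longrightarrow> nth_subst xs \<in> substs ar"
  by (auto simp: substs_def nth_subst_def intro: terms.Var)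

lemma map_nth_subst:
  assumes "1 \<le> i" "j \<le> length xs"
  shows "map (subst (nth_subst xs)) (var_list i j) = take (Suc j - i) (drop (i - 1) xs)"
  using assms by (intro nth_equalityI) (auto simp: var_list_def nth_subst_def simp del: upt_Suc)

lemma linked_assoc:
  assumes len: "length bs = n - 1" "length as + length ds + 2 = n"
    and mem: "set (as @ a # bs @ c # ds) \<subseteq> SC_terms"
  shows "linked (otimes (as @ a # otimes (bs @ [c]) # ds)) (otimes (as @ otimes (a # bs) # c # ds))"
proof -
  \<comment> \<open>In the associativity equation, \<open>a\<close> is the variable with index
    \<open>i\<close> that enters the inner product and \<open>c\<close> the one with index
    \<open>i + n\<close> that leaves it.\<close>
  define i where "i = Suc (length as)"
  define xs where "xs = as @ a # bs @ c # ds"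
  have i: "0 < i" "i < n" and lxs: "length xs = 2 * n - 1"
    using len by (auto simp: i_def xs_def)
  have eqn: "(otimes (var_list 1 i @ [otimes (var_list (i + 1) (i + n))] @ var_list (i + n + 1) (2 * n - 1)),
      otimes (var_list 1 (i - 1) @ [otimes (var_list i (i + n - 1))] @ var_list (i + n) (2 * n - 1))) \<in> SC n"
    unfolding SC_def using i by blast
  have m: "map (subst (nth_subst xs)) (var_list k j) = take (Suc j - k) (drop (k - 1) xs)"
    if "1 \<le> k" "j \<le> 2 * n - 1" for k j
    using map_nth_subst that lxs by simp
  have n: "n = Suc (length bs)" using len n2 by simp
  have lbs: "length bs = length as + length ds + 1" using len by simp
  have "map (subst (nth_subst xs)) (var_list 1 i) = take i xs"
    "map (subst (nth_subst xs)) (var_list (i + 1) (i + n)) = take n (drop i xs)"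
    "map (subst (nth_subst xs)) (var_list (i + n + 1) (2 * n - 1)) = take (n - (i + 1)) (drop (i + n) xs)"
    "map (subst (nth_subst xs)) (var_list 1 (i - 1)) = take (i - 1) xs"
    "map (subst (nth_subst xs)) (var_list i (i + n - 1)) = take n (drop (i - 1) xs)"
    "map (subst (nth_subst xs)) (var_list (i + n) (2 * n - 1)) = take (n - i) (drop (i + n - 1) xs)"
    using i m[of 1 i] m[of "i + 1" "i + n"] m[of "i + n + 1" "2 * n - 1"] m[of 1 "i - 1"]
      m[of i "i + n - 1"] m[of "i + n" "2 * n - 1"] by (simp_all add: add.commute)
  moreover have "take i xs = as @ [a]" "take (i - 1) xs = as"
    "take n (drop i xs) = bs @ [c]" "take (n - (i + 1)) (drop (i + n) xs) = ds"
    "take n (drop (i - 1) xs) = a # bs" "take (n - i) (drop (i + n - 1) xs) = c # ds"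
    by (simp_all add: i_def xs_def n lbs One_nat_def numeral_eq_Suc)
  moreover have "nth_subst xs \<in> substs ar"
    using mem by (intro nth_subst_in_substs) (simp add: xs_def)
  ultimately show ?thesis using linked_equation[OF eqn, of "nth_subst xs"] by simp
qed

lemma linked_swap:
  assumes len: "length as + length bs + 2 = n" and mem: "set (as @ a # b # bs) \<subseteq> SC_terms"
  shows "linked (otimes (as @ a # b # bs)) (otimes (as @ b # a # bs))"
proof -
  define i where "i = Suc (length as)"
  define xs where "xs = as @ a # b # bs"
  have i: "0 < i" "i < n" and lxs: "length xs = n" using len by (auto simp: i_def xs_def)
  have eqn: "(otimes (var_list 1 (i - 1) @ [Var i, Var (i + 1)] @ var_list (i + 2) n),
      otimes (var_list 1 (i - 1) @ [Var (i + 1), Var i] @ var_list (i + 2) n)) \<in> SC n"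
    unfolding SC_def using i by blast
  have "map (subst (nth_subst xs)) (var_list 1 (i - 1)) = as"
    using i lxs by (subst map_nth_subst) (auto simp: i_def xs_def)
  moreover have "map (subst (nth_subst xs)) (var_list (i + 2) n) = bs"
    using i lxs by (subst map_nth_subst) (auto simp: i_def xs_def)
  moreover have "nth_subst xs i = a" "nth_subst xs (i + 1) = b"
    by (auto simp: nth_subst_def i_def xs_def nth_append)
  moreover have "nth_subst xs \<in> substs ar"
    using mem by (intro nth_subst_in_substs) (simp add: xs_def)
  ultimately show ?thesis using linked_equation[OF eqn, of "nth_subst xs"] by simp
qed

lemma linked_permute:
  assumes "otimes ts \<in> SC_terms" "mset ts = mset us"
  shows "linked (otimes ts) (otimes us)"
proof -
  \<comment> \<open>Membership in the terms is part of the relation, because \<open>linked\<close>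
    is reflexive on terms only.\<close>
  let ?P = "\<lambda>ts us. otimes ts \<in> SC_terms \<longrightarrow> otimes us \<in> SC_terms \<and> linked (otimes ts) (otimes us)"
  have "?P ts us"
  proof (rule mset_eq_adjacent_swaps[where P = ?P, OF _ _ _ assms(2)])
    fix as bs :: "(SC_symbol, nat) trm list" and a b
    show "?P (as @ a # b # bs) (as @ b # a # bs)"
      using linked_swap[of as bs a b] by (auto simp: App_in_terms)
  qed (use linked_refl linked_trans in blast)+
  then show ?thesis using assms(1) by blast
qed

section \<open>Right-nested normal forms\<close>

text \<open>Right combs: \<open>m\<close> symbols, each with \<open>n - 1\<close> variables and the
  rest of the comb as last argument, hence \<open>m * (n - 1) + 1\<close> variables. On lists of
  that length \<open>hd\<close> meets a singleton.\<close>

primrec comb :: "nat \<Rightarrow> nat list \<Rightarrow> (SC_symbol, nat) trm" where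
  "comb 0 xs = Var (hd xs)"
| "comb (Suc m) xs = otimes (map Var (take (n - 1) xs) @ [comb m (drop (n - 1) xs)])"

lemma comb_Suc_append:
  "length ys = n - 1 \<Longrightarrow> comb (Suc m) (ys @ xs) = otimes (map Var ys @ [comb m xs])"
  by simp

lemma comb_in_terms: "length xs = m * (n - 1) + 1 \<Longrightarrow> comb m xs \<in> SC_terms"
proof (induction m arbitrary: xs)
  case (Suc m)
  have "comb m (drop (n - 1) xs) \<in> SC_terms" using Suc by simp
  then show ?case using Suc.prems n2 by (auto simp: App_in_terms)
qed simp

text \<open>The pair lies below the top symbol, among the variables of the top symbol, or straddles
  the two. In the last case, unless the lower part is a single variable, associativity lifts both
  into one inner product, where commutativity applies, and is then undone.\<close>

lemma comb_swap:
  "length (as @ a # b # bs) = m * (n - 1) + 1 \<Longrightarrow>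
     linked (comb m (as @ a # b # bs)) (comb m (as @ b # a # bs))"
proof (induction m arbitrary: as)
  case (Suc m)
  let ?V = "Var :: nat \<Rightarrow> (SC_symbol, nat) trm"
  consider "n - 1 \<le> length as" | "length as + 2 \<le> n - 1" | "length as + 2 = n"
    using n2 by linarith
  then show ?case
  proof cases
    case 1
    define as1 as2 where "as1 = take (n - 1) as" and "as2 = drop (n - 1) as"
    have as: "as = as1 @ as2" "length as1 = n - 1" using 1 by (auto simp: as1_def as2_def)
    have len: "length (as2 @ a # b # bs) = m * (n - 1) + 1" using Suc.prems as by simp
    have comb: "comb (Suc m) (as @ ys) = otimes (map ?V as1 @ [comb m (as2 @ ys)])" for ys
      using as by simp
    have "linked (comb m (as2 @ a # b # bs)) (comb m (as2 @ b # a # bs))"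
      by (rule Suc.IH[OF len])
    then show ?thesis
      unfolding comb using comb_in_terms[OF len] as(2) n2
      by (intro linked_context) (auto simp: App_in_terms)
  next
    case 2
    \<comment> \<open>Besides \<open>as\<close> and the swapped pair, the top symbol carries
      \<open>n - 3 - length as\<close> further variables.\<close>
    define ds es where "ds = take (n - 3 - length as) bs" and "es = drop (n - 3 - length as) bs"
    have bs: "bs = ds @ es" by (simp add: ds_def es_def)
    have lds: "length as + length ds + 3 = n"
      using Suc.prems 2 n2 by (auto simp: ds_def min_def)
    have len: "length es = m * (n - 1) + 1" using Suc.prems lds bs by simp
    have comb: "comb (Suc m) (as @ x # y # bs) = otimes (map ?V as @ Var x # Var y # (map ?V ds @ [comb m es]))" for x y
      using comb_Suc_append[of "as @ x # y # ds" m es] lds bs by simp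
    show ?thesis
      unfolding comb using comb_in_terms[OF len] lds
      by (intro linked_swap) (auto intro: terms.Var)
  next
    case 3
    have last: "comb (Suc m) (as @ x # y # bs) = otimes (map ?V as @ Var x # [comb m (y # bs)])" for x y
      using comb_Suc_append[of "as @ [x]" m "y # bs"] 3 by simp
    have len: "length bs = m * (n - 1)" using Suc.prems 3 by simp
    show ?thesis
    proof (cases m)
      \<comment> \<open>The last argument is a single variable, so the swap is an instance of
        commutativity.\<close>
      case 0
      then show ?thesis
        unfolding last using 0 3 linked_swap[of "map ?V as" "[]" "Var a" "Var b"] by simp
    next
      case (Suc m')
      define ds es where "ds = take (n - 2) bs" and "es = drop (n - 2) bs"
      have bs: "bs = ds @ es" by (simp add: ds_def es_def)
      have lds: "length ds + 2 = n"
        using len Suc n2 by (auto simp: ds_def min_def)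
      have les: "length es = m' * (n - 1) + 1" using len lds bs Suc by simp
      have inner: "comb m (y # bs) = otimes (Var y # map ?V ds @ [comb m' es])" for y
        using comb_Suc_append[of "y # ds" m' es] lds bs Suc by simp
      \<comment> \<open>\<open>Var x\<close> joins \<open>Var y\<close> in an inner product, and the
        rest of the comb moves out to become the last argument.\<close>
      have assoc: "linked (otimes (map ?V as @ Var x # [comb m (y # bs)]))
         (otimes (map ?V as @ otimes (Var x # Var y # map ?V ds) # [comb m' es]))" for x y
        unfolding inner
        using linked_assoc[of "Var y # map ?V ds" "map ?V as" "[]" "Var x" "comb m' es"]
          lds 3 comb_in_terms[OF les] by auto
      have "linked (otimes (Var a # Var b # map ?V ds)) (otimes (Var b # Var a # map ?V ds))"
        using linked_swap[of "[]" "map ?V ds" "Var a" "Var b"] lds by auto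
      then have "linked (otimes (map ?V as @ otimes (Var a # Var b # map ?V ds) # [comb m' es]))
          (otimes (map ?V as @ otimes (Var b # Var a # map ?V ds) # [comb m' es]))"
        using lds 3 comb_in_terms[OF les] by (intro linked_context) (auto simp: App_in_terms)
      then show ?thesis
        unfolding last using assoc linked_sym linked_trans by blast
    qed
  qed
qed simp

lemma comb_permute:
  assumes "length xs = m * (n - 1) + 1" "mset xs = mset ys"
  shows "linked (comb m xs) (comb m ys)"
proof -
  let ?P = "\<lambda>xs ys. length xs = m * (n - 1) + 1 \<longrightarrow>
      length ys = m * (n - 1) + 1 \<and> linked (comb m xs) (comb m ys)"
  have "?P xs ys"
  proof (rule mset_eq_adjacent_swaps[where P = ?P, OF _ _ _ assms(2)])
    fix as bs :: "nat list" and a b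
    show "?P (as @ a # b # bs) (as @ b # a # bs)" using comb_swap[of as a b bs m] by auto
  qed (use linked_refl comb_in_terms linked_trans in blast)+
  then show ?thesis using assms(1) by blast
qed

section \<open>Reduction of an arbitrary term to a right comb\<close>

primrec weight :: "(SC_symbol, nat) trm \<Rightarrow> nat" where
  "weight (Var x) = 1"
| "weight (App f ts) = Suc (sum_list (map weight ts))"

text \<open>Pulling a compound argument \<open>\<otimes>(b, \<dots>)\<close> from a non-last position into the last
  argument keeps the weight and decreases the weight of the non-last arguments.\<close>

lemma linked_comb_otimes:
  assumes IH: "\<And>v. weight v < W \<Longrightarrow> v \<in> SC_terms \<Longrightarrow>
      \<exists>m xs. length xs = m * (n - 1) + 1 \<and> mset xs = mset (var_seq v) \<and> linked v (comb m xs)"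
  shows "weight (otimes ts) = W \<Longrightarrow> otimes ts \<in> SC_terms \<Longrightarrow>
    \<exists>m xs. length xs = m * (n - 1) + 1 \<and> mset xs = mset (var_seq (otimes ts)) \<and> linked (otimes ts) (comb m xs)"
proof (induction "sum_list (map weight (butlast ts))" arbitrary: ts rule: less_induct)
  case (less ts)
  have ts: "length ts = n" "set ts \<subseteq> SC_terms" using less.prems(2) by (auto simp: App_in_terms)
  define init c where "init = butlast ts" and "c = last ts"
  have "ts \<noteq> []" using ts(1) n2 by auto
  then have ts_eq: "ts = init @ [c]" by (simp add: init_def c_def)
  show ?case
  proof (cases "set init \<subseteq> range Var")
    case True
    then obtain ys where ys: "init = map Var ys" by (metis ex_map_conv image_iff subsetD)
    \<comment> \<open>The other arguments are variables already, so only the last one has to be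
      normalised, and it is lighter than the whole term.\<close>
    have "weight c < W" using less.prems(1) ts_eq by simp
    moreover have "c \<in> SC_terms" using ts(2) unfolding ts_eq by simp
    ultimately obtain m xs where c: "length xs = m * (n - 1) + 1" "mset xs = mset (var_seq c)" "linked c (comb m xs)"
      using IH by blast
    have lys: "length ys = n - 1" using ts(1) ts_eq ys by simp
    have "linked (otimes ts) (comb (Suc m) (ys @ xs))"
      unfolding comb_Suc_append[OF lys] ts_eq ys
      using c(3) less.prems(2) unfolding ts_eq ys by (intro linked_context)
    moreover have "mset (ys @ xs) = mset (var_seq (otimes ts))"
      using c(2) by (simp add: ts_eq ys concat_var_seq_Var)
    moreover have "length (ys @ xs) = Suc m * (n - 1) + 1" using lys c(1) by simp
    ultimately show ?thesis by blast
  next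
    case False
    then obtain d where d: "d \<in> set init" "d \<notin> range Var" by blast
    from d(2) obtain f bs0 where "d = App f bs0" by (cases d) auto
    moreover have "f = Otimes" by (cases f)
    ultimately have d_eq: "d = otimes bs0" by simp
    have bs0: "length bs0 = n" "set bs0 \<subseteq> SC_terms"
    proof -
      have "d \<in> SC_terms" using d(1) ts(2) ts_eq by auto
      then show "length bs0 = n" "set bs0 \<subseteq> SC_terms" by (simp_all add: d_eq App_in_terms)
    qed
    then obtain b bs where bs: "bs0 = b # bs" "length bs = n - 1" using n2 by (cases bs0) auto
    obtain as1 as2 where init: "init = as1 @ d # as2" using d(1) by (meson split_list)
    define as where "as = as1 @ as2"
    have las: "length as + 2 = n" using ts(1) ts_eq init by (simp add: as_def)
    have mem: "set as \<subseteq> SC_terms" "b \<in> SC_terms" "set bs \<subseteq> SC_terms" "c \<in> SC_terms" "d \<in> SC_terms"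
      using ts ts_eq init bs bs0 by (auto simp: as_def)
    define ts' where "ts' = as @ b # [otimes (bs @ [c])]"
    \<comment> \<open>Commutativity brings the compound argument next to the last one;
      associativity, read from right to left, then moves all but its first component into the last
      argument.\<close>
    have "linked (otimes ts) (otimes (as @ d # [c]))"
      by (rule linked_permute[OF less.prems(2)]) (simp add: ts_eq init as_def)
    moreover have "linked (otimes (as @ d # [c])) (otimes ts')"
      unfolding ts'_def d_eq bs(1)
      by (rule linked_sym, rule linked_assoc) (use bs(2) las mem in auto)
    ultimately have conn: "linked (otimes ts) (otimes ts')" by (rule linked_trans)
    have "weight b < weight d" by (simp add: d_eq bs(1))
    then have "sum_list (map weight (butlast ts')) < sum_list (map weight (butlast ts))"
      by (simp add: ts'_def ts_eq init as_def butlast_append)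
    moreover have "weight (otimes ts') = W"
      using less.prems(1) by (simp add: ts'_def ts_eq init as_def d_eq bs(1))
    moreover have "otimes ts' \<in> SC_terms" using linked_in_terms[OF conn] by blast
    ultimately obtain m xs where "length xs = m * (n - 1) + 1" "mset xs = mset (var_seq (otimes ts'))"
      "linked (otimes ts') (comb m xs)"
      using less.hyps by blast
    moreover have "mset (var_seq (otimes ts')) = mset (var_seq (otimes ts))"
      by (simp add: ts'_def ts_eq init as_def d_eq bs(1))
    ultimately show ?thesis using conn linked_trans by metis
  qed
qed

lemma linked_comb:
  "u \<in> SC_terms \<Longrightarrow>
    \<exists>m xs. length xs = m * (n - 1) + 1 \<and> mset xs = mset (var_seq u) \<and> linked u (comb m xs)"
proof (induction "weight u" arbitrary: u rule: less_induct)
  case (less u)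
  show ?case
  proof (cases u)
    case (Var x)
    then show ?thesis using linked_refl by (intro exI[of _ 0] exI[of _ "[x]"]) simp
  next
    case (App f ts)
    have "f = Otimes" by (cases f)
    then show ?thesis
      using linked_comb_otimes[of "weight u" ts] less App by blast
  qed
qed

lemma linked_mset:
  assumes "u \<in> SC_terms" "v \<in> SC_terms" "mset (var_seq u) = mset (var_seq v)"
  shows "linked u v"
proof -
  obtain m xs where u: "length xs = m * (n - 1) + 1" "mset xs = mset (var_seq u)" "linked u (comb m xs)"
    using linked_comb[OF assms(1)] by blast
  obtain m' ys where v: "length ys = m' * (n - 1) + 1" "mset ys = mset (var_seq v)" "linked v (comb m' ys)"
    using linked_comb[OF assms(2)] by blast
  have eq: "mset xs = mset ys" using u(2) v(2) assms(3) by simp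
  then have "length xs = length ys" by (rule mset_eq_length)
  \<comment> \<open>Equally many variables force equally many symbols, as
    \<open>n - 1 > 0\<close>.\<close>
  then have "m * (n - 1) = m' * (n - 1)" using u(1) v(1) by simp
  then have "m = m'" using n2 by simp
  then have "linked (comb m xs) (comb m' ys)" using comb_permute[OF u(1) eq] by simp
  then show ?thesis using u(3) v(3) linked_trans linked_sym by blast
qed

lemma map_bij_onto:
  assumes "q \<in> \<Gamma>"
  shows "\<exists>f\<in>maps. map_bij f = q"
proof -
  obtain d where d: "d \<in> tree_diagrams n" "symbol_map d = q"
    using symbol_class_nonempty[OF assms] by (auto simp: symbol_class_def)
  obtain T1 T2 \<sigma> where "d = (T1, T2, \<sigma>)" by (cases d)
  with d obtain u v where uv: "linear_pair u v" "match_rel u v = q"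
    using symbol_map_match_rel by metis
  then have lin: "u \<in> SC_terms" "v \<in> SC_terms" "distinct (var_seq u)" "distinct (var_seq v)" "vars u = vars v"
    by (auto simp: linear_pair_def)
  then have "mset (var_seq u) = mset (var_seq v)"
    by (simp flip: set_eq_iff_mset_eq_distinct)
  then obtain f where f: "f \<in> maps" "(u, v) \<in> f"
    using linked_mset lin unfolding linked_def by blast
  \<comment> \<open>Both bijections represent the single pair \<open>(u, v)\<close>, and linearity
    of \<open>u\<close> leaves room for only one.\<close>
  have "represents (map_bij f) {(u, v)}"
    using map_bij(2)[OF f(1)] f(2) unfolding represents_def by blast
  moreover have "represents q {(u, v)}"
    using uv(2) unfolding represents_def match_rel_def by blast
  ultimately have "map_bij f = q"
    using represents_unique[OF \<Gamma>_word_bij[OF map_bij(1)[OF f(1)]] \<Gamma>_word_bij[OF assms]] lin by blast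
  then show ?thesis using f(1) by blast
qed

section \<open>The structure group\<close>

definition map_class :: "nat stream rel \<Rightarrow> (SC_symbol, nat) trm rel set" where
  "map_class q = {f \<in> maps. map_bij f = q}"

lemma idem_cong_Struct:
  "idem_cong (Struct ar (SC n)) = {(f, g). f \<in> maps \<and> g \<in> maps \<and> map_bij f = map_bij g}"
proof (intro equalityI subrelI)
  let ?M = "Struct ar (SC n)"
  have M: "carrier ?M = maps" "\<And>f g. f \<otimes>\<^bsub>?M\<^esub> g = f O g" "\<one>\<^bsub>?M\<^esub> = Id_on SC_terms"
    by (simp_all add: Struct_def)
  show "(f, g) \<in> {(f, g). f \<in> maps \<and> g \<in> maps \<and> map_bij f = map_bij g}" if "(f, g) \<in> idem_cong ?M" for f g
    using that
  proof (induction rule: idem_cong.induct)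
    case (idem e)
    then show ?case using map_bij_idem map_bij_Id Struct_maps.identity by (simp add: M)
  next
    case (mult a b c d)
    then show ?case using map_bij_comp Struct_maps.composite[where E = "SC n"] by (auto simp: M)
  qed (auto simp: M)
  show "(f, g) \<in> idem_cong ?M" if "(f, g) \<in> {(f, g). f \<in> maps \<and> g \<in> maps \<and> map_bij f = map_bij g}" for f g
  proof -
    have fg: "f \<in> maps" "g \<in> maps" "map_bij f = map_bij g" using that by auto
    have g': "g\<inverse> \<in> maps" using fg(2) by (rule maps_converse)
    have idem: "(e, Id_on SC_terms) \<in> idem_cong ?M" if "e \<in> maps" "map_bij e = Id_on \<Omega>" for e
      using idem_cong.idem[of e ?M] that map_bij_kernel by (simp add: M)
    have refl: "(e, e) \<in> idem_cong ?M" if "e \<in> maps" for e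
      using idem_cong.refl[of e ?M] that by (simp add: M)
    have unit: "Id_on SC_terms O e = e" "e O Id_on SC_terms = e" if "e \<in> maps" for e
      using maps_in_terms[OF that] by auto
    have 1: "(f O g\<inverse>, Id_on SC_terms) \<in> idem_cong ?M"
      using fg g' map_bij_comp[OF fg(1) g'] map_bij_converse[OF fg(2)]
        word_bij_comp_converse[OF \<Gamma>_word_bij[OF map_bij(1)[OF fg(2)]]]
      by (intro idem Struct_maps.composite) auto
    have 2: "(g\<inverse> O g, Id_on SC_terms) \<in> idem_cong ?M"
      using fg g' map_bij_comp[OF g' fg(2)] map_bij_converse[OF fg(2)]
        word_bij_comp_converse[OF word_bij_converse[OF \<Gamma>_word_bij[OF map_bij(1)[OF fg(2)]]]]
      by (intro idem Struct_maps.composite) auto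
    \<comment> \<open>One composite, two bracketings: the right one is congruent to
      \<open>f\<close>, the left one to \<open>g\<close>.\<close>
    have "(f O (g\<inverse> O g), f) \<in> idem_cong ?M"
      using idem_cong.mult[OF refl[OF fg(1)] 2] unit[OF fg(1)] by (simp add: M)
    moreover have "((f O g\<inverse>) O g, g) \<in> idem_cong ?M"
      using idem_cong.mult[OF 1 refl[OF fg(2)]] unit[OF fg(2)] by (simp add: M)
    ultimately show ?thesis
      unfolding O_assoc by (blast intro: idem_cong.sym idem_cong.trans)
  qed
qed

lemma idem_cong_class: "f \<in> maps \<Longrightarrow> idem_cong (Struct ar (SC n)) `` {f} = map_class (map_bij f)"
  unfolding idem_cong_Struct map_class_def by auto

lemma carrier_Struct_G: "carrier (Struct_G ar (SC n)) = map_class ` \<Gamma>"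
proof -
  have "carrier (Struct_G ar (SC n)) = (\<lambda>f. map_class (map_bij f)) ` maps"
    by (auto simp: Struct_G_def universal_group_def Struct_def quotient_def idem_cong_class[unfolded Struct_def])
  also have "\<dots> = map_class ` map_bij ` maps" by (simp add: image_image)
  also have "map_bij ` maps = \<Gamma>"
    using map_bij(1) map_bij_onto by blast
  finally show ?thesis .
qed

lemma inj_on_map_class: "inj_on map_class \<Gamma>"
proof (rule inj_onI)
  fix q q' assume "q \<in> \<Gamma>" "map_class q = map_class q'"
  moreover from this obtain f where "f \<in> map_class q"
    using map_bij_onto unfolding map_class_def by blast
  ultimately have "f \<in> map_class q" "f \<in> map_class q'" by auto
  then show "q = q'" by (simp add: map_class_def)
qed

lemma mult_Struct_G:
  assumes q: "q \<in> \<Gamma>" "q' \<in> \<Gamma>"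
  shows "map_class q \<otimes>\<^bsub>Struct_G ar (SC n)\<^esub> map_class q' = map_class (q O q')"
proof -
  have "idem_cong (Struct ar (SC n)) `` {f O g} = map_class (q O q')"
    if "f \<in> map_class q" "g \<in> map_class q'" for f g
    using that idem_cong_class[OF Struct_maps.composite] map_bij_comp by (auto simp: map_class_def)
  moreover have "\<exists>f. f \<in> map_class q" "\<exists>g. g \<in> map_class q'"
    using map_bij_onto q unfolding map_class_def by blast+
  ultimately have "(\<Union>f\<in>map_class q. \<Union>g\<in>map_class q'. idem_cong (Struct ar (SC n)) `` {f O g}) =
      map_class (q O q')"
    by auto
  then show ?thesis by (simp add: Struct_G_def universal_group_def Struct_def)
qed

lemma Struct_G_iso_G_n1: "Struct_G ar (SC n) \<cong> G_n1 n"
proof -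
  \<comment> \<open>Both carriers are indexed injectively by \<Gamma>, and \<open>?h\<close> passes
    through the common index.\<close>
  let ?h = "\<lambda>A. symbol_class (the_inv_into \<Gamma> map_class A)"
  have h: "?h (map_class q) = symbol_class q" if "q \<in> \<Gamma>" for q
    using the_inv_into_f_f[OF inj_on_map_class that] by simp
  have "?h \<in> hom (Struct_G ar (SC n)) (G_n1 n)"
  proof (rule homI)
    fix A B assume "A \<in> carrier (Struct_G ar (SC n))" "B \<in> carrier (Struct_G ar (SC n))"
    then obtain q q' where "q \<in> \<Gamma>" "q' \<in> \<Gamma>" "A = map_class q" "B = map_class q'"
      unfolding carrier_Struct_G by blast
    then show "?h A \<in> carrier (G_n1 n)"
      "?h (A \<otimes>\<^bsub>Struct_G ar (SC n)\<^esub> B) = ?h A \<otimes>\<^bsub>G_n1 n\<^esub> ?h B"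
      using \<Gamma>_comp by (simp_all add: h mult_Struct_G mult_G_n1 carrier_G_n1)
  qed
  moreover have "bij_betw ?h (carrier (Struct_G ar (SC n))) (carrier (G_n1 n))"
  proof -
    have "bij_betw (the_inv_into \<Gamma> map_class) (map_class ` \<Gamma>) \<Gamma>"
      using bij_betw_the_inv_into[OF inj_on_imp_bij_betw[OF inj_on_map_class]] .
    moreover have "bij_betw symbol_class \<Gamma> (symbol_class ` \<Gamma>)"
      using inj_on_imp_bij_betw[OF inj_on_symbol_class] .
    ultimately show ?thesis
      unfolding carrier_Struct_G carrier_G_n1 using bij_betw_trans by (fastforce simp: comp_def)
  qed
  ultimately show ?thesis unfolding is_iso_def iso_def by blast
qed

end

theorem theorem5p2p13:
  fixes n :: nat
  assumes "n \<ge> 2"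
  shows "Struct_G (SC_arity n) (SC n) \<cong> G_n1 n"
  using catalan.Struct_G_iso_G_n1 assms by (simp add: catalan_def)

end
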